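(* Let $X$ be a $\sigma$-compact smooth manifold with compact boundary, let $\mathfrak{k}$ be a finite-dimensional real Lie algebra and $\mathfrak{K}\to X$ a smooth Lie algebra bundle with typical fiber $\mathfrak{k}$. Let $\mathfrak{n}\trianglelefteq\mathfrak{k}$ be the minimal ideal for which $\mathfrak{k}/\mathfrak{n}$ is a compact Lie algebra, and let $\mathfrak{N}\subseteq\mathfrak{K}$ be the corresponding subbundle. If $\overline{\pi}\colon\Gamma_c(\mathfrak{K})\to\mathfrak{pu}(\mathcal{H})$ is a bounded projective unitary representation, then $\Gamma_c(\mathfrak{N})\subseteq\ker\overline{\pi}$.
   Context: A finite-dimensional real Lie algebra is compact if it admits a norm invariant under its adjoint group $\langle e^{\operatorname{ad}\mathfrak{k}}\rangle$ (equivalently, its adjoint group is relatively compact in $\mathrm{GL}(\mathfrak{k})$). Every finite-dimensional real Lie algebra $\mathfrak{k}$ has a unique minimal ideal $\mathfrak{n}$ with compact quotient; it is $\mathrm{Aut}(\mathfrak{k})$-invariant, so it defines a subbundle $\mathfrak{N}\subseteq\mathfrak{K}$ with fibers isomorphic to $\mathfrak{n}$. $\Gamma(\mathfrak{K})$ is the Lie algebra (pointwise bracket) of sections that are smooth on the interior of $X$ and whose derivatives extend continuously to the boundary, with the smooth compact-open topology; $\Gamma_c(\mathfrak{K})$ is the subalgebra of compactly supported sections with the locally convex direct limit topology of the Fréchet spaces $\{s:\operatorname{supp}(s)\subseteq C\}$, $C\subseteq X$ compact. For a complex Hilbert space $\mathcal{H}$, $\mathfrak{u}(\mathcal{H})$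 is the Banach–Lie algebra of bounded skew-hermitian operators and $\mathfrak{pu}(\mathcal{H})=\mathfrak{u}(\mathcal{H})/i\mathbb{R}\mathbf{1}$ has the quotient norm. A bounded projective unitary representation is a continuous Lie algebra homomorphism into $\mathfrak{pu}(\mathcal{H})$. *)

theory Defs
  imports "HOL-Analysis.Analysis" "HOL-Algebra.QuotRing" "HOL-Algebra.Module"
begin

section \<open>Real Lie algebras\<close>

text \<open>
  A real Lie algebra is a module over the field of real numbers, given by the library record
  \<^type>\<open>module\<close>, whose multiplication is the Lie bracket; the \<open>one\<close> field of the record
  plays no role.
\<close>

definition real_ring :: "real ring" where
  "real_ring = \<lparr>carrier = UNIV, mult = (*), one = 1, zero = 0, add = (+)\<rparr>"

lemma real_ring_cring: "cring real_ring"
proof (rule cringI)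
  show "abelian_group real_ring"
  proof (rule abelian_groupI)
    fix x :: real
    show "\<exists>y\<in>carrier real_ring. y \<oplus>\<^bsub>real_ring\<^esub> x = \<zero>\<^bsub>real_ring\<^esub>"
      by (rule bexI[of _ "- x"]) (auto simp: real_ring_def)
  qed (auto simp: real_ring_def)
  show "comm_monoid real_ring"
    by (rule comm_monoidI) (auto simp: real_ring_def)
qed (auto simp: real_ring_def algebra_simps)

locale lie_algebra = module real_ring L for L :: "(real, 'a) module" (structure) +
  assumes bracket_closed: "\<lbrakk>x \<in> carrier L; y \<in> carrier L\<rbrakk> \<Longrightarrow> x \<otimes> y \<in> carrier L"
    and bracket_add_left:
      "\<lbrakk>x \<in> carrier L; y \<in> carrier L; z \<in> carrier L\<rbrakk> \<Longrightarrow> (x \<oplus> y) \<otimes> z = (x \<otimes> z) \<oplus> (y \<otimes> z)"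
    and bracket_add_right:
      "\<lbrakk>x \<in> carrier L; y \<in> carrier L; z \<in> carrier L\<rbrakk> \<Longrightarrow> z \<otimes> (x \<oplus> y) = (z \<otimes> x) \<oplus> (z \<otimes> y)"
    and bracket_smult_left:
      "\<lbrakk>x \<in> carrier L; y \<in> carrier L\<rbrakk> \<Longrightarrow> (r \<odot> x) \<otimes> y = r \<odot> (x \<otimes> y)"
    and bracket_smult_right:
      "\<lbrakk>x \<in> carrier L; y \<in> carrier L\<rbrakk> \<Longrightarrow> x \<otimes> (r \<odot> y) = r \<odot> (x \<otimes> y)"
    and bracket_alternating: "x \<in> carrier L \<Longrightarrow> x \<otimes> x = \<zero>"
    and jacobi:
      "\<lbrakk>x \<in> carrier L; y \<in> carrier L; z \<in> carrier L\<rbrakk> \<Longrightarrow>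
        (x \<otimes> (y \<otimes> z)) \<oplus> (y \<otimes> (z \<otimes> x)) \<oplus> (z \<otimes> (x \<otimes> y)) = \<zero>"

definition lie_hom :: "(real, 'a) module \<Rightarrow> (real, 'b) module \<Rightarrow> ('a \<Rightarrow> 'b) set" where
  "lie_hom L M = {h \<in> carrier L \<rightarrow> carrier M.
     (\<forall>x\<in>carrier L. \<forall>y\<in>carrier L.
        h (x \<oplus>\<^bsub>L\<^esub> y) = h x \<oplus>\<^bsub>M\<^esub> h y \<and> h (x \<otimes>\<^bsub>L\<^esub> y) = h x \<otimes>\<^bsub>M\<^esub> h y) \<and>
     (\<forall>r. \<forall>x\<in>carrier L. h (r \<odot>\<^bsub>L\<^esub> x) = r \<odot>\<^bsub>M\<^esub> h x)}"

definition lie_iso :: "(real, 'a) module \<Rightarrow> (real, 'b) module \<Rightarrow> ('a \<Rightarrow> 'b) set" where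
  "lie_iso L M = {h \<in> lie_hom L M. bij_betw h (carrier L) (carrier M)}"

definition lie_ideal :: "'a set \<Rightarrow> (real, 'a) module \<Rightarrow> bool" where
  "lie_ideal I L \<longleftrightarrow> submodule I real_ring L \<and> (\<forall>x\<in>carrier L. \<forall>v\<in>I. x \<otimes>\<^bsub>L\<^esub> v \<in> I)"

definition lie_quotient :: "(real, 'a) module \<Rightarrow> 'a set \<Rightarrow> (real, 'a set) module" where
  "lie_quotient L I =
     \<lparr>carrier = a_rcosets\<^bsub>L\<^esub> I, mult = rcoset_mult L I, one = I, zero = I, add = set_add L,
      smult = (\<lambda>r C. \<Union>v\<in>C. I +>\<^bsub>L\<^esub> (r \<odot>\<^bsub>L\<^esub> v))\<rparr>"

definition finite_dimensional :: "(real, 'a) module \<Rightarrow> bool" where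
  "finite_dimensional L \<longleftrightarrow>
     (\<exists>B. finite B \<and> B \<subseteq> carrier L \<and>
        (\<forall>v\<in>carrier L. \<exists>c. v = (\<Oplus>\<^bsub>L\<^esub>b\<in>B. c b \<odot>\<^bsub>L\<^esub> b)))"

definition linear_functionals :: "(real, 'a) module \<Rightarrow> ('a \<Rightarrow> real) set" where
  "linear_functionals L = {l.
     (\<forall>v\<in>carrier L. \<forall>w\<in>carrier L. l (v \<oplus>\<^bsub>L\<^esub> w) = l v + l w) \<and>
     (\<forall>r. \<forall>v\<in>carrier L. l (r \<odot>\<^bsub>L\<^esub> v) = r * l v)}"

definition vector_norm :: "(real, 'a) module \<Rightarrow> ('a \<Rightarrow> real) \<Rightarrow> bool" where
  "vector_norm L N \<longleftrightarrow>
     (\<forall>v\<in>carrier L. 0 \<le> N v \<and> (N v = 0 \<longleftrightarrow> v = \<zero>\<^bsub>L\<^esub>)) \<and>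
     (\<forall>r. \<forall>v\<in>carrier L. N (r \<odot>\<^bsub>L\<^esub> v) = \<bar>r\<bar> * N v) \<and>
     (\<forall>v\<in>carrier L. \<forall>w\<in>carrier L. N (v \<oplus>\<^bsub>L\<^esub> w) \<le> N v + N w)"

text \<open>
  The value at \<open>y\<close> of \<open>exp (ad x)\<close> in a finite-dimensional Lie algebra. Convergence of
  the exponential series in the canonical topology of a finite-dimensional space is convergence
  under all linear functionals.
\<close>

definition exp_ad :: "(real, 'a) module \<Rightarrow> 'a \<Rightarrow> 'a \<Rightarrow> 'a" where
  "exp_ad L x y = (THE z. z \<in> carrier L \<and>
     (\<forall>l\<in>linear_functionals L. (\<lambda>j. l (((\<lambda>v. x \<otimes>\<^bsub>L\<^esub> v) ^^ j) y) / fact j) sums l z))"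

text \<open>
  The group generated by the \<open>exp (ad x)\<close>. No clause for inverses is needed, because the
  inverse of \<open>exp (ad x)\<close> is \<open>exp (ad (-x))\<close>. Only the values of the maps on the carrier matter.
\<close>

inductive_set adjoint_group :: "(real, 'a) module \<Rightarrow> ('a \<Rightarrow> 'a) set"
  for L :: "(real, 'a) module" where
  one: "id \<in> adjoint_group L"
| step: "\<lbrakk>g \<in> adjoint_group L; x \<in> carrier L\<rbrakk> \<Longrightarrow> exp_ad L x \<circ> g \<in> adjoint_group L"

definition compact_lie_algebra :: "(real, 'a) module \<Rightarrow> bool" where
  "compact_lie_algebra L \<longleftrightarrow> lie_algebra L \<and> finite_dimensional L \<and>
     (\<exists>N. vector_norm L N \<and> (\<forall>g\<in>adjoint_group L. \<forall>v\<in>carrier L. N (g v) = N v))"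

definition minimal_cocompact_ideal :: "'a set \<Rightarrow> (real, 'a) module \<Rightarrow> bool" where
  "minimal_cocompact_ideal I L \<longleftrightarrow>
     lie_ideal I L \<and> compact_lie_algebra (lie_quotient L I) \<and>
     (\<forall>J. lie_ideal J L \<and> compact_lie_algebra (lie_quotient L J) \<and> J \<subseteq> I \<longrightarrow> J = I)"

text \<open>
  The locally convex topology of a family of seminorms. The carrier is added to the subbasis so
  that it is the whole space even if the family is empty.
\<close>

definition seminorm_topology :: "(real, 'a) module \<Rightarrow> ('a \<Rightarrow> real) set \<Rightarrow> 'a topology" where
  "seminorm_topology L P = topology_generated_by
     (insert (carrier L)
       {{w \<in> carrier L. p (w \<ominus>\<^bsub>L\<^esub> v) < \<epsilon>} | v p \<epsilon>. v \<in> carrier L \<and> p \<in> P \<and> 0 < \<epsilon>})"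

definition convex_in :: "(real, 'a) module \<Rightarrow> 'a set \<Rightarrow> bool" where
  "convex_in L W \<longleftrightarrow>
     (\<forall>v\<in>W. \<forall>w\<in>W. \<forall>t\<in>{0..1}. (t \<odot>\<^bsub>L\<^esub> v) \<oplus>\<^bsub>L\<^esub> ((1 - t) \<odot>\<^bsub>L\<^esub> w) \<in> W)"


section \<open>Smooth manifolds with boundary\<close>

text \<open>
  The Euclidean space of dimension \<open>n\<close> is modelled by an \<open>n\<close>-dimensional linear subspace \<open>V\<close> of
  a Euclidean space; since \<^class>\<open>euclidean_space\<close> has no zero-dimensional instance, this is what
  makes \<open>n = 0\<close> possible. Derivatives are Frechet derivatives within \<open>V\<close>, which are unique
  on vectors of \<open>V\<close>.
\<close>

primrec iterated_deriv ::
  "'e::euclidean_space set \<Rightarrow> 'e list \<Rightarrow> ('e \<Rightarrow> 'f::real_normed_vector) \<Rightarrow> 'e \<Rightarrow> 'f" where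
  "iterated_deriv V [] f = f"
| "iterated_deriv V (v # vs) f = (\<lambda>x. frechet_derivative (iterated_deriv V vs f) (at x within V) v)"

text \<open>
  Smoothness on a relatively open subset \<open>S\<close> of \<open>V\<close> or of a half-space of \<open>V\<close>: smooth on the
  interior, and all derivatives extend continuously to \<open>S\<close>.
\<close>

definition smooth_upto_boundary ::
  "'e::euclidean_space set \<Rightarrow> 'e set \<Rightarrow> ('e \<Rightarrow> 'f::real_normed_vector) \<Rightarrow> bool" where
  "smooth_upto_boundary V S f \<longleftrightarrow>
     continuous_on S f \<and>
     (\<forall>vs\<in>lists V.
        (\<forall>x \<in> top_of_set V interior_of S. iterated_deriv V vs f differentiable (at x within V)) \<and>
        (\<exists>g. continuous_on S g \<and>
           (\<forall>x \<in> top_of_set V interior_of S. g x = iterated_deriv V vs f x)))"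

record ('m, 'e) manifold =
  points :: "'m topology"
  model :: "'e set"
  conormal :: 'e
  atlas :: "('m set \<times> ('m \<Rightarrow> 'e)) set"

text \<open>
  If the vector \<open>conormal X\<close> is zero, the following is the whole model space; this is the only
  possibility in dimension zero.
\<close>

definition model_half_space :: "('m, 'e::euclidean_space) manifold \<Rightarrow> 'e set" where
  "model_half_space X = {v \<in> model X. 0 \<le> conormal X \<bullet> v}"

definition smooth_manifold :: "('m, 'e::euclidean_space) manifold \<Rightarrow> bool" where
  "smooth_manifold X \<longleftrightarrow>
     Hausdorff_space (points X) \<and> subspace (model X) \<and> conormal X \<in> model X \<and>
     (\<forall>(U, \<phi>)\<in>atlas X.
        openin (points X) U \<and> openin (top_of_set (model_half_space X)) (\<phi> ` U) \<and>
        homeomorphic_map (subtopology (points X) U) (top_of_set (\<phi> ` U)) \<phi>) \<and>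
     (\<Union>(U, \<phi>)\<in>atlas X. U) = topspace (points X) \<and>
     (\<forall>(U, \<phi>)\<in>atlas X. \<forall>(U', \<phi>')\<in>atlas X.
        smooth_upto_boundary (model X) (\<phi> ` (U \<inter> U')) (\<phi>' \<circ> inv_into U \<phi>))"

definition manifold_boundary :: "('m, 'e::euclidean_space) manifold \<Rightarrow> 'm set" where
  "manifold_boundary X = {x. \<exists>(U, \<phi>)\<in>atlas X.
     x \<in> U \<and> \<phi> x \<notin> top_of_set (model X) interior_of (\<phi> ` U)}"

definition sigma_compact_space :: "'m topology \<Rightarrow> bool" where
  "sigma_compact_space T \<longleftrightarrow>
     (\<exists>\<C>. countable \<C> \<and> (\<forall>C\<in>\<C>. compactin T C) \<and> \<Union>\<C> = topspace T)"

definition smooth_function ::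
  "('m, 'e::euclidean_space) manifold \<Rightarrow> 'm set \<Rightarrow> ('m \<Rightarrow> real) \<Rightarrow> bool" where
  "smooth_function X W f \<longleftrightarrow>
     (\<forall>(U, \<phi>)\<in>atlas X. smooth_upto_boundary (model X) (\<phi> ` (U \<inter> W)) (f \<circ> inv_into U \<phi>))"


section \<open>Lie algebra bundles and their sections\<close>

text \<open>
  A bundle is given by its fibers and by an atlas of local trivializations \<open>(U, \<psi>)\<close>, where
  \<open>\<psi> x\<close> identifies the fiber over \<open>x \<in> U\<close> with the typical fiber. The total space is the
  disjoint union of the fibers (which need not be disjoint as sets), with the manifold structure
  determined by the trivializations. A map into a finite-dimensional space (or into its
  automorphism group) is smooth iff its compositions with linear functionals (its matrix
  coefficients) are.
\<close>

record ('m, 'b, 'g) fiber_bundle =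
  fiber :: "'m \<Rightarrow> (real, 'b) module"
  trivializations :: "('m set \<times> ('m \<Rightarrow> 'b \<Rightarrow> 'g)) set"

definition lie_algebra_bundle ::
  "('m, 'e::euclidean_space) manifold \<Rightarrow> (real, 'g) module \<Rightarrow> ('m, 'b, 'g) fiber_bundle \<Rightarrow> bool" where
  "lie_algebra_bundle X \<kk> K \<longleftrightarrow>
     (\<forall>x\<in>topspace (points X). lie_algebra (fiber K x)) \<and>
     (\<forall>(U, \<psi>)\<in>trivializations K.
        openin (points X) U \<and> (\<forall>x\<in>U. \<psi> x \<in> lie_iso (fiber K x) \<kk>)) \<and>
     (\<Union>(U, \<psi>)\<in>trivializations K. U) = topspace (points X) \<and>
     (\<forall>(U, \<psi>)\<in>trivializations K. \<forall>(U', \<psi>')\<in>trivializations K.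
        \<forall>v\<in>carrier \<kk>. \<forall>l\<in>linear_functionals \<kk>.
          smooth_function X (U \<inter> U')
            (\<lambda>x. l (\<psi>' x (inv_into (carrier (fiber K x)) (\<psi> x) v))))"

text \<open>
  The subbundle belonging to an \<open>Aut(\<kk>)\<close>-invariant subspace \<open>I\<close> of the typical fiber \<open>\<kk>\<close>. By
  invariance, the condition on \<open>v\<close> does not depend on the trivialization around \<open>x\<close>.
\<close>

definition subbundle :: "('m, 'b, 'g) fiber_bundle \<Rightarrow> 'g set \<Rightarrow> ('m, 'b, 'g) fiber_bundle" where
  "subbundle K I = K\<lparr>fiber := (\<lambda>x. (fiber K x)
     \<lparr>carrier := {v \<in> carrier (fiber K x). \<forall>(U, \<psi>)\<in>trivializations K. x \<in> U \<longrightarrow> \<psi> x v \<in> I}\<rparr>)\<rparr>"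

definition smooth_sections ::
  "('m, 'e::euclidean_space) manifold \<Rightarrow> (real, 'g) module \<Rightarrow> ('m, 'b, 'g) fiber_bundle
     \<Rightarrow> ('m \<Rightarrow> 'b) set" where
  "smooth_sections X \<kk> K = {s \<in> (\<Pi>\<^sub>E x\<in>topspace (points X). carrier (fiber K x)).
     \<forall>(U, \<psi>)\<in>trivializations K. \<forall>l\<in>linear_functionals \<kk>.
       smooth_function X U (\<lambda>x. l (\<psi> x (s x)))}"

definition section_support ::
  "('m, 'e) manifold \<Rightarrow> ('m, 'b, 'g) fiber_bundle \<Rightarrow> ('m \<Rightarrow> 'b) \<Rightarrow> 'm set" where
  "section_support X K s =
     points X closure_of {x \<in> topspace (points X). s x \<noteq> \<zero>\<^bsub>fiber K x\<^esub>}"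

definition compact_sections ::
  "('m, 'e::euclidean_space) manifold \<Rightarrow> (real, 'g) module \<Rightarrow> ('m, 'b, 'g) fiber_bundle
     \<Rightarrow> (real, 'm \<Rightarrow> 'b) module" where
  "compact_sections X \<kk> K =
     \<lparr>carrier = {s \<in> smooth_sections X \<kk> K. compactin (points X) (section_support X K s)},
      mult = (\<lambda>s t. \<lambda>x\<in>topspace (points X). s x \<otimes>\<^bsub>fiber K x\<^esub> t x),
      one = (\<lambda>x\<in>topspace (points X). \<zero>\<^bsub>fiber K x\<^esub>),
      zero = (\<lambda>x\<in>topspace (points X). \<zero>\<^bsub>fiber K x\<^esub>),
      add = (\<lambda>s t. \<lambda>x\<in>topspace (points X). s x \<oplus>\<^bsub>fiber K x\<^esub> t x),
      smult = (\<lambda>r s. \<lambda>x\<in>topspace (points X). r \<odot>\<^bsub>fiber K x\<^esub> s x)\<rparr>"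

definition sections_supported_in ::
  "('m, 'e::euclidean_space) manifold \<Rightarrow> (real, 'g) module \<Rightarrow> ('m, 'b, 'g) fiber_bundle \<Rightarrow> 'm set
     \<Rightarrow> (real, 'm \<Rightarrow> 'b) module" where
  "sections_supported_in X \<kk> K C = (compact_sections X \<kk> K)
     \<lparr>carrier := {s \<in> carrier (compact_sections X \<kk> K). section_support X K s \<subseteq> C}\<rparr>"

text \<open>
  The seminorms of the smooth compact-open topology: suprema of the derivatives, in local
  coordinates, over compact sets \<open>C\<close>. Derivatives are evaluated at interior points only; since
  they extend continuously and \<open>C\<close> may be enlarged, this gives the same topology as using
  the extended derivatives. The \<open>0\<close> accounts for sets \<open>C\<close> without interior points.
\<close>

definition smooth_seminorms ::
  "('m, 'e::euclidean_space) manifold \<Rightarrow> (real, 'g) module \<Rightarrow> ('m, 'b, 'g) fiber_bundle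
     \<Rightarrow> (('m \<Rightarrow> 'b) \<Rightarrow> real) set" where
  "smooth_seminorms X \<kk> K =
     {\<lambda>s. Sup (insert 0
         ((\<lambda>y. \<bar>iterated_deriv (model X) vs (\<lambda>y. l (\<psi> (inv_into U \<phi> y) (s (inv_into U \<phi> y)))) y\<bar>)
           ` (\<phi> ` C \<inter> (top_of_set (model X) interior_of (\<phi> ` U)))))
      | U \<phi> U' \<psi> l vs C.
        (U, \<phi>) \<in> atlas X \<and> (U', \<psi>) \<in> trivializations K \<and> l \<in> linear_functionals \<kk> \<and>
        vs \<in> lists (model X) \<and> compactin (points X) C \<and> C \<subseteq> U \<inter> U'}"

text \<open>
  The locally convex direct limit topology: the convex sets whose trace on every
  step \<open>sections_supported_in X \<kk> K C\<close> is open form a basis.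
\<close>

definition compact_sections_topology ::
  "('m, 'e::euclidean_space) manifold \<Rightarrow> (real, 'g) module \<Rightarrow> ('m, 'b, 'g) fiber_bundle
     \<Rightarrow> ('m \<Rightarrow> 'b) topology" where
  "compact_sections_topology X \<kk> K = topology_generated_by
     {W. W \<subseteq> carrier (compact_sections X \<kk> K) \<and> convex_in (compact_sections X \<kk> K) W \<and>
         (\<forall>C. compactin (points X) C \<longrightarrow>
            openin (seminorm_topology (sections_supported_in X \<kk> K C) (smooth_seminorms X \<kk> K))
              (W \<inter> carrier (sections_supported_in X \<kk> K C)))}"


section \<open>Bounded projective unitary representations\<close>

class complex_hilbert_space = banach +
  fixes scaleC :: "complex \<Rightarrow> 'a \<Rightarrow> 'a"
    and cinner :: "'a \<Rightarrow> 'a \<Rightarrow> complex"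
  assumes scaleC_add_right: "scaleC c (x + y) = scaleC c x + scaleC c y"
    and scaleC_add_left: "scaleC (c + d) x = scaleC c x + scaleC d x"
    and scaleC_scaleC: "scaleC c (scaleC d x) = scaleC (c * d) x"
    and scaleC_of_real: "scaleC (complex_of_real r) x = scaleR r x"
    and cinner_commute: "cinner x y = cnj (cinner y x)"
    and cinner_add_right: "cinner x (y + z) = cinner x y + cinner x z"
    and cinner_scaleC_right: "cinner x (scaleC c y) = c * cinner x y"
    and cinner_norm: "cinner x x = complex_of_real ((norm x)\<^sup>2)"

definition skew_hermitian_algebra ::
  "(real, 'h::complex_hilbert_space \<Rightarrow>\<^sub>L 'h) module" where
  "skew_hermitian_algebra =
     \<lparr>carrier = {A. (\<forall>c x. blinfun_apply A (scaleC c x) = scaleC c (blinfun_apply A x)) \<and>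
                    (\<forall>x y. cinner (blinfun_apply A x) y = - cinner x (blinfun_apply A y))},
      mult = (\<lambda>A B. (A o\<^sub>L B) - (B o\<^sub>L A)), one = 0, zero = 0, add = (+), smult = scaleR\<rparr>"

definition imaginary_scalars :: "('h::complex_hilbert_space \<Rightarrow>\<^sub>L 'h) set" where
  "imaginary_scalars = {A. \<exists>t::real. \<forall>x. blinfun_apply A x = scaleC (\<i> * complex_of_real t) x}"

definition projective_skew_hermitian_algebra ::
  "(real, ('h::complex_hilbert_space \<Rightarrow>\<^sub>L 'h) set) module" where
  "projective_skew_hermitian_algebra = lie_quotient skew_hermitian_algebra imaginary_scalars"

definition quotient_norm :: "'v::real_normed_vector set \<Rightarrow> real" where
  "quotient_norm C = Inf (norm ` C)"

definition bounded_projective_unitary_rep ::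
  "('m, 'e::euclidean_space) manifold \<Rightarrow> (real, 'g) module \<Rightarrow> ('m, 'b, 'g) fiber_bundle
     \<Rightarrow> (('m \<Rightarrow> 'b) \<Rightarrow> ('h::complex_hilbert_space \<Rightarrow>\<^sub>L 'h) set) \<Rightarrow> bool" where
  "bounded_projective_unitary_rep X \<kk> K \<pi> \<longleftrightarrow>
     \<pi> \<in> lie_hom (compact_sections X \<kk> K) projective_skew_hermitian_algebra \<and>
     continuous_map (compact_sections_topology X \<kk> K)
       (seminorm_topology projective_skew_hermitian_algebra {quotient_norm}) \<pi>"

end

(*
  Let p(s) be the quotient norm of \<pi>(s). If f is a smooth function with compact support in the
  domain of a trivialization, and \<eta> is another one with \<eta> f = f, then on the sections f v
  (v in the fiber) the operator ad(\<eta> y) acts as f v |-> f [y, v]. As \<pi>(\<eta> y) is skew-hermitian,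
  this makes q(v) = p(f v) a seminorm on the finite-dimensional Lie algebra \<kk> that is
  invariant under e^(ad y). Its kernel is an ideal with compact quotient; so is the intersection of
  the kernel with \<nn>, hence q vanishes on \<nn> by minimality. By bump functions and
  coordinates on \<nn>, every element of \<Gamma>_c(\<NN>) is a finite sum of sections f v with v in \<nn>.
*)
theory Submission
  imports Defs
begin

section \<open>Finite-dimensional real modules\<close>

text \<open>The link between operators and \<kk> is the one-step estimate q(v + h [y, v]) \<le> (1 +
  C h^2) q(v). It says that ad y acts by infinitesimal isometries, it is checked on operators by
  polynomial identities, and it survives the passage to the quotient norm; exponentials then occur
  only in finite-dimensional algebras, where convergence is coordinatewise. The function \<eta>
  makes the estimate possible: bracketing with f y instead would turn f into its square, and no
  seminorm would be compared with itself. Minimality of \<nn> speaks only of ideals inside \<nn>,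
  hence the intersection; its quotient is compact because a sum of invariant seminorms is invariant
  and vanishes exactly on the common null space. On the geometric side, boundary points are not
  treated apart: smoothness is characterized by closure under directional derivatives inside the
  model space, and extensions to the boundary are glued by continuity. No partition of unity is
  formed; one bump at a time is split off by s = \<rho> s + (1 - \<rho>) s.\<close>

lemma real_ring_simps [simp]:
  "carrier real_ring = UNIV" "x \<otimes>\<^bsub>real_ring\<^esub> y = x * y" "x \<oplus>\<^bsub>real_ring\<^esub> y = x + y"
  "\<one>\<^bsub>real_ring\<^esub> = 1" "\<zero>\<^bsub>real_ring\<^esub> = 0"
  by (simp_all add: real_ring_def)

lemma real_ring_a_inv [simp]: "\<ominus>\<^bsub>real_ring\<^esub> x = - x"
proof -
  interpret cring real_ring by (rule real_ring_cring)
  have "- x = \<ominus>\<^bsub>real_ring\<^esub> x" by (rule sum_zero_eq_neg) simp_all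
  then show ?thesis by simp
qed

text \<open>Kept apart from \<open>lie_algebra\<close> so that it also applies to subspaces (the
  same record with a smaller carrier), which serve as vector spaces only.\<close>

locale real_module = module real_ring L for L :: "(real, 'a) module" (structure)
begin

lemma smult_in [simp, intro]: "x \<in> carrier L \<Longrightarrow> r \<odot> x \<in> carrier L"
  by (rule smult_closed) simp_all

lemma smult_smult: "x \<in> carrier L \<Longrightarrow> r \<odot> (s \<odot> x) = (r * s) \<odot> x"
  using smult_assoc1[of r s x] by simp

lemma smult_add_right:
  "x \<in> carrier L \<Longrightarrow> y \<in> carrier L \<Longrightarrow> r \<odot> (x \<oplus> y) = r \<odot> x \<oplus> r \<odot> y"
  by (rule smult_r_distr) simp_all

lemma smult_add_left: "x \<in> carrier L \<Longrightarrow> (r + s) \<odot> x = r \<odot> x \<oplus> s \<odot> x"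
  using smult_l_distr[of r s x] by simp

lemma smult_diff_left: "x \<in> carrier L \<Longrightarrow> (r - s) \<odot> x = r \<odot> x \<oplus> (- s) \<odot> x"
  using smult_add_left[of x r "- s"] by simp

lemma smult_one_eq [simp]: "x \<in> carrier L \<Longrightarrow> 1 \<odot> x = x"
  using smult_one[of x] by simp

lemma smult_zero_eq [simp]: "x \<in> carrier L \<Longrightarrow> 0 \<odot> x = \<zero>"
  using smult_l_null[of x] by simp

lemma smult_zero_right [simp]: "r \<odot> \<zero> = \<zero>"
  by (rule smult_r_null) simp

lemma smult_minus_one: "x \<in> carrier L \<Longrightarrow> (-1) \<odot> x = \<ominus> x"
  using smult_l_minus[of 1 x] by simp

lemma minus_smult: "x \<in> carrier L \<Longrightarrow> (- r) \<odot> x = \<ominus> (r \<odot> x)"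
  using smult_l_minus[of r x] by simp

lemma a_inv_eq_smult: "x \<in> carrier L \<Longrightarrow> \<ominus> x = (-1) \<odot> x"
  by (simp add: smult_minus_one)

section \<open>Linear functionals and coordinates\<close>

lemma linear_functionals_add:
  "l \<in> linear_functionals L \<Longrightarrow> v \<in> carrier L \<Longrightarrow> w \<in> carrier L \<Longrightarrow> l (v \<oplus> w) = l v + l w"
  by (simp add: linear_functionals_def)

lemma linear_functionals_smult:
  "l \<in> linear_functionals L \<Longrightarrow> v \<in> carrier L \<Longrightarrow> l (r \<odot> v) = r * l v"
  by (simp add: linear_functionals_def)

lemma linear_functionals_zero: "l \<in> linear_functionals L \<Longrightarrow> l \<zero> = 0"
  using linear_functionals_smult[of l \<zero> 0] by simp

lemma linear_functionals_finsum:
  assumes "l \<in> linear_functionals L" "finite B" "f \<in> B \<rightarrow> carrier L"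
  shows "l (\<Oplus>b\<in>B. f b) = (\<Sum>b\<in>B. l (f b))"
  using assms(2,3)
  by (induction B rule: finite_induct)
    (auto simp: linear_functionals_zero[OF assms(1)] linear_functionals_add[OF assms(1)] Pi_def)

text \<open>A finite dual basis; the \<open>b\<close> need not be linearly independent.\<close>

definition frame :: "'a set \<Rightarrow> ('a \<Rightarrow> 'a \<Rightarrow> real) \<Rightarrow> bool" where
  "frame B c \<longleftrightarrow> finite B \<and> B \<subseteq> carrier L \<and> (\<forall>b\<in>B. c b \<in> linear_functionals L) \<and>
     (\<forall>v\<in>carrier L. v = (\<Oplus>b\<in>B. c b v \<odot> b))"

lemma lincomb_add:
  assumes "B \<subseteq> carrier L"
  shows "(\<Oplus>b\<in>B. a b \<odot> b) \<oplus> (\<Oplus>b\<in>B. d b \<odot> b) = (\<Oplus>b\<in>B. (a b + d b) \<odot> b)"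
proof -
  have "(\<Oplus>b\<in>B. (a b + d b) \<odot> b) = (\<Oplus>b\<in>B. a b \<odot> b \<oplus> d b \<odot> b)"
    using assms by (intro finsum_cong') (auto intro!: smult_add_left)
  also have "\<dots> = (\<Oplus>b\<in>B. a b \<odot> b) \<oplus> (\<Oplus>b\<in>B. d b \<odot> b)"
    using assms by (intro finsum_addf) auto
  finally show ?thesis by simp
qed

text \<open>The exchange argument: adding a suitable multiple of a relation that involves
  \<open>b0\<close> removes \<open>b0\<close> from any combination.\<close>

lemma finsum_drop:
  assumes B: "finite B" "B \<subseteq> carrier L" "b0 \<in> B" and d: "(\<Oplus>b\<in>B. d b \<odot> b) = \<zero>" "d b0 \<noteq> 0"
    and v: "v = (\<Oplus>b\<in>B. a b \<odot> b)"
  shows "\<exists>a'. v = (\<Oplus>b\<in>B - {b0}. a' b \<odot> b)"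
proof -
  \<comment> \<open>Chosen to cancel the coefficient of \<open>b0\<close>, that is, a b0 + t d b0 =
    0.\<close>
  define t where "t = - a b0 / d b0"
  have mem: "\<And>b. b \<in> B \<Longrightarrow> b \<in> carrier L" using B by auto
  have vin: "v \<in> carrier L" unfolding v using mem by (intro finsum_closed) auto
  have "v = v \<oplus> t \<odot> (\<Oplus>b\<in>B. d b \<odot> b)"
    unfolding d using vin by simp
  also have "t \<odot> (\<Oplus>b\<in>B. d b \<odot> b) = (\<Oplus>b\<in>B. (t * d b) \<odot> b)"
    using B mem by (subst finsum_smult_ldistr) (auto simp: smult_smult intro!: finsum_cong')
  also have "v \<oplus> \<dots> = (\<Oplus>b\<in>B. (a b + t * d b) \<odot> b)"
    unfolding v using B(2) by (rule lincomb_add)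
  also have "\<dots> = (\<Oplus>b\<in>insert b0 (B - {b0}). (a b + t * d b) \<odot> b)"
    using B(3) by (simp add: insert_absorb)
  also have "\<dots> = (a b0 + t * d b0) \<odot> b0 \<oplus> (\<Oplus>b\<in>B - {b0}. (a b + t * d b) \<odot> b)"
    using B mem by (subst finsum_insert) auto
  also have "\<dots> = (\<Oplus>b\<in>B - {b0}. (a b + t * d b) \<odot> b)"
    using mem B d by (subst (2) l_zero[symmetric]) (auto simp: t_def intro!: finsum_closed)
  finally show ?thesis by (rule exI[of _ "\<lambda>b. a b + t * d b"])
qed

text \<open>Coordinates are linear as soon as they are unique. They are unique for a spanning set of
  least cardinality, since a nontrivial relation would allow an element to be dropped.\<close>

lemma finite_dimensional_frame:
  assumes "finite_dimensional L"
  obtains B c where "frame B c"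
proof -
  define P where "P B \<longleftrightarrow> finite B \<and> B \<subseteq> carrier L \<and>
      (\<forall>v\<in>carrier L. \<exists>c. v = (\<Oplus>b\<in>B. c b \<odot> b))" for B
  have "\<exists>B. P B" using assms unfolding finite_dimensional_def P_def .
  define B where "B = arg_min card P"
  have PB: "P B" unfolding B_def using \<open>\<exists>B. P B\<close> by (metis arg_min_natI)
  have min: "card B \<le> card C" if "P C" for C
    unfolding B_def using that by (rule arg_min_nat_le)
  have B: "finite B" "B \<subseteq> carrier L" "\<And>v. v \<in> carrier L \<Longrightarrow> \<exists>c. v = (\<Oplus>b\<in>B. c b \<odot> b)"
    using PB by (auto simp: P_def)
  have mem: "\<And>b. b \<in> B \<Longrightarrow> b \<in> carrier L" using B by auto
  have indep: "d b0 = 0" if "(\<Oplus>b\<in>B. d b \<odot> b) = \<zero>" "b0 \<in> B" for d b0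
  proof (rule ccontr)
    assume "d b0 \<noteq> 0"
    have "P (B - {b0})"
      unfolding P_def
    proof (intro conjI ballI)
      fix v assume "v \<in> carrier L"
      then obtain a where "v = (\<Oplus>b\<in>B. a b \<odot> b)" using B by blast
      then show "\<exists>c. v = (\<Oplus>b\<in>B - {b0}. c b \<odot> b)"
        using finsum_drop[of B b0 d v a] B(1,2) that \<open>d b0 \<noteq> 0\<close> by blast
    qed (use B in auto)
    from min[OF this] show False using that(2) B(1)
      by (metis card_Diff1_less not_less)
  qed
  have uniq: "a b0 = a' b0" if "(\<Oplus>b\<in>B. a b \<odot> b) = (\<Oplus>b\<in>B. a' b \<odot> b)" "b0 \<in> B" for a a' b0
  proof -
    have "(\<Oplus>b\<in>B. (a b - a' b) \<odot> b) = (\<Oplus>b\<in>B. a b \<odot> b \<oplus> (-1) \<odot> (a' b \<odot> b))"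
      using mem
      by (intro finsum_cong') (auto simp: smult_smult smult_add_left[symmetric])
    also have "\<dots> = (\<Oplus>b\<in>B. a b \<odot> b) \<oplus> (\<Oplus>b\<in>B. (-1) \<odot> (a' b \<odot> b))"
      using mem by (intro finsum_addf) auto
    also have "(\<Oplus>b\<in>B. (-1) \<odot> (a' b \<odot> b)) = (-1) \<odot> (\<Oplus>b\<in>B. a' b \<odot> b)"
      using mem B by (intro finsum_smult_ldistr[symmetric]) auto
    also have "(\<Oplus>b\<in>B. a b \<odot> b) \<oplus> \<dots> = \<zero>"
      unfolding that(1) using mem by (subst smult_minus_one) (auto simp: r_neg intro!: finsum_closed)
    finally show ?thesis using indep[of "\<lambda>b. a b - a' b" b0] that(2) by simp
  qed
  \<comment> \<open>The coordinates are picked for each vector separately; the uniqueness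
    \<open>uniq\<close> forces their linearity afterwards.\<close>
  define c where "c b v = (SOME a. v = (\<Oplus>b\<in>B. a b \<odot> b)) b" for b v
  have c: "v = (\<Oplus>b\<in>B. c b v \<odot> b)" if "v \<in> carrier L" for v
    unfolding c_def using someI_ex[OF B(3)[OF that]] .
  have "c b \<in> linear_functionals L" if "b \<in> B" for b
    unfolding linear_functionals_def
  proof (safe)
    fix v w assume vw: "v \<in> carrier L" "w \<in> carrier L"
    have "(\<Oplus>b\<in>B. c b (v \<oplus> w) \<odot> b) = v \<oplus> w" using c[of "v \<oplus> w"] vw by simp
    also have "\<dots> = (\<Oplus>b\<in>B. c b v \<odot> b) \<oplus> (\<Oplus>b\<in>B. c b w \<odot> b)" using c vw by simp
    also have "\<dots> = (\<Oplus>b\<in>B. (c b v + c b w) \<odot> b)"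
      using B(2) by (rule lincomb_add)
    finally show "c b (v \<oplus> w) = c b v + c b w" using uniq[of "\<lambda>b. c b (v \<oplus> w)" "\<lambda>b. c b v + c b w" b] that by simp
  next
    fix r v assume vw: "v \<in> carrier L"
    have "(\<Oplus>b\<in>B. c b (r \<odot> v) \<odot> b) = r \<odot> v" using c[of "r \<odot> v"] vw by simp
    also have "\<dots> = r \<odot> (\<Oplus>b\<in>B. c b v \<odot> b)" using c vw by simp
    also have "\<dots> = (\<Oplus>b\<in>B. (r * c b v) \<odot> b)"
      using mem B by (subst finsum_smult_ldistr) (auto simp: smult_smult intro!: finsum_cong')
    finally show "c b (r \<odot> v) = r * c b v" using uniq[of "\<lambda>b. c b (r \<odot> v)" "\<lambda>b. r * c b v" b] that by simp
  qed
  with B c have "frame B c" unfolding frame_def by blast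
  then show ?thesis by (rule that)
qed

lemma frame_eqI:
  assumes "frame B c" "v \<in> carrier L" "w \<in> carrier L" "\<And>b. b \<in> B \<Longrightarrow> c b v = c b w"
  shows "v = w"
proof -
  have "v = (\<Oplus>b\<in>B. c b v \<odot> b)" "w = (\<Oplus>b\<in>B. c b w \<odot> b)" using assms by (auto simp: frame_def)
  moreover have "(\<Oplus>b\<in>B. c b v \<odot> b) = (\<Oplus>b\<in>B. c b w \<odot> b)"
    using assms by (intro finsum_cong') (auto simp: frame_def)
  ultimately show ?thesis by simp
qed

lemma linear_functionals_frame:
  assumes "frame B c" "l \<in> linear_functionals L" "v \<in> carrier L"
  shows "l v = (\<Sum>b\<in>B. c b v * l b)"
proof -
  have "l v = l (\<Oplus>b\<in>B. c b v \<odot> b)" using assms by (auto simp: frame_def)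
  also have "\<dots> = (\<Sum>b\<in>B. l (c b v \<odot> b))"
    using assms by (intro linear_functionals_finsum) (auto simp: frame_def)
  also have "\<dots> = (\<Sum>b\<in>B. c b v * l b)"
    using assms by (intro sum.cong) (auto simp: frame_def linear_functionals_smult)
  finally show ?thesis .
qed

section \<open>Subspaces and their coordinates\<close>

lemma submodule_props:
  assumes "submodule I real_ring L"
  shows submodule_subset: "I \<subseteq> carrier L"
    and submodule_add: "\<And>x y. x \<in> I \<Longrightarrow> y \<in> I \<Longrightarrow> x \<oplus> y \<in> I"
    and submodule_smult: "\<And>r x. x \<in> I \<Longrightarrow> r \<odot> x \<in> I"
    and submodule_zero: "\<zero> \<in> I"
proof -
  interpret I: submodule I real_ring L by fact
  show "I \<subseteq> carrier L" using I.subset by simp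
  show "\<And>x y. x \<in> I \<Longrightarrow> y \<in> I \<Longrightarrow> x \<oplus> y \<in> I" using I.m_closed by simp
  show "\<And>r x. x \<in> I \<Longrightarrow> r \<odot> x \<in> I" using I.smult_closed by simp
  show "\<zero> \<in> I" using I.one_closed by simp
qed

lemma real_submoduleI:
  assumes "I \<subseteq> carrier L" "\<zero> \<in> I" "\<And>x y. x \<in> I \<Longrightarrow> y \<in> I \<Longrightarrow> x \<oplus> y \<in> I"
    "\<And>r x. x \<in> I \<Longrightarrow> r \<odot> x \<in> I"
  shows "submodule I real_ring L"
proof (rule submoduleI)
  show "\<And>a. a \<in> I \<Longrightarrow> \<ominus> a \<in> I"
    using assms(1,4) by (metis a_inv_eq_smult subsetD)
qed (use assms in auto)

lemma submodule_is_real_module: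
  assumes "submodule I real_ring L" shows "real_module (L\<lparr>carrier := I\<rparr>)"
  unfolding real_module_def
proof (rule moduleI)
  note I = submodule_props[OF assms]
  show "abelian_group (L\<lparr>carrier := I\<rparr>)"
  proof (rule abelian_groupI)
    fix x assume "x \<in> carrier (L\<lparr>carrier := I\<rparr>)"
    then show "\<exists>y\<in>carrier (L\<lparr>carrier := I\<rparr>). y \<oplus>\<^bsub>L\<lparr>carrier := I\<rparr>\<^esub> x = \<zero>\<^bsub>L\<lparr>carrier := I\<rparr>\<^esub>"
      using I l_neg[of x] smult_minus_one[of x] I(3)[of x "-1"] by (intro bexI[of _ "\<ominus> x"]) (auto simp: subset_eq)
  qed (use I in \<open>auto simp: subset_eq a_assoc intro: a_comm\<close>)
qed (use submodule_props[OF assms] real_ring_cring in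
    \<open>auto simp: subset_eq smult_add_left smult_add_right smult_smult\<close>)

text \<open>
  Induction on the number of functionals needed to separate the points of \<open>W\<close>: in the step, one
  splits off a vector on which one of them is \<open>1\<close>.
\<close>

lemma separated_submodule_frame:
  assumes "finite F" "F \<subseteq> linear_functionals L" "submodule W real_ring L"
    and "\<And>w. w \<in> W \<Longrightarrow> (\<And>l. l \<in> F \<Longrightarrow> l w = 0) \<Longrightarrow> w = \<zero>"
  shows "\<exists>B c. real_module.frame (L\<lparr>carrier := W\<rparr>) B c"
  using assms
proof (induction F arbitrary: W rule: finite_induct)
  case empty
  interpret W: real_module "L\<lparr>carrier := W\<rparr>" by (rule submodule_is_real_module) fact
  have "v = \<zero>" if "v \<in> W" for v using empty that by auto
  then have "W.frame {} c" for c
    unfolding W.frame_def by simp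
  then show ?case by blast
next
  case (insert l F)
  have W: "submodule W real_ring L" by fact
  note Wp = submodule_props[OF W]
  interpret W: real_module "L\<lparr>carrier := W\<rparr>" by (rule submodule_is_real_module) fact
  have l: "l \<in> linear_functionals L" using insert by auto
  show ?case
  proof (cases "\<forall>w\<in>W. l w = 0")
    case True
    then show ?thesis using insert.prems by (intro insert.IH) auto
  next
    case False
    then obtain w0 where w0: "w0 \<in> W" "l w0 \<noteq> 0" by auto
    define w where "w = (1 / l w0) \<odot> w0"
    have w: "w \<in> W" "l w = 1"
      using w0 Wp l by (auto simp: w_def linear_functionals_smult subset_eq)
    define V where "V = {v \<in> W. l v = 0}"
    have V: "submodule V real_ring L"
      using Wp l by (intro real_submoduleI) (auto simp: V_def linear_functionals_zero
        linear_functionals_add linear_functionals_smult subset_eq)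
    interpret V: real_module "L\<lparr>carrier := V\<rparr>" by (rule submodule_is_real_module) fact
    have "\<exists>B c. V.frame B c"
      using insert.prems V by (intro insert.IH) (auto simp: V_def)
    then obtain B c where Bc: "V.frame B c" by auto
    \<comment> \<open>The projection of \<open>W\<close> onto the kernel \<open>V\<close> of
      \<open>l\<close> along \<open>w\<close>. Composition with it extends the coordinates of
      \<open>V\<close> to \<open>W\<close>, and \<open>l\<close> becomes the coordinate along
      \<open>w\<close>.\<close>
    define p where "p v = v \<oplus> (- l v) \<odot> w" for v
    have p: "p v \<in> V" if "v \<in> W" for v
      unfolding V_def p_def using that w Wp l
      by (auto simp: linear_functionals_add linear_functionals_smult subset_eq)
    have BV: "B \<subseteq> V" using Bc by (auto simp: V.frame_def)
    then have wV: "w \<notin> B" using w by (auto simp: V_def)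
    define c' where "c' b v = (if b = w then l v else c b (p v))" for b v
    have padd: "p (v \<oplus> u) = p v \<oplus> p u" if "v \<in> W" "u \<in> W" for u v
      using that w Wp l
      by (simp add: p_def linear_functionals_add subset_eq smult_diff_left a_ac)
    have psm: "p (r \<odot> v) = r \<odot> p v" if "v \<in> W" for r v
      using that w Wp l
      by (simp add: p_def linear_functionals_smult subset_eq smult_add_right smult_smult)
    have "W.frame (insert w B) c'"
      unfolding W.frame_def
    proof (intro conjI ballI)
      show "finite (insert w B)" using Bc by (simp add: V.frame_def)
      show sub: "insert w B \<subseteq> carrier (L\<lparr>carrier := W\<rparr>)" using BV w by (auto simp: V_def)
      fix b assume "b \<in> insert w B"
      show "c' b \<in> linear_functionals (L\<lparr>carrier := W\<rparr>)"
      proof (cases "b = w")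
        case True then show ?thesis
          using l Wp by (auto simp: c'_def linear_functionals_def subset_eq)
      next
        case False
        then have "c b \<in> linear_functionals (L\<lparr>carrier := V\<rparr>)"
          using Bc \<open>b \<in> insert w B\<close> by (auto simp: V.frame_def)
        then show ?thesis using False p padd psm Wp
          by (simp add: c'_def linear_functionals_def subset_eq)
      qed
    next
      fix v assume "v \<in> carrier (L\<lparr>carrier := W\<rparr>)"
      then have v: "v \<in> W" by simp
      have B: "finite B" "B \<subseteq> V" using Bc by (auto simp: V.frame_def)
      \<comment> \<open>Sums of vectors of \<open>U\<close> agree in the subspace and in the whole
        space. This needs an argument because \<open>finsum\<close> depends on the carrier of the
        record.\<close>
      have subs: "finsum (L\<lparr>carrier := U\<rparr>) f A = finsum L f A" if "f \<in> A \<rightarrow> U" "submodule U real_ring L" "finite A"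
        for U and f :: "'a \<Rightarrow> 'a" and A
      proof -
        note U = submodule_props[OF that(2)]
        interpret U: real_module "L\<lparr>carrier := U\<rparr>" by (rule submodule_is_real_module) fact
        show ?thesis
          using that(3,1)
        proof (induction A rule: finite_induct)
          case (insert a A)
          have "finsum (L\<lparr>carrier := U\<rparr>) f (insert a A) = f a \<oplus>\<^bsub>L\<lparr>carrier := U\<rparr>\<^esub> finsum (L\<lparr>carrier := U\<rparr>) f A"
            using insert by (intro U.finsum_insert) auto
          also have "\<dots> = f a \<oplus> finsum L f A" using insert by simp
          also have "\<dots> = finsum L f (insert a A)"
            using insert U by (intro finsum_insert[symmetric]) auto
          finally show ?case .
        qed simp
      qed
      have "p v = finsum (L\<lparr>carrier := V\<rparr>) (\<lambda>b. c b (p v) \<odot> b) B"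
        using Bc p[OF v] by (auto simp: V.frame_def)
      also have "\<dots> = (\<Oplus>b\<in>B. c b (p v) \<odot> b)"
        using B submodule_smult[OF V] V by (intro subs) auto
      also have "\<dots> = (\<Oplus>b\<in>B. c' b v \<odot> b)"
        using B wV submodule_props[OF V] by (intro finsum_cong') (auto simp: c'_def)
      finally have pv: "p v = (\<Oplus>b\<in>B. c' b v \<odot> b)" .
      have "v = l v \<odot> w \<oplus> p v"
        unfolding p_def using v w Wp
          a_lcomm[of "l v \<odot> w" v "\<ominus> (l v \<odot> w)"] r_neg[of "l v \<odot> w"]
        by (simp add: subset_eq minus_smult)
      also have "\<dots> = (\<Oplus>b\<in>insert w B. c' b v \<odot> b)"
        unfolding pv using B wV w Wp submodule_props[OF V]
        by (subst finsum_insert) (auto simp: c'_def subset_eq)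
      also have "\<dots> = finsum (L\<lparr>carrier := W\<rparr>) (\<lambda>b. c' b v \<odot>\<^bsub>L\<lparr>carrier := W\<rparr>\<^esub> b) (insert w B)"
        using B w Wp(3) W by (subst subs) (auto simp: V_def)
      finally show "v = finsum (L\<lparr>carrier := W\<rparr>) (\<lambda>b. c' b v \<odot>\<^bsub>L\<lparr>carrier := W\<rparr>\<^esub> b) (insert w B)" .
    qed
    then show ?thesis by blast
  qed
qed

text \<open>The coordinates of the whole space form a finite family of functionals that separates
  the points of \<open>W\<close>.\<close>

lemma submodule_frame:
  assumes "finite_dimensional L" "submodule W real_ring L"
  obtains B c where "real_module.frame (L\<lparr>carrier := W\<rparr>) B c"
proof -
  obtain B c where "frame B c" using finite_dimensional_frame[OF assms(1)] .
  moreover have "w = \<zero>" if "w \<in> W" "\<And>l. l \<in> c ` B \<Longrightarrow> l w = 0" for w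
    using that submodule_subset[OF assms(2)] calculation
    by (intro frame_eqI[of B c]) (auto simp: frame_def linear_functionals_zero)
  ultimately have "\<exists>B c. real_module.frame (L\<lparr>carrier := W\<rparr>) B c"
    using assms(2) by (intro separated_submodule_frame[of "c ` B"]) (auto simp: frame_def)
  then show ?thesis using that by blast
qed

end

section \<open>Quotient Lie algebras\<close>

sublocale lie_algebra \<subseteq> real_module L ..

lemma lie_ideal_submodule: "lie_ideal I L \<Longrightarrow> submodule I real_ring L"
  by (simp add: lie_ideal_def)

locale lie_algebra_ideal = lie_algebra +
  fixes I assumes lie_ideal: "lie_ideal I L"
begin

lemmas I_subset = submodule_subset[OF lie_ideal_submodule[OF lie_ideal]]
lemmas I_add = submodule_add[OF lie_ideal_submodule[OF lie_ideal]]
lemmas I_smult = submodule_smult[OF lie_ideal_submodule[OF lie_ideal]]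
lemmas I_zero = submodule_zero[OF lie_ideal_submodule[OF lie_ideal]]

lemma I_carrier: "x \<in> I \<Longrightarrow> x \<in> carrier L"
  using I_subset by auto

lemma I_bracket_right: "x \<in> carrier L \<Longrightarrow> v \<in> I \<Longrightarrow> x \<otimes> v \<in> I"
  using lie_ideal by (simp add: lie_ideal_def)

lemma bracket_swap:
  assumes "x \<in> carrier L" "y \<in> carrier L" shows "x \<otimes> y = (-1) \<odot> (y \<otimes> x)"
proof -
  have "\<zero> = (x \<oplus> y) \<otimes> (x \<oplus> y)" using assms by (simp add: bracket_alternating)
  also have "\<dots> = x \<otimes> (x \<oplus> y) \<oplus> y \<otimes> (x \<oplus> y)"
    using assms by (intro bracket_add_left) auto
  also have "\<dots> = (x \<otimes> y) \<oplus> (y \<otimes> x)"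
    using assms by (simp add: bracket_add_right bracket_alternating bracket_closed)
  finally have "\<ominus> (y \<otimes> x) = x \<otimes> y"
    using assms by (intro minus_equality) (auto simp: bracket_closed)
  then show ?thesis using assms by (simp add: smult_minus_one bracket_closed)
qed

lemma I_bracket_left: "x \<in> carrier L \<Longrightarrow> v \<in> I \<Longrightarrow> v \<otimes> x \<in> I"
  using bracket_swap[of v x] I_bracket_right[of x v] I_smult I_carrier by auto

sublocale I: abelian_subgroup I L
proof (rule abelian_subgroupI3)
  show "additive_subgroup I L"
    using lie_ideal by (intro additive_subgroupI) (simp add: lie_ideal_def submodule_def)
qed (rule abelian_group_axioms)

lemma cosetE:
  assumes "u \<in> I +> v" obtains h where "h \<in> I" "u = h \<oplus> v"
  using assms by (auto simp: a_r_coset_def')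

lemma coset_eq_iff:
  assumes "v \<in> carrier L" "w \<in> carrier L"
  shows "I +> v = I +> w \<longleftrightarrow> v \<oplus> (-1) \<odot> w \<in> I"
proof
  assume "I +> v = I +> w"
  then have "v \<in> I +> w" using I.a_rcos_self[OF assms(1)] by simp
  then obtain h where "h \<in> I" "v = h \<oplus> w" by (rule cosetE)
  then show "v \<oplus> (-1) \<odot> w \<in> I"
    using assms I_carrier by (simp add: a_assoc smult_minus_one r_neg)
next
  assume *: "v \<oplus> (-1) \<odot> w \<in> I"
  have "(v \<oplus> (-1) \<odot> w) \<oplus> w = v"
    using assms by (simp add: a_assoc smult_minus_one l_neg)
  with * have "v \<in> I +> w" unfolding a_r_coset_def' by blast
  then show "I +> v = I +> w" using I.a_repr_independence'[of v w] assms by simp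
qed

lemma coset_eq_self_iff: "v \<in> carrier L \<Longrightarrow> I +> v = I \<longleftrightarrow> v \<in> I"
  using coset_eq_iff[of v \<zero>] I_subset by simp

section \<open>Operations on cosets\<close>

lemma quotient_carrierE:
  assumes "C \<in> carrier (lie_quotient L I)"
  obtains v where "v \<in> carrier L" "C = I +> v"
  using assms by (auto simp: lie_quotient_def A_RCOSETS_def')

lemma coset_in_quotient: "v \<in> carrier L \<Longrightarrow> I +> v \<in> carrier (lie_quotient L I)"
  by (auto simp: lie_quotient_def A_RCOSETS_def')

lemma quotient_zero: "\<zero>\<^bsub>lie_quotient L I\<^esub> = I +> \<zero>"
  using I_subset by (simp add: lie_quotient_def)

lemma quotient_add:
  "v \<in> carrier L \<Longrightarrow> w \<in> carrier L \<Longrightarrow>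
    (I +> v) \<oplus>\<^bsub>lie_quotient L I\<^esub> (I +> w) = I +> (v \<oplus> w)"
  by (simp add: lie_quotient_def I.a_rcos_sum)

text \<open>The scalar multiple of a coset is defined as a union over all representatives. All of
  them yield the same coset, so the union collapses.\<close>

lemma quotient_smult:
  assumes "v \<in> carrier L"
  shows "r \<odot>\<^bsub>lie_quotient L I\<^esub> (I +> v) = I +> (r \<odot> v)"
proof -
  have "I +> (r \<odot> u) = I +> (r \<odot> v)" if u: "u \<in> I +> v" for u
  proof -
    obtain h where h: "h \<in> I" "u = h \<oplus> v" using u by (rule cosetE)
    have "r \<odot> u \<oplus> (-1) \<odot> (r \<odot> v) = r \<odot> h"
      using h assms I_carrier[OF h(1)]
      by (simp add: smult_add_right a_assoc smult_minus_one r_neg)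
    then show ?thesis using h assms I_carrier[OF h(1)] I_smult by (subst coset_eq_iff) auto
  qed
  moreover have "v \<in> I +> v" using I.a_rcos_self assms by simp
  ultimately have "(\<Union>u\<in>I +> v. I +> (r \<odot> u)) = I +> (r \<odot> v)"
    by (intro UN_constant_eq ballI)
  then show ?thesis by (simp add: lie_quotient_def)
qed

text \<open>As for scalars, a union over representatives collapses, here in both factors: changing a
  factor by an element of the ideal changes the bracket by an element of the ideal.\<close>

lemma quotient_mult:
  assumes v: "v \<in> carrier L" and w: "w \<in> carrier L"
  shows "(I +> v) \<otimes>\<^bsub>lie_quotient L I\<^esub> (I +> w) = I +> (v \<otimes> w)"
proof -
  have "I +> (a \<otimes> b) = I +> (v \<otimes> w)" if a: "a \<in> I +> v" and b: "b \<in> I +> w" for a b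
  proof -
    obtain h where h: "h \<in> I" "a = h \<oplus> v" using a by (rule cosetE)
    obtain k where k: "k \<in> I" "b = k \<oplus> w" using b by (rule cosetE)
    have c: "h \<in> carrier L" "k \<in> carrier L" using h k I_carrier by auto
    \<comment> \<open>Expanded so that only the last summand is outside the ideal: the first has its
      left factor \<open>h\<close> in it, the second its right factor \<open>k\<close>.\<close>
    have "a \<otimes> b = (h \<otimes> b \<oplus> v \<otimes> k) \<oplus> v \<otimes> w"
      using h k c v w
      by (simp add: bracket_add_left[of _ _ "k \<oplus> w"] bracket_add_right[of _ _ v] bracket_closed a_assoc)
    then have "a \<otimes> b \<oplus> (-1) \<odot> (v \<otimes> w) = h \<otimes> b \<oplus> v \<otimes> k"
      using h k c v w by (simp add: a_assoc smult_minus_one r_neg bracket_closed)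
    moreover have "h \<otimes> b \<oplus> v \<otimes> k \<in> I"
      using h k c v w by (intro I_add I_bracket_left I_bracket_right) auto
    ultimately show ?thesis
      using h k c v w by (subst coset_eq_iff) (auto simp: bracket_closed)
  qed
  then have "(\<Union>b\<in>I +> w. I +> (a \<otimes> b)) = I +> (v \<otimes> w)" if "a \<in> I +> v" for a
    using that I.a_rcos_self[OF w] by (intro UN_constant_eq) auto
  then have "(\<Union>a\<in>I +> v. \<Union>b\<in>I +> w. I +> (a \<otimes> b)) = I +> (v \<otimes> w)"
    using I.a_rcos_self[OF v] by (intro UN_constant_eq) auto
  then show ?thesis by (simp add: lie_quotient_def rcoset_mult_def)
qed

lemmas quotient_ops =
  quotient_zero quotient_add quotient_smult quotient_mult coset_in_quotient

lemma quotient_lie_algebra: "lie_algebra (lie_quotient L I)"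
proof -
  let ?Q = "lie_quotient L I"
  have ag: "abelian_group ?Q"
  proof (rule abelian_groupI)
    fix x assume "x \<in> carrier ?Q"
    then obtain v where v: "v \<in> carrier L" "x = I +> v" by (rule quotient_carrierE)
    then have "(I +> \<ominus> v) \<oplus>\<^bsub>?Q\<^esub> x = \<zero>\<^bsub>?Q\<^esub>" by (simp add: quotient_ops l_neg del: a_coset_add_zero)
    then show "\<exists>y\<in>carrier ?Q. y \<oplus>\<^bsub>?Q\<^esub> x = \<zero>\<^bsub>?Q\<^esub>" using v by (auto intro: coset_in_quotient)
  qed (auto elim!: quotient_carrierE simp: quotient_ops a_ac
      simp del: a_coset_add_zero)
  have "module real_ring ?Q"
    by (rule moduleI[OF real_ring_cring ag])
      (auto elim!: quotient_carrierE simp: quotient_ops smult_smult smult_add_left smult_add_right)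
  then show ?thesis
    by (rule lie_algebra.intro, unfold_locales)
      (auto elim!: quotient_carrierE simp: quotient_ops bracket_closed bracket_add_left
        bracket_add_right bracket_smult_left bracket_smult_right bracket_alternating jacobi
        simp del: a_coset_add_zero)
qed

text \<open>The cosets of a spanning set span the quotient. The work lies in the reindexing, as
  distinct spanning vectors may have the same coset.\<close>

lemma quotient_finite_dimensional:
  assumes "finite_dimensional L"
  shows "finite_dimensional (lie_quotient L I)"
proof -
  let ?Q = "lie_quotient L I"
  interpret Q: lie_algebra ?Q by (rule quotient_lie_algebra)
  obtain B c where Bc: "frame B c" using finite_dimensional_frame[OF assms] .
  then have B: "finite B" "B \<subseteq> carrier L" by (auto simp: frame_def)
  have hom: "I +> finsum L f A = finsum ?Q (\<lambda>a. I +> f a) A"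
    if "f \<in> A \<rightarrow> carrier L" "finite A" for A and f :: "'a \<Rightarrow> 'a"
    using that(2,1)
  proof (induction A rule: finite_induct)
    case empty then show ?case by (simp add: quotient_zero del: a_coset_add_zero)
  next
    case (insert a A)
    then have f: "f a \<in> carrier L" "f \<in> A \<rightarrow> carrier L" by auto
    have "I +> finsum L f (insert a A) = I +> (f a \<oplus> finsum L f A)"
      using insert f by simp
    also have "\<dots> = (I +> f a) \<oplus>\<^bsub>?Q\<^esub> (I +> finsum L f A)"
      using f by (intro quotient_add[symmetric]) auto
    also have "\<dots> = (I +> f a) \<oplus>\<^bsub>?Q\<^esub> finsum ?Q (\<lambda>a. I +> f a) A"
      using insert f by simp
    also have "\<dots> = finsum ?Q (\<lambda>a. I +> f a) (insert a A)"
      using insert f by (intro Q.finsum_insert[symmetric]) (auto intro!: coset_in_quotient)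
    finally show ?case .
  qed
  let ?B = "(\<lambda>b. I +> b) ` B"
  show ?thesis
    unfolding finite_dimensional_def
  proof (intro exI[of _ ?B] conjI ballI)
    show "finite ?B" using B by simp
    show "?B \<subseteq> carrier ?Q" using B coset_in_quotient by auto
    fix C assume "C \<in> carrier ?Q"
    then obtain v where v: "v \<in> carrier L" "C = I +> v" by (rule quotient_carrierE)
    \<comment> \<open>All spanning vectors with coset \<open>D\<close> contribute to the coefficient
      of \<open>D\<close>. The equation with these coefficients is proved by adding the elements of
      \<open>B\<close> one at a time while the index set \<open>?B\<close> on the right stays
      fixed.\<close>
    let ?c = "\<lambda>D. \<Sum>b\<in>{b\<in>B. I +> b = D}. c b v"
    have "C = I +> (\<Oplus>b\<in>B. c b v \<odot> b)" using Bc v by (auto simp: frame_def)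
    also have "\<dots> = (\<Oplus>\<^bsub>?Q\<^esub>b\<in>B. I +> (c b v \<odot> b))"
      using B by (intro hom) auto
    also have "\<dots> = (\<Oplus>\<^bsub>?Q\<^esub>b\<in>B. c b v \<odot>\<^bsub>?Q\<^esub> (I +> b))"
      using B by (intro Q.finsum_cong') (auto simp: quotient_ops subset_eq)
    also have "\<dots> = (\<Oplus>\<^bsub>?Q\<^esub>D\<in>?B. ?c D \<odot>\<^bsub>?Q\<^esub> D)"
    proof -
      have "(\<Oplus>\<^bsub>?Q\<^esub>b\<in>A. c b v \<odot>\<^bsub>?Q\<^esub> (I +> b)) =
          (\<Oplus>\<^bsub>?Q\<^esub>D\<in>?B. (\<Sum>b\<in>{b\<in>A. I +> b = D}. c b v) \<odot>\<^bsub>?Q\<^esub> D)" if "finite A" "A \<subseteq> B" for A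
        using that
      proof (induction A rule: finite_induct)
        case empty
        have "(\<Oplus>\<^bsub>?Q\<^esub>D\<in>?B. \<zero>\<^bsub>?Q\<^esub>) = \<zero>\<^bsub>?Q\<^esub>" by simp
        moreover have "(\<Oplus>\<^bsub>?Q\<^esub>D\<in>?B. 0 \<odot>\<^bsub>?Q\<^esub> D) = (\<Oplus>\<^bsub>?Q\<^esub>D\<in>?B. \<zero>\<^bsub>?Q\<^esub>)"
          using B by (intro Q.finsum_cong') (auto simp: coset_in_quotient subset_eq)
        ultimately show ?case by simp
      next
        case (insert a A)
        have mem: "D \<in> carrier ?Q" if "D \<in> ?B" for D
          using that B coset_in_quotient by auto
        have "(\<Oplus>\<^bsub>?Q\<^esub>D\<in>?B. (\<Sum>b\<in>{b\<in>insert a A. I +> b = D}. c b v) \<odot>\<^bsub>?Q\<^esub> D) =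
          (\<Oplus>\<^bsub>?Q\<^esub>D\<in>?B. ((if I +> a = D then c a v else 0) +
              (\<Sum>b\<in>{b\<in>A. I +> b = D}. c b v)) \<odot>\<^bsub>?Q\<^esub> D)"
        proof (intro Q.finsum_cong')
          fix D assume D: "D \<in> ?B"
          have "{b\<in>insert a A. I +> b = D} =
              (if I +> a = D then insert a {b\<in>A. I +> b = D} else {b\<in>A. I +> b = D})" by auto
          then show "(\<Sum>b\<in>{b\<in>insert a A. I +> b = D}. c b v) \<odot>\<^bsub>?Q\<^esub> D =
            ((if I +> a = D then c a v else 0) + (\<Sum>b\<in>{b\<in>A. I +> b = D}. c b v)) \<odot>\<^bsub>?Q\<^esub> D"
            using insert by simp
        qed (use mem in auto)
        also have "\<dots> = (\<Oplus>\<^bsub>?Q\<^esub>D\<in>?B. (if I +> a = D then c a v else 0) \<odot>\<^bsub>?Q\<^esub> D) \<oplus>\<^bsub>?Q\<^esub>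
          (\<Oplus>\<^bsub>?Q\<^esub>D\<in>?B. (\<Sum>b\<in>{b\<in>A. I +> b = D}. c b v) \<odot>\<^bsub>?Q\<^esub> D)"
          using mem by (intro Q.lincomb_add[symmetric]) auto
        also have "(\<Oplus>\<^bsub>?Q\<^esub>D\<in>?B. (if I +> a = D then c a v else 0) \<odot>\<^bsub>?Q\<^esub> D) =
            (\<Oplus>\<^bsub>?Q\<^esub>D\<in>?B. (if I +> a = D then c a v \<odot>\<^bsub>?Q\<^esub> D else \<zero>\<^bsub>?Q\<^esub>))"
          using mem by (intro Q.finsum_cong') auto
        also have "\<dots> = c a v \<odot>\<^bsub>?Q\<^esub> (I +> a)"
          using insert B mem by (intro Q.finsum_singleton) auto
        finally show ?case using insert B by (simp add: coset_in_quotient Pi_def subset_eq)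
      qed
      from this[OF B(1)] show ?thesis by simp
    qed
    finally show "\<exists>d. C = (\<Oplus>\<^bsub>?Q\<^esub>D\<in>?B. d D \<odot>\<^bsub>?Q\<^esub> D)" by (rule exI[of _ ?c])
  qed
qed

end

section \<open>Invariant seminorms\<close>

context real_module
begin

definition seminorm :: "('a \<Rightarrow> real) \<Rightarrow> bool" where
  "seminorm q \<longleftrightarrow> (\<forall>v\<in>carrier L. 0 \<le> q v) \<and> (\<forall>r. \<forall>v\<in>carrier L. q (r \<odot> v) = \<bar>r\<bar> * q v) \<and>
     (\<forall>v\<in>carrier L. \<forall>w\<in>carrier L. q (v \<oplus> w) \<le> q v + q w)"

lemma seminormD:
  assumes "seminorm q"
  shows seminorm_nonneg: "v \<in> carrier L \<Longrightarrow> 0 \<le> q v"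
    and seminorm_smult: "v \<in> carrier L \<Longrightarrow> q (r \<odot> v) = \<bar>r\<bar> * q v"
    and seminorm_triangle: "v \<in> carrier L \<Longrightarrow> w \<in> carrier L \<Longrightarrow> q (v \<oplus> w) \<le> q v + q w"
    and seminorm_zero: "q \<zero> = 0"
proof -
  show "v \<in> carrier L \<Longrightarrow> 0 \<le> q v" "v \<in> carrier L \<Longrightarrow> q (r \<odot> v) = \<bar>r\<bar> * q v"
    "v \<in> carrier L \<Longrightarrow> w \<in> carrier L \<Longrightarrow> q (v \<oplus> w) \<le> q v + q w" for v r w
    using assms by (auto simp: seminorm_def)
  from this(2)[of \<zero> 0] show "q \<zero> = 0" by simp
qed

lemma seminorm_finsum:
  assumes "seminorm q" "finite B" "f \<in> B \<rightarrow> carrier L"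
  shows "q (\<Oplus>b\<in>B. f b) \<le> (\<Sum>b\<in>B. q (f b))"
  using assms(2,3)
proof (induction B rule: finite_induct)
  case (insert b B)
  then have "q (\<Oplus>b\<in>insert b B. f b) = q (f b \<oplus> (\<Oplus>b\<in>B. f b))" by (simp add: Pi_def)
  also have "\<dots> \<le> q (f b) + q (\<Oplus>b\<in>B. f b)"
    using insert by (intro seminorm_triangle[OF assms(1)]) auto
  finally show ?case using insert by (simp add: Pi_def)
qed (simp add: seminorm_zero[OF assms(1)])

text \<open>Continuity of seminorms in finite dimension: \<open>q\<close> is small on vectors with
  small coordinates. This converts coordinatewise differentiability into estimates for
  \<open>q\<close>.\<close>

lemma seminorm_frame_le:
  assumes "seminorm q" "frame B c" "v \<in> carrier L"
  shows "q v \<le> (\<Sum>b\<in>B. \<bar>c b v\<bar> * q b)"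
proof -
  have B: "finite B" "B \<subseteq> carrier L" using assms by (auto simp: frame_def)
  have "q v = q (\<Oplus>b\<in>B. c b v \<odot> b)" using assms by (auto simp: frame_def)
  also have "\<dots> \<le> (\<Sum>b\<in>B. q (c b v \<odot> b))"
    using assms B by (intro seminorm_finsum) auto
  also have "\<dots> = (\<Sum>b\<in>B. \<bar>c b v\<bar> * q b)"
    using assms B by (intro sum.cong) (auto simp: seminorm_smult)
  finally show ?thesis .
qed

end

section \<open>The exponential series of ad y and its flow\<close>

context lie_algebra
begin

abbreviation ad_power :: "'a \<Rightarrow> nat \<Rightarrow> 'a \<Rightarrow> 'a" where
  "ad_power y j \<equiv> (\<lambda>v. y \<otimes> v) ^^ j"

lemma ad_power_closed [simp, intro]:
  "y \<in> carrier L \<Longrightarrow> v \<in> carrier L \<Longrightarrow> ad_power y j v \<in> carrier L"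
  by (induction j) (auto simp: bracket_closed)

lemma ad_power_smult:
  "y \<in> carrier L \<Longrightarrow> v \<in> carrier L \<Longrightarrow> ad_power (t \<odot> y) j v = (t ^ j) \<odot> ad_power y j v"
  by (induction j) (auto simp: bracket_smult_left bracket_smult_right bracket_closed smult_smult mult.commute)

lemma linear_functionals_ad:
  "l \<in> linear_functionals L \<Longrightarrow> y \<in> carrier L \<Longrightarrow> (\<lambda>w. l (y \<otimes> w)) \<in> linear_functionals L"
  by (simp add: linear_functionals_def bracket_add_right bracket_smult_right bracket_closed)

text \<open>In \<open>S\<close>, the sum of the absolute coordinates, ad y is bounded by the
  constant \<open>M\<close>, so the series is dominated by a multiple of the series of exp (M |t|).
  The power of \<open>t\<close> is included because the flow is later differentiated as a power
  series in \<open>t\<close>.\<close>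

lemma ad_power_summable:
  assumes fr: "frame B c" and l: "l \<in> linear_functionals L" and y: "y \<in> carrier L" and v: "v \<in> carrier L"
  shows "summable (\<lambda>j. l (ad_power y j v) / fact j * t ^ j)"
proof -
  have B: "finite B" "B \<subseteq> carrier L" "\<And>b. b \<in> B \<Longrightarrow> c b \<in> linear_functionals L"
    using fr by (auto simp: frame_def)
  define S where "S w = (\<Sum>b\<in>B. \<bar>c b w\<bar>)" for w
  define M where "M = (\<Sum>b\<in>B. S (y \<otimes> b))"
  define K where "K = (\<Sum>b\<in>B. \<bar>l b\<bar>)"
  have S0: "0 \<le> S w" for w by (simp add: S_def sum_nonneg)
  have M0: "0 \<le> M" by (simp add: M_def S0 sum_nonneg)
  have SM: "S (y \<otimes> w) \<le> M * S w" if w: "w \<in> carrier L" for w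
  proof -
    have "S (y \<otimes> w) = (\<Sum>a\<in>B. \<bar>\<Sum>b\<in>B. c b w * c a (y \<otimes> b)\<bar>)"
      unfolding S_def
      by (intro sum.cong refl arg_cong[where f = abs] linear_functionals_frame[OF fr] linear_functionals_ad B y w)
    also have "\<dots> \<le> (\<Sum>a\<in>B. \<Sum>b\<in>B. \<bar>c b w\<bar> * \<bar>c a (y \<otimes> b)\<bar>)"
      by (intro sum_mono order_trans[OF sum_abs]) (simp add: abs_mult)
    also have "\<dots> = (\<Sum>b\<in>B. \<bar>c b w\<bar> * S (y \<otimes> b))"
      by (subst sum.swap) (simp add: S_def sum_distrib_left)
    also have "\<dots> \<le> (\<Sum>b\<in>B. \<bar>c b w\<bar> * M)"
      unfolding M_def using B S0 by (intro sum_mono mult_left_mono member_le_sum) auto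
    also have "\<dots> = M * S w" by (simp add: S_def sum_distrib_left mult.commute)
    finally show ?thesis .
  qed
  have Sp: "S (ad_power y j v) \<le> M ^ j * S v" for j
  proof (induction j)
    case (Suc j)
    have "S (ad_power y (Suc j) v) \<le> M * S (ad_power y j v)" using SM y v by simp
    also have "\<dots> \<le> M * (M ^ j * S v)" by (intro mult_left_mono Suc M0)
    finally show ?case by (simp add: mult.assoc)
  qed simp
  have lK: "\<bar>l w\<bar> \<le> K * S w" if w: "w \<in> carrier L" for w
  proof -
    have "\<bar>l w\<bar> = \<bar>\<Sum>b\<in>B. c b w * l b\<bar>" using linear_functionals_frame[OF fr l w] by simp
    also have "\<dots> \<le> (\<Sum>b\<in>B. \<bar>c b w\<bar> * \<bar>l b\<bar>)"
      by (intro order_trans[OF sum_abs]) (simp add: abs_mult)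
    also have "\<dots> \<le> (\<Sum>b\<in>B. \<bar>c b w\<bar> * K)"
      unfolding K_def using B by (intro sum_mono mult_left_mono member_le_sum) auto
    also have "\<dots> = K * S w" by (simp add: S_def sum_distrib_left mult.commute)
    finally show ?thesis .
  qed
  have K0: "0 \<le> K" by (simp add: K_def sum_nonneg)
  have "summable (\<lambda>j. K * S v * ((M * \<bar>t\<bar>) ^ j / fact j))"
    using summable_exp[of "M * \<bar>t\<bar>"] by (intro summable_mult) (simp add: divide_inverse mult.commute)
  then show ?thesis
  proof (rule summable_comparison_test[rotated], intro exI[of _ 0] allI impI)
    fix j
    have "norm (l (ad_power y j v) / fact j * t ^ j) = \<bar>l (ad_power y j v)\<bar> * (\<bar>t\<bar> ^ j / fact j)"
      by (simp add: abs_mult power_abs)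
    also have "\<dots> \<le> (K * (M ^ j * S v)) * (\<bar>t\<bar> ^ j / fact j)"
      using lK[of "ad_power y j v"] Sp[of j] y v K0
      by (intro mult_right_mono) (auto intro: order_trans mult_left_mono)
    finally show "norm (l (ad_power y j v) / fact j * t ^ j) \<le> K * S v * ((M * \<bar>t\<bar>) ^ j / fact j)"
      by (simp add: power_mult_distrib mult_ac)
  qed
qed

lemma exp_ad_unique:
  assumes "finite_dimensional L" "z \<in> carrier L"
    and "\<And>l. l \<in> linear_functionals L \<Longrightarrow> (\<lambda>j. l (ad_power y j v) / fact j) sums l z"
  shows "exp_ad L y v = z"
  unfolding exp_ad_def
proof (rule the_equality)
  fix z' assume z': "z' \<in> carrier L \<and>
    (\<forall>l\<in>linear_functionals L. (\<lambda>j. l (ad_power y j v) / fact j) sums l z')"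
  obtain B c where "frame B c" using finite_dimensional_frame[OF assms(1)] .
  then show "z' = z"
  proof (rule frame_eqI)
    fix b assume "b \<in> B"
    then have "c b \<in> linear_functionals L" using \<open>frame B c\<close> by (simp add: frame_def)
    then show "c b z' = c b z" using z' assms(3) sums_unique2 by blast
  qed (use z' assms(2) in auto)
qed (use assms in auto)

text \<open>The limit is assembled from the sums of the coordinate series; every other functional is
  a finite combination of the coordinates, so its series converges to the right value.\<close>

lemma exp_ad:
  assumes fin: "finite_dimensional L" and y: "y \<in> carrier L" and v: "v \<in> carrier L"
  shows exp_ad_closed: "exp_ad L y v \<in> carrier L"
    and exp_ad_sums: "l \<in> linear_functionals L \<Longrightarrow>
      (\<lambda>j. l (ad_power y j v) / fact j) sums l (exp_ad L y v)"
proof -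
  obtain B c where fr: "frame B c" using finite_dimensional_frame[OF fin] .
  then have B: "finite B" "B \<subseteq> carrier L" "\<And>b. b \<in> B \<Longrightarrow> c b \<in> linear_functionals L"
    by (auto simp: frame_def)
  define s where "s b = (\<Sum>j. c b (ad_power y j v) / fact j)" for b
  have s: "(\<lambda>j. c b (ad_power y j v) / fact j) sums s b" if "b \<in> B" for b
    unfolding s_def using ad_power_summable[OF fr B(3)[OF that] y v, of 1] by (simp add: summable_sums)
  define z where "z = (\<Oplus>b\<in>B. s b \<odot> b)"
  have z: "z \<in> carrier L" unfolding z_def using B by (intro finsum_closed) auto
  have zs: "(\<lambda>j. l (ad_power y j v) / fact j) sums l z" if l: "l \<in> linear_functionals L" for l
  proof -
    have "l z = (\<Sum>b\<in>B. l (s b \<odot> b))"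
      unfolding z_def using B by (intro linear_functionals_finsum l) auto
    also have "\<dots> = (\<Sum>b\<in>B. s b * l b)"
      using B l by (intro sum.cong) (auto simp: linear_functionals_smult)
    finally have lz: "l z = (\<Sum>b\<in>B. s b * l b)" .
    have "(\<lambda>j. \<Sum>b\<in>B. c b (ad_power y j v) / fact j * l b) sums (\<Sum>b\<in>B. s b * l b)"
      by (intro sums_sum sums_mult2 s)
    moreover have "(\<Sum>b\<in>B. c b (ad_power y j v) / fact j * l b) = l (ad_power y j v) / fact j" for j
      using linear_functionals_frame[OF fr l, of "ad_power y j v"] y v
      by (simp add: sum_divide_distrib)
    ultimately show ?thesis by (simp add: lz)
  qed
  have eq: "exp_ad L y v = z" by (rule exp_ad_unique[OF fin z zs])
  show "exp_ad L y v \<in> carrier L" using eq z by simp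
  show "l \<in> linear_functionals L \<Longrightarrow> (\<lambda>j. l (ad_power y j v) / fact j) sums l (exp_ad L y v)"
    using eq zs by simp
qed

lemma exp_ad_zero: "finite_dimensional L \<Longrightarrow> y \<in> carrier L \<Longrightarrow> v \<in> carrier L \<Longrightarrow> exp_ad L (0 \<odot> y) v = v"
proof (rule exp_ad_unique)
  fix l assume l: "l \<in> linear_functionals L" and y: "y \<in> carrier L" "v \<in> carrier L"
  \<comment> \<open>The series is read as a power series evaluated at 0, where only the term j = 0
    survives because 0 ^ 0 = 1.\<close>
  have "(\<lambda>j. l (ad_power (0 \<odot> y) j v) / fact j) = (\<lambda>j. (l (ad_power y j v) / fact j) * 0 ^ j)"
    using y l by (auto simp: ad_power_smult linear_functionals_smult simp del: smult_zero_eq)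
  then show "(\<lambda>j. l (ad_power (0 \<odot> y) j v) / fact j) sums l v"
    using powser_sums_zero[of "\<lambda>j. l (ad_power y j v) / fact j"] by simp
qed auto

text \<open>The left side is an everywhere convergent power series in \<open>t\<close>. Its formal
  derivative shifts the index by one, and this shift is the series of the functional w \<mapsto> l
  [y, w].\<close>

lemma exp_ad_has_derivative:
  assumes fin: "finite_dimensional L" and y: "y \<in> carrier L" and v: "v \<in> carrier L"
    and l: "l \<in> linear_functionals L"
  shows "((\<lambda>t. l (exp_ad L (t \<odot> y) v)) has_real_derivative l (y \<otimes> exp_ad L (t \<odot> y) v)) (at t)"
proof -
  obtain B c where fr: "frame B c" using finite_dimensional_frame[OF fin] .
  have ser: "(\<Sum>j. f (ad_power y j v) / fact j * t ^ j) = f (exp_ad L (t \<odot> y) v)"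
    if f: "f \<in> linear_functionals L" for f t
  proof -
    have "(\<lambda>j. f (ad_power (t \<odot> y) j v) / fact j) = (\<lambda>j. f (ad_power y j v) / fact j * t ^ j)"
      using y v f by (auto simp: ad_power_smult linear_functionals_smult)
    then show ?thesis
      using exp_ad_sums[OF fin _ v f, of "t \<odot> y"] y by (simp add: sums_iff)
  qed
  let ?a = "\<lambda>j. l (ad_power y j v) / fact j"
  have "((\<lambda>t. \<Sum>j. ?a j * t ^ j) has_real_derivative (\<Sum>j. diffs ?a j * t ^ j)) (at t)"
    by (intro termdiffs_strong_converges_everywhere ad_power_summable[OF fr l y v])
  moreover have "diffs ?a j = l (y \<otimes> ad_power y j v) / fact j" for j
    by (simp add: diffs_def field_simps del: of_nat_Suc)
  ultimately show ?thesis
    using ser[OF l] ser[OF linear_functionals_ad[OF l y]] by simp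
qed

text \<open>
  Along the flow \<open>u\<close> of \<open>ad y\<close>, the function \<open>q \<circ> u\<close> has derivative zero: \<open>u (t + h)\<close> is
  \<open>u t + h [y, u t]\<close> up to \<open>o(h)\<close>, and the latter has almost the same \<open>q\<close> as \<open>u t\<close>. The lower
  estimate comes from applying the hypothesis to \<open>- h\<close>.
\<close>

lemma exp_ad_invariant_seminorm:
  assumes fin: "finite_dimensional L" and q: "seminorm q" and y: "y \<in> carrier L" and v: "v \<in> carrier L"
    and C: "0 \<le> C" "\<And>h v. v \<in> carrier L \<Longrightarrow> q (v \<oplus> h \<odot> (y \<otimes> v)) \<le> (1 + C * h\<^sup>2) * q v"
  shows "q (exp_ad L y v) = q v"
proof -
  obtain B c where fr: "frame B c" using finite_dimensional_frame[OF fin] .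
  then have B: "finite B" "B \<subseteq> carrier L" "\<And>b. b \<in> B \<Longrightarrow> c b \<in> linear_functionals L"
    by (auto simp: frame_def)
  define u where "u t = exp_ad L (t \<odot> y) v" for t
  have u: "u t \<in> carrier L" for t unfolding u_def using exp_ad_closed[OF fin] y v by simp
  have "((\<lambda>t. q (u t)) has_real_derivative 0) (at t)" for t
  proof -
    define w where "w = u t"
    define w' where "w' = y \<otimes> w"
    have w: "w \<in> carrier L" "w' \<in> carrier L" "y \<otimes> w' \<in> carrier L"
      using u y by (auto simp: w_def w'_def bracket_closed)
    \<comment> \<open>Collects the second-order errors of both directions: the last summand for the
      upper estimate, the others for the lower one, where 1 + C bounds 1 + C h^2 for |h| \<le>
      1.\<close>
    define A where "A = C * (1 + C) * q w + q (y \<otimes> w') + C * q w"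
    \<comment> \<open>The remainder of the first-order expansion of the flow at \<open>t\<close>,
      measured in coordinates. As every coordinate is differentiable, R h / |h| tends to 0.\<close>
    define R where "R h = (\<Sum>b\<in>B. \<bar>c b (u (t + h)) - c b w - h * c b w'\<bar> * q b)" for h
    have diff: "q (u (t + h) \<oplus> (-1) \<odot> (w \<oplus> h \<odot> w')) \<le> R h" for h
    proof -
      have "q (u (t + h) \<oplus> (-1) \<odot> (w \<oplus> h \<odot> w')) \<le>
          (\<Sum>b\<in>B. \<bar>c b (u (t + h) \<oplus> (-1) \<odot> (w \<oplus> h \<odot> w'))\<bar> * q b)"
        using u w by (intro seminorm_frame_le[OF q fr]) auto
      also have "\<dots> = R h"
        unfolding R_def using u w B
        by (intro sum.cong) (simp_all add: linear_functionals_add linear_functionals_smult algebra_simps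
          flip: minus_smult)
      finally show ?thesis .
    qed
    have upper: "q (u (t + h)) \<le> q (w \<oplus> h \<odot> w') + R h" for h
    proof -
      have "u (t + h) = (w \<oplus> h \<odot> w') \<oplus> (u (t + h) \<oplus> (-1) \<odot> (w \<oplus> h \<odot> w'))"
        using u w a_lcomm[of "w \<oplus> h \<odot> w'" "u (t + h)" "\<ominus> (w \<oplus> h \<odot> w')"]
          r_neg[of "w \<oplus> h \<odot> w'"] by (simp add: smult_minus_one)
      then show ?thesis
        using seminorm_triangle[OF q, of "w \<oplus> h \<odot> w'" "u (t + h) \<oplus> (-1) \<odot> (w \<oplus> h \<odot> w')"]
          diff[of h] u w by auto
    qed
    have lower: "q (w \<oplus> h \<odot> w') \<le> q (u (t + h)) + R h" for h
    proof -
      let ?d = "u (t + h) \<oplus> (-1) \<odot> (w \<oplus> h \<odot> w')"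
      have "(-1) \<odot> ?d = (-1) \<odot> u (t + h) \<oplus> (w \<oplus> h \<odot> w')"
        using u w by (subst smult_add_right) (auto simp: smult_smult)
      then have "w \<oplus> h \<odot> w' = u (t + h) \<oplus> (-1) \<odot> ?d"
        using u[of "t + h"] w by (simp add: smult_minus_one a_assoc[symmetric] r_neg)
      then show ?thesis
        using seminorm_triangle[OF q, of "u (t + h)" "(-1) \<odot> ?d"] seminorm_smult[OF q, of ?d "-1"]
          diff[of h] u w by auto
    qed
    have est: "\<bar>q (u (t + h)) - q w\<bar> \<le> R h + A * h\<^sup>2" if h: "\<bar>h\<bar> \<le> 1" for h
    proof -
      have h2: "h\<^sup>2 \<le> 1" using h by (simp add: abs_square_le_1)
      have 1: "q (w \<oplus> h \<odot> w') \<le> (1 + C * h\<^sup>2) * q w" using C(2)[of w h] w by (simp add: w'_def)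
      have nn: "0 \<le> q w" "0 \<le> q (y \<otimes> w')" "0 \<le> q (w \<oplus> h \<odot> w')"
        using w by (auto intro!: seminorm_nonneg[OF q])
      \<comment> \<open>Going back by - h almost undoes the step: (1 - h ad y) (1 + h ad y) w = w -
        h^2 [y, [y, w]]. This bounds q w by q ?e up to order h^2.\<close>
      let ?e = "w \<oplus> h \<odot> w'"
      have "y \<otimes> ?e = w' \<oplus> h \<odot> (y \<otimes> w')"
        using w y by (simp add: bracket_add_right bracket_smult_right w'_def)
      then have "?e \<oplus> (- h) \<odot> (y \<otimes> ?e) = w \<oplus> (h \<odot> w' \<oplus> ((- h) \<odot> w' \<oplus> (- h * h) \<odot> (y \<otimes> w')))"
        using w by (simp add: smult_add_right smult_smult a_assoc)
      also have "\<dots> = w \<oplus> ((h + - h) \<odot> w' \<oplus> (- h * h) \<odot> (y \<otimes> w'))"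
        unfolding smult_add_left[OF w(2)] using w by (simp add: a_assoc)
      finally have "?e \<oplus> (- h) \<odot> (y \<otimes> ?e) = w \<oplus> (- h * h) \<odot> (y \<otimes> w')" using w by simp
      then have "(?e \<oplus> (- h) \<odot> (y \<otimes> ?e)) \<oplus> (h * h) \<odot> (y \<otimes> w') = w"
        using w by (simp add: a_assoc smult_add_left[symmetric])
      from arg_cong[OF this, of q] have "q w \<le> q (?e \<oplus> (- h) \<odot> (y \<otimes> ?e)) + q ((h * h) \<odot> (y \<otimes> w'))"
        using w y seminorm_triangle[OF q, of "?e \<oplus> (- h) \<odot> (y \<otimes> ?e)" "(h * h) \<odot> (y \<otimes> w')"]
        by (simp add: bracket_closed)
      also have "\<dots> \<le> (1 + C * h\<^sup>2) * q ?e + h\<^sup>2 * q (y \<otimes> w')"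
        using C(2)[of ?e "- h"] w seminorm_smult[OF q, of "y \<otimes> w'" "h * h"]
        by (simp add: power2_eq_square)
      finally have 2: "q w \<le> q ?e + C * h\<^sup>2 * q ?e + h\<^sup>2 * q (y \<otimes> w')" by (simp add: algebra_simps)
      have "(1 + C * h\<^sup>2) * q w \<le> (1 + C) * q w"
        using h2 C nn by (intro mult_right_mono) (auto simp: mult_left_le)
      with 1 have "q ?e \<le> (1 + C) * q w" by linarith
      then have "C * h\<^sup>2 * q ?e \<le> C * h\<^sup>2 * ((1 + C) * q w)" using C by (intro mult_left_mono) auto
      with 2 have 3: "q w \<le> q ?e + h\<^sup>2 * (C * (1 + C) * q w + q (y \<otimes> w'))"
        by (simp add: algebra_simps)
      have "h\<^sup>2 * (C * (1 + C) * q w + q (y \<otimes> w')) \<le> A * h\<^sup>2" "C * h\<^sup>2 * q w \<le> A * h\<^sup>2"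
        using C nn by (auto simp: A_def algebra_simps)
      then show ?thesis using upper[of h] lower[of h] 1 3 by (auto simp: abs_le_iff algebra_simps)
    qed
    have "((\<lambda>h. (\<Sum>b\<in>B. \<bar>(c b (u (t + h)) - c b w) / h - c b w'\<bar> * q b) + A * \<bar>h\<bar>) \<longlongrightarrow>
        (\<Sum>b\<in>B. \<bar>c b w' - c b w'\<bar> * q b) + A * \<bar>0\<bar>) (at 0)"
    proof (intro tendsto_intros)
      fix b assume "b \<in> B"
      show "((\<lambda>h. (c b (u (t + h)) - c b w) / h) \<longlongrightarrow> c b w') (at 0)"
        using exp_ad_has_derivative[OF fin y v B(3)[OF \<open>b \<in> B\<close>], of t]
        unfolding DERIV_def u_def[symmetric] w_def w'_def .
    qed
    then have lim: "((\<lambda>h. (\<Sum>b\<in>B. \<bar>(c b (u (t + h)) - c b w) / h - c b w'\<bar> * q b) + A * \<bar>h\<bar>) \<longlongrightarrow> 0) (at 0)"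
      by simp
    have "((\<lambda>h. (q (u (t + h)) - q (u t)) / h) \<longlongrightarrow> 0) (at 0)"
    proof (rule Lim_null_comparison[OF _ lim])
      have "\<forall>\<^sub>F h in at 0. h \<noteq> 0 \<and> \<bar>h\<bar> \<le> (1::real)"
        by (auto simp: eventually_at intro!: exI[of _ 1])
      then show "\<forall>\<^sub>F h in at 0. norm ((q (u (t + h)) - q (u t)) / h) \<le>
          (\<Sum>b\<in>B. \<bar>(c b (u (t + h)) - c b w) / h - c b w'\<bar> * q b) + A * \<bar>h\<bar>"
      proof eventually_elim
        case (elim h)
        have "norm ((q (u (t + h)) - q (u t)) / h) \<le> (R h + A * h\<^sup>2) / \<bar>h\<bar>"
          using est[of h] elim by (simp add: w_def[symmetric] divide_right_mono)
        also have "\<dots> = R h / \<bar>h\<bar> + A * \<bar>h\<bar>"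
          using elim by (simp add: add_divide_distrib power2_eq_square) (simp add: abs_if)
        also have "R h / \<bar>h\<bar> = (\<Sum>b\<in>B. \<bar>(c b (u (t + h)) - c b w) / h - c b w'\<bar> * q b)"
          unfolding R_def sum_divide_distrib
        proof (intro sum.cong refl)
          fix b
          have "(c b (u (t + h)) - c b w) / h - c b w' = (c b (u (t + h)) - c b w - h * c b w') / h"
            using elim by (simp add: field_simps)
          then show "\<bar>c b (u (t + h)) - c b w - h * c b w'\<bar> * q b / \<bar>h\<bar> =
              \<bar>(c b (u (t + h)) - c b w) / h - c b w'\<bar> * q b" by simp
        qed
        finally show ?case .
      qed
    qed
    then show ?thesis by (simp add: DERIV_def)
  qed
  then have "q (u 1) = q (u 0)" using DERIV_isconst_all[of "\<lambda>t. q (u t)"] by blast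
  then show ?thesis using exp_ad_zero[OF fin y v] y by (simp add: u_def)
qed

end

section \<open>Cocompact ideals as null spaces of invariant seminorms\<close>

context lie_algebra_ideal
begin

lemma linear_functionals_quotient:
  "l \<in> linear_functionals (lie_quotient L I) \<Longrightarrow> (\<lambda>v. l (I +> v)) \<in> linear_functionals L"
  by (auto simp: linear_functionals_def coset_in_quotient simp flip: quotient_add quotient_smult)

text \<open>The quotient map intertwines the powers of ad, and functionals on the quotient pull back
  to \<open>L\<close>. Hence the coset of the limit has the property that characterizes the
  exponential in the quotient.\<close>

lemma exp_ad_quotient:
  assumes fin: "finite_dimensional L" and "y \<in> carrier L" "v \<in> carrier L"
  shows "exp_ad (lie_quotient L I) (I +> y) (I +> v) = I +> exp_ad L y v"
proof -
  interpret Q: lie_algebra "lie_quotient L I" by (rule quotient_lie_algebra)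
  have "Q.ad_power (I +> y) j (I +> v) = I +> ad_power y j v" for j
    using assms by (induction j) (auto simp: quotient_mult)
  then show ?thesis
    using assms exp_ad_sums[OF assms linear_functionals_quotient] exp_ad_closed[OF assms]
    by (intro Q.exp_ad_unique) (auto simp: quotient_finite_dimensional coset_in_quotient)
qed

text \<open>A seminorm becomes a norm modulo its null space, and by \<open>exp_ad_quotient\<close>
  this norm inherits the invariance.\<close>

lemma compact_quotient_if_invariant_seminorm:
  assumes fin: "finite_dimensional L" and q: "seminorm q" and I: "\<And>v. v \<in> carrier L \<Longrightarrow> v \<in> I \<longleftrightarrow> q v = 0"
    and inv: "\<And>y v. y \<in> carrier L \<Longrightarrow> v \<in> carrier L \<Longrightarrow> q (exp_ad L y v) = q v"
  shows "compact_lie_algebra (lie_quotient L I)"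
proof -
  let ?Q = "lie_quotient L I"
  interpret Q: lie_algebra ?Q by (rule quotient_lie_algebra)
  \<comment> \<open>The representative is arbitrary; by \<open>le\<close>, in both directions, the
    value does not depend on it.\<close>
  define N where "N C = q (SOME v. v \<in> carrier L \<and> C = I +> v)" for C
  have le: "q v \<le> q w" if "v \<in> carrier L" "w \<in> carrier L" "I +> v = I +> w" for v w
  proof -
    have "v \<in> I +> w" using I.a_rcos_self[OF that(1)] that(3) by simp
    then obtain h where h: "h \<in> I" "v = h \<oplus> w" by (rule cosetE)
    have hL: "h \<in> carrier L" using h(1) by (rule I_carrier)
    have "q h = 0" using h(1) I[OF hL] by (rule iffD1[rotated])
    with seminorm_triangle[OF q hL that(2)] show ?thesis unfolding h(2) by linarith
  qed
  have N: "N (I +> v) = q v" if "v \<in> carrier L" for v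
  proof -
    have "\<exists>w. w \<in> carrier L \<and> I +> v = I +> w" using that by auto
    from someI_ex[OF this] show ?thesis
      unfolding N_def using that by (intro antisym le) auto
  qed
  have "vector_norm ?Q N"
    unfolding vector_norm_def
  proof (intro conjI ballI allI)
    fix C D r assume "C \<in> carrier ?Q" "D \<in> carrier ?Q"
    then obtain v w where vw: "v \<in> carrier L" "C = I +> v" "w \<in> carrier L" "D = I +> w"
      by (metis quotient_carrierE)
    show "0 \<le> N C" using vw by (simp add: N seminorm_nonneg[OF q])
    show "N C = 0 \<longleftrightarrow> C = \<zero>\<^bsub>?Q\<^esub>"
      using vw I[OF vw(1)] I_subset by (simp add: N coset_eq_self_iff quotient_zero)
    show "N (r \<odot>\<^bsub>?Q\<^esub> C) = \<bar>r\<bar> * N C" using vw by (simp add: N quotient_smult seminorm_smult[OF q])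
    show "N (C \<oplus>\<^bsub>?Q\<^esub> D) \<le> N C + N D"
      using vw by (simp add: N quotient_add seminorm_triangle[OF q])
  qed
  \<comment> \<open>The induction has to carry membership in the quotient along, since a further
    exponential is controlled only on cosets.\<close>
  moreover have "g C \<in> carrier ?Q \<and> N (g C) = N C" if "g \<in> adjoint_group ?Q" "C \<in> carrier ?Q" for g C
    using that(1)
  proof induction
    case (step g D)
    obtain v y where vy: "v \<in> carrier L" "g C = I +> v" "y \<in> carrier L" "D = I +> y"
      using step by (metis quotient_carrierE)
    then show ?case
      using step exp_ad_quotient[OF fin, of y v] exp_ad_closed[OF fin, of y v] inv[of y v]
      by (simp add: N coset_in_quotient)
  qed (use that in simp)
  ultimately show ?thesis
    unfolding compact_lie_algebra_def
    using quotient_lie_algebra quotient_finite_dimensional[OF fin] by blast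
qed

text \<open>The invariant norm is pulled back along the quotient map. With the preceding lemma,
  cocompact ideals become the ideals that are null spaces of invariant seminorms, and seminorms,
  unlike ideals with compact quotient, are easily combined: they can be added.\<close>

lemma invariant_seminorm_if_compact_quotient:
  assumes fin: "finite_dimensional L" and "compact_lie_algebra (lie_quotient L I)"
  obtains q where "seminorm q" "I = {v \<in> carrier L. q v = 0}"
    "\<And>y v. y \<in> carrier L \<Longrightarrow> v \<in> carrier L \<Longrightarrow> q (exp_ad L y v) = q v"
proof -
  let ?Q = "lie_quotient L I"
  obtain N where N: "vector_norm ?Q N"
    and inv: "\<And>g C. g \<in> adjoint_group ?Q \<Longrightarrow> C \<in> carrier ?Q \<Longrightarrow> N (g C) = N C"
    using assms(2) by (auto simp: compact_lie_algebra_def)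
  show thesis
  proof (rule that[of "\<lambda>v. N (I +> v)"])
    show "seminorm (\<lambda>v. N (I +> v))"
      using N unfolding seminorm_def vector_norm_def
      by (auto simp: coset_in_quotient simp flip: quotient_add quotient_smult)
    show "I = {v \<in> carrier L. N (I +> v) = 0}"
    proof -
      have "N (I +> v) = 0 \<longleftrightarrow> v \<in> I" if "v \<in> carrier L" for v
        using N coset_eq_self_iff[OF that] I_subset coset_in_quotient[OF that]
        by (simp add: vector_norm_def quotient_zero)
      then show ?thesis using I_subset by blast
    qed
    fix y v assume yv: "y \<in> carrier L" "v \<in> carrier L"
    have "exp_ad ?Q (I +> y) \<circ> id \<in> adjoint_group ?Q"
      using yv by (intro adjoint_group.intros coset_in_quotient)
    from inv[OF this coset_in_quotient[OF yv(2)]]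
    show "N (I +> exp_ad L y v) = N (I +> v)"
      using exp_ad_quotient[OF fin yv] by simp
  qed
qed

end

section \<open>Infinitesimally invariant seminorms and minimality\<close>

context lie_algebra
begin

text \<open>For q v = 0 and h = 1 the bound gives q (v + [y, v]) = 0; the bracket differs from this
  null vector by the null vector \<open>v\<close>.\<close>

lemma seminorm_kernel_ideal:
  assumes q: "seminorm q"
    and inv: "\<And>y. y \<in> carrier L \<Longrightarrow>
      \<exists>C\<ge>0. \<forall>h. \<forall>v\<in>carrier L. q (v \<oplus> h \<odot> (y \<otimes> v)) \<le> (1 + C * h\<^sup>2) * q v"
  shows "lie_ideal {v \<in> carrier L. q v = 0} L"
  unfolding lie_ideal_def
proof (intro conjI ballI)
  show "submodule {v \<in> carrier L. q v = 0} real_ring L"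
  proof (rule real_submoduleI)
    fix x y assume "x \<in> {v \<in> carrier L. q v = 0}" "y \<in> {v \<in> carrier L. q v = 0}"
    then show "x \<oplus> y \<in> {v \<in> carrier L. q v = 0}"
      using seminorm_triangle[OF q, of x y] seminorm_nonneg[OF q, of "x \<oplus> y"] by auto
  qed (auto simp: seminorm_zero[OF q] seminorm_smult[OF q])
  fix y v assume y: "y \<in> carrier L" and "v \<in> {v \<in> carrier L. q v = 0}"
  then have v: "v \<in> carrier L" "q v = 0" by auto
  obtain C where "\<forall>h. \<forall>v\<in>carrier L. q (v \<oplus> h \<odot> (y \<otimes> v)) \<le> (1 + C * h\<^sup>2) * q v"
    using inv[OF y] by blast
  then have "q (v \<oplus> 1 \<odot> (y \<otimes> v)) \<le> (1 + C * 1\<^sup>2) * q v" using v by blast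
  then have *: "q (v \<oplus> y \<otimes> v) \<le> 0" using v y by (simp add: bracket_closed)
  have "y \<otimes> v = (v \<oplus> y \<otimes> v) \<oplus> (-1) \<odot> v"
    using v y a_lcomm[of v "y \<otimes> v" "\<ominus> v"] by (simp add: bracket_closed smult_minus_one a_assoc r_neg)
  then have "q (y \<otimes> v) \<le> q (v \<oplus> y \<otimes> v) + q ((-1) \<odot> v)"
    using v y seminorm_triangle[OF q, of "v \<oplus> y \<otimes> v" "(-1) \<odot> v"] by (simp add: bracket_closed)
  with * v have "q (y \<otimes> v) \<le> 0" using seminorm_smult[OF q v(1), of "-1"] by simp
  then show "y \<otimes> v \<in> {v \<in> carrier L. q v = 0}"
    using y v seminorm_nonneg[OF q, of "y \<otimes> v"] by (auto simp: bracket_closed)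
qed

lemma minimal_cocompact_ideal_seminorm:
  assumes fin: "finite_dimensional L" and n: "minimal_cocompact_ideal \<nn> L" and q: "seminorm q"
    and inv: "\<And>y. y \<in> carrier L \<Longrightarrow>
      \<exists>C\<ge>0. \<forall>h. \<forall>v\<in>carrier L. q (v \<oplus> h \<odot> (y \<otimes> v)) \<le> (1 + C * h\<^sup>2) * q v"
    and v: "v \<in> \<nn>"
  shows "q v = 0"
proof -
  have nid: "lie_ideal \<nn> L" and ncp: "compact_lie_algebra (lie_quotient L \<nn>)"
    using n by (auto simp: minimal_cocompact_ideal_def)
  have "lie_algebra_ideal L \<nn>"
    using nid by (intro lie_algebra_ideal.intro lie_algebra_ideal_axioms.intro lie_algebra_axioms)
  then obtain p where p: "seminorm p" "\<nn> = {v \<in> carrier L. p v = 0}"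
    "\<And>y v. y \<in> carrier L \<Longrightarrow> v \<in> carrier L \<Longrightarrow> p (exp_ad L y v) = p v"
    using lie_algebra_ideal.invariant_seminorm_if_compact_quotient[OF _ fin ncp] by blast
  let ?K = "{v \<in> carrier L. q v = 0}"
  define J where "J = \<nn> \<inter> ?K"
  have K: "lie_ideal ?K L" by (rule seminorm_kernel_ideal[OF q inv])
  have J: "lie_ideal J L"
    using submodule_props[OF lie_ideal_submodule[OF K]] submodule_props[OF lie_ideal_submodule[OF nid]]
      K nid unfolding lie_ideal_def J_def by (intro conjI real_submoduleI) auto
  have qinv: "q (exp_ad L y w) = q w" if "y \<in> carrier L" "w \<in> carrier L" for y w
    using inv[OF that(1)] exp_ad_invariant_seminorm[OF fin q that] by blast
  \<comment> \<open>The sum of the two invariant seminorms has null space \<open>J\<close>, which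
    makes the quotient by \<open>J\<close> compact.\<close>
  have sn: "seminorm (\<lambda>v. p v + q v)"
    unfolding seminorm_def
  proof (intro conjI ballI allI)
    fix v w r assume vw: "v \<in> carrier L" "w \<in> carrier L"
    show "0 \<le> p v + q v" using vw seminorm_nonneg[OF q] seminorm_nonneg[OF p(1)] by simp
    show "p (r \<odot> v) + q (r \<odot> v) = \<bar>r\<bar> * (p v + q v)"
      using vw by (simp add: seminorm_smult[OF q] seminorm_smult[OF p(1)] algebra_simps)
    show "p (v \<oplus> w) + q (v \<oplus> w) \<le> p v + q v + (p w + q w)"
      using seminorm_triangle[OF q vw] seminorm_triangle[OF p(1) vw] by simp
  qed
  have "v \<in> J \<longleftrightarrow> p v + q v = 0" if "v \<in> carrier L" for v
    unfolding J_def p(2) using that seminorm_nonneg[OF p(1) that] seminorm_nonneg[OF q that]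
    by (auto simp: add_nonneg_eq_0_iff)
  then have "compact_lie_algebra (lie_quotient L J)"
    using J p(3) qinv
    by (intro lie_algebra_ideal.compact_quotient_if_invariant_seminorm[OF _ fin sn])
      (auto intro!: lie_algebra_ideal.intro lie_algebra_ideal_axioms.intro lie_algebra_axioms)
  moreover have "J \<subseteq> \<nn>" by (simp add: J_def)
  ultimately have "J = \<nn>" using n J by (simp add: minimal_cocompact_ideal_def)
  then show ?thesis using v by (auto simp: J_def)
qed

end

section \<open>The projective unitary Lie algebra\<close>

lemma cinner_add_left: "cinner (x + y) z = cinner x z + cinner y z"
  using cinner_commute[of "x + y" z] cinner_commute[of x z] cinner_commute[of y z]
  by (simp add: cinner_add_right)

lemma cinner_scaleR_right: "cinner x (r *\<^sub>R y) = of_real r * cinner x y"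
  by (simp add: cinner_scaleC_right flip: scaleC_of_real)

lemma cinner_scaleR_left: "cinner (r *\<^sub>R x) y = of_real r * cinner x y"
  using cinner_commute[of "r *\<^sub>R x" y] cinner_commute[of x y] by (simp add: cinner_scaleR_right)

lemma cinner_minus_left: "cinner (- x) y = - cinner x y"
  using cinner_scaleR_left[of "-1" x y] by simp

lemma cinner_minus_right: "cinner x (- y) = - cinner x y"
  using cinner_scaleR_right[of x "-1" y] by simp

lemma cinner_diff_left: "cinner (x - y) z = cinner x z - cinner y z"
  using cinner_add_left[of x "- y" z] by (simp add: cinner_minus_left)

lemma cinner_diff_right: "cinner x (y - z) = cinner x y - cinner x z"
  using cinner_add_right[of x y "- z"] by (simp add: cinner_minus_right)

lemma cinner_zero_left [simp]: "cinner 0 x = 0"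
  using cinner_scaleR_left[of 0 0 x] by simp

lemma cinner_zero_right [simp]: "cinner x 0 = 0"
  using cinner_scaleR_right[of x 0 0] by simp

lemma scaleC_zero_right [simp]: "scaleC c 0 = 0"
  using scaleC_add_right[of c 0 0] by simp

lemma scaleC_scaleR: "scaleC c (r *\<^sub>R x) = r *\<^sub>R scaleC c x"
  by (simp add: scaleC_scaleC mult.commute flip: scaleC_of_real)

lemma scaleC_minus_right: "scaleC c (- x) = - scaleC c x"
  using scaleC_scaleR[of c "-1" x] by simp

lemma scaleC_diff_right: "scaleC c (x - y) = scaleC c x - scaleC c y"
  using scaleC_add_right[of c x "- y"] by (simp add: scaleC_minus_right)

lemma cinner_scaleC_left: "cinner (scaleC c x) y = cnj c * cinner x y"
  using cinner_commute[of "scaleC c x" y] cinner_commute[of x y] by (simp add: cinner_scaleC_right)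

lemma norm_scaleC: "norm (scaleC c x) = norm c * norm x"
proof -
  have "complex_of_real ((norm (scaleC c x))\<^sup>2) = (c * cnj c) * complex_of_real ((norm x)\<^sup>2)"
    unfolding cinner_norm[symmetric] by (simp add: cinner_scaleC_left cinner_scaleC_right)
  also have "\<dots> = complex_of_real ((norm c * norm x)\<^sup>2)"
    by (simp add: power_mult_distrib flip: complex_norm_square)
  finally have "(norm (scaleC c x))\<^sup>2 = (norm c * norm x)\<^sup>2" using of_real_eq_iff by blast
  then show ?thesis by (simp add: power2_eq_iff_nonneg)
qed

section \<open>Skew-hermitian operators and the imaginary scalars\<close>

definition scaleC_i :: "'h::complex_hilbert_space \<Rightarrow>\<^sub>L 'h" where
  "scaleC_i = Blinfun (scaleC \<i>)"

lemma scaleC_i_apply [simp]: "blinfun_apply scaleC_i x = scaleC \<i> x"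
proof -
  have "bounded_linear (scaleC \<i> :: 'a \<Rightarrow> 'a)"
    by (rule bounded_linear_intro[where K = 1])
      (auto simp: scaleC_add_right scaleC_scaleR norm_scaleC)
  then show ?thesis by (simp add: scaleC_i_def bounded_linear_Blinfun_apply)
qed

lemma imaginary_scalars_eq: "imaginary_scalars = range (\<lambda>t. t *\<^sub>R scaleC_i)"
proof -
  have "(\<forall>x. blinfun_apply A x = scaleC (\<i> * complex_of_real t) x) \<longleftrightarrow> A = t *\<^sub>R scaleC_i"
    for A :: "'a \<Rightarrow>\<^sub>L 'a" and t
    by (auto intro!: blinfun_eqI simp: scaleC_scaleC scaleR_blinfun.rep_eq mult.commute simp flip: scaleC_of_real)
  then show ?thesis by (auto simp: imaginary_scalars_def)
qed

text \<open>For nonzero \<open>v\<close> the map t \<mapsto> t v scales distances by norm v, so its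
  range is complete. Applied to the imaginary scalars, this makes the quotient norm
  definite.\<close>

lemma closed_line:
  fixes v :: "'v::real_normed_vector"
  shows "closed (range (\<lambda>t. t *\<^sub>R v))"
proof (cases "v = 0")
  case False
  have "complete (range (\<lambda>t. t *\<^sub>R v))"
    using False
    by (intro complete_isometric_image[where e = "norm v"] bounded_linear_scaleR_left complete_UNIV)
      (auto simp: mult.commute)
  then show ?thesis by (rule complete_imp_closed)
qed (simp add: image_constant_conv)

lemma skew_hermitian_simps:
  "x \<otimes>\<^bsub>skew_hermitian_algebra\<^esub> y = (x o\<^sub>L y) - (y o\<^sub>L x)" "\<zero>\<^bsub>skew_hermitian_algebra\<^esub> = 0"
  "x \<oplus>\<^bsub>skew_hermitian_algebra\<^esub> y = x + y" "r \<odot>\<^bsub>skew_hermitian_algebra\<^esub> x = r *\<^sub>R x"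
  by (simp_all add: skew_hermitian_algebra_def)

lemma skew_hermitian_carrier_iff:
  "A \<in> carrier skew_hermitian_algebra \<longleftrightarrow>
     (\<forall>c x. blinfun_apply A (scaleC c x) = scaleC c (blinfun_apply A x)) \<and>
     (\<forall>x y. cinner (blinfun_apply A x) y = - cinner x (blinfun_apply A y))"
  by (simp add: skew_hermitian_algebra_def)

lemmas blinfun_simps = blinfun.add_left blinfun.diff_left blinfun.minus_left blinfun.scaleR_left
  blinfun.add_right blinfun.diff_right blinfun.minus_right blinfun.scaleR_right

lemma skew_hermitian_lie_algebra: "lie_algebra skew_hermitian_algebra"
proof -
  let ?U = "skew_hermitian_algebra :: (real, 'a \<Rightarrow>\<^sub>L 'a) module"
  have "abelian_group ?U"
  proof (rule abelian_groupI)
    fix x assume "x \<in> carrier ?U"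
    then show "\<exists>y\<in>carrier ?U. y \<oplus>\<^bsub>?U\<^esub> x = \<zero>\<^bsub>?U\<^esub>"
      by (intro bexI[of _ "- x"])
        (auto simp: skew_hermitian_simps skew_hermitian_carrier_iff blinfun_simps cinner_minus_left
          cinner_minus_right scaleC_minus_right)
  qed (auto simp: skew_hermitian_simps skew_hermitian_carrier_iff blinfun_simps cinner_add_left
      cinner_add_right scaleC_add_right)
  then have "module real_ring ?U"
    by (intro moduleI real_ring_cring)
      (auto simp: skew_hermitian_simps skew_hermitian_carrier_iff blinfun_simps cinner_scaleR_left
        cinner_scaleR_right scaleC_scaleR scaleR_add_left scaleR_add_right)
  then show ?thesis
  proof (rule lie_algebra.intro, unfold_locales)
    fix x y z assume "x \<in> carrier ?U" "y \<in> carrier ?U" "z \<in> carrier ?U"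
    show "(x \<otimes>\<^bsub>?U\<^esub> (y \<otimes>\<^bsub>?U\<^esub> z)) \<oplus>\<^bsub>?U\<^esub> (y \<otimes>\<^bsub>?U\<^esub> (z \<otimes>\<^bsub>?U\<^esub> x)) \<oplus>\<^bsub>?U\<^esub> (z \<otimes>\<^bsub>?U\<^esub> (x \<otimes>\<^bsub>?U\<^esub> y)) = \<zero>\<^bsub>?U\<^esub>"
      by (rule blinfun_eqI) (simp add: skew_hermitian_simps blinfun_simps)
  qed (auto intro!: blinfun_eqI simp: skew_hermitian_simps skew_hermitian_carrier_iff blinfun_simps
      cinner_diff_left cinner_diff_right scaleC_diff_right algebra_simps)
qed

lemma imaginary_scalars_lie_ideal: "lie_ideal imaginary_scalars skew_hermitian_algebra"
proof -
  let ?U = "skew_hermitian_algebra :: (real, 'a \<Rightarrow>\<^sub>L 'a) module"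
  interpret U: lie_algebra ?U by (rule skew_hermitian_lie_algebra)
  have sub: "imaginary_scalars \<subseteq> carrier ?U"
    by (auto simp: imaginary_scalars_eq skew_hermitian_carrier_iff blinfun_simps scaleC_scaleR
      scaleC_scaleC mult.commute cinner_scaleR_left cinner_scaleR_right cinner_scaleC_left cinner_scaleC_right)
  have "x \<otimes>\<^bsub>?U\<^esub> v \<in> imaginary_scalars" if "x \<in> carrier ?U" "v \<in> imaginary_scalars" for x v
  proof -
    have "x \<otimes>\<^bsub>?U\<^esub> v = 0 *\<^sub>R scaleC_i"
      using that by (auto intro!: blinfun_eqI simp: imaginary_scalars_eq skew_hermitian_simps
        skew_hermitian_carrier_iff blinfun_simps)
    then show ?thesis unfolding imaginary_scalars_eq by (metis rangeI)
  qed
  moreover have "submodule imaginary_scalars real_ring ?U"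
  proof (rule U.real_submoduleI[OF sub])
    show "\<zero>\<^bsub>?U\<^esub> \<in> imaginary_scalars"
      unfolding imaginary_scalars_eq skew_hermitian_simps by (metis rangeI scaleR_zero_left)
    show "x \<oplus>\<^bsub>?U\<^esub> y \<in> imaginary_scalars" if "x \<in> imaginary_scalars" "y \<in> imaginary_scalars" for x y
      using that unfolding imaginary_scalars_eq skew_hermitian_simps
      by (auto simp flip: scaleR_add_left)
    show "r \<odot>\<^bsub>?U\<^esub> x \<in> imaginary_scalars" if "x \<in> imaginary_scalars" for r x
      using that unfolding imaginary_scalars_eq skew_hermitian_simps by auto
  qed
  ultimately show ?thesis by (simp add: lie_ideal_def)
qed

interpretation pu: lie_algebra_ideal skew_hermitian_algebra imaginary_scalars
  by (intro lie_algebra_ideal.intro lie_algebra_ideal_axioms.intro skew_hermitian_lie_algebra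
    imaginary_scalars_lie_ideal)

text \<open>
  Up to second order in \<open>h\<close>, \<open>B + h [A, B]\<close> is \<open>(1 + h A) B (1 - h A)\<close>, and skewness of \<open>A\<close> gives
  \<open>\<parallel>(1 + h A) x\<parallel>\<^sup>2 = \<parallel>x\<parallel>\<^sup>2 + h\<^sup>2 \<parallel>A x\<parallel>\<^sup>2\<close>.
\<close>

lemma norm_skew_hermitian_bracket_le:
  fixes A B :: "'h::complex_hilbert_space \<Rightarrow>\<^sub>L 'h"
  assumes A: "A \<in> carrier skew_hermitian_algebra"
  shows "norm (B + h *\<^sub>R ((A o\<^sub>L B) - (B o\<^sub>L A))) \<le> (1 + 2 * (norm A)\<^sup>2 * h\<^sup>2) * norm B"
proof -
  define s where "s = 1 + (norm A)\<^sup>2 * h\<^sup>2"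
  have s0: "0 \<le> s" by (simp add: s_def)
  \<comment> \<open>Formulated for both k = h and k = - h, because both factors 1 + h A and 1 - h A
    have to be estimated.\<close>
  have pyth: "norm (x + k *\<^sub>R A x) \<le> sqrt s * norm x" if k: "k\<^sup>2 = h\<^sup>2" for k x
  proof -
    have "cinner (A x) x = - cinner x (A x)" using A by (simp add: skew_hermitian_carrier_iff)
    then have "cinner (x + k *\<^sub>R A x) (x + k *\<^sub>R A x) = cinner x x + of_real (k\<^sup>2) * cinner (A x) (A x)"
      by (simp add: cinner_add_left cinner_add_right cinner_scaleR_left cinner_scaleR_right power2_eq_square
        algebra_simps)
    then have "complex_of_real ((norm (x + k *\<^sub>R A x))\<^sup>2) = of_real ((norm x)\<^sup>2 + k\<^sup>2 * (norm (A x))\<^sup>2)"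
      unfolding cinner_norm by simp
    then have "(norm (x + k *\<^sub>R A x))\<^sup>2 = (norm x)\<^sup>2 + k\<^sup>2 * (norm (A x))\<^sup>2" using of_real_eq_iff by blast
    also have "\<dots> \<le> (norm x)\<^sup>2 + h\<^sup>2 * (norm A * norm x)\<^sup>2"
      unfolding k by (intro add_left_mono mult_left_mono power_mono norm_blinfun) auto
    also have "\<dots> = (sqrt s * norm x)\<^sup>2"
      using s0 by (simp add: s_def power_mult_distrib algebra_simps)
    finally show ?thesis by (rule power2_le_imp_le) (simp add: s0)
  qed
  show ?thesis
  proof (rule norm_blinfun_bound)
    fix x
    define y where "y = x + (- h) *\<^sub>R A x"
    \<comment> \<open>The exact identity is B + h [A, B] = (1 + h A) B (1 - h A) + h^2 A B A. The
      product contributes the factor \<open>s\<close>, the last term a further (norm A)^2 h^2; this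
      is where the 2 in the constant comes from.\<close>
    have eq: "blinfun_apply (B + h *\<^sub>R ((A o\<^sub>L B) - (B o\<^sub>L A))) x =
        (B y + h *\<^sub>R A (B y)) + h\<^sup>2 *\<^sub>R A (B (A x))"
      by (simp add: y_def blinfun_simps power2_eq_square algebra_simps)
    have "norm (B y + h *\<^sub>R A (B y)) \<le> sqrt s * norm (B y)" by (rule pyth) simp
    also have "\<dots> \<le> sqrt s * (norm B * norm y)"
      using s0 by (intro mult_left_mono norm_blinfun) auto
    also have "\<dots> \<le> sqrt s * (norm B * (sqrt s * norm x))"
      unfolding y_def using s0 by (intro mult_left_mono pyth) auto
    also have "\<dots> = (sqrt s * sqrt s) * (norm B * norm x)" by (simp only: mult_ac)
    also have "\<dots> = s * (norm B * norm x)" using s0 by simp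
    finally have 1: "norm (B y + h *\<^sub>R A (B y)) \<le> s * (norm B * norm x)" .
    have "norm (A (B (A x))) \<le> norm A * norm (B (A x))" by (rule norm_blinfun)
    also have "\<dots> \<le> norm A * (norm B * norm (A x))" by (intro mult_left_mono norm_blinfun) auto
    also have "\<dots> \<le> norm A * (norm B * (norm A * norm x))" by (intro mult_left_mono norm_blinfun) auto
    finally have 2: "h\<^sup>2 * norm (A (B (A x))) \<le> h\<^sup>2 * (norm A * (norm B * (norm A * norm x)))"
      by (rule mult_left_mono) simp
    have "norm (blinfun_apply (B + h *\<^sub>R ((A o\<^sub>L B) - (B o\<^sub>L A))) x) \<le>
        norm (B y + h *\<^sub>R A (B y)) + h\<^sup>2 * norm (A (B (A x)))"
      unfolding eq by (rule order_trans[OF norm_triangle_ineq]) simp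
    also have "\<dots> \<le> s * (norm B * norm x) + h\<^sup>2 * (norm A * (norm B * (norm A * norm x)))"
      by (rule add_mono[OF 1 2])
    also have "\<dots> = (1 + 2 * (norm A)\<^sup>2 * h\<^sup>2) * norm B * norm x"
      by (simp add: s_def power2_eq_square algebra_simps)
    finally show "norm (blinfun_apply (B + h *\<^sub>R ((A o\<^sub>L B) - (B o\<^sub>L A))) x) \<le>
        (1 + 2 * (norm A)\<^sup>2 * h\<^sup>2) * norm B * norm x" .
  qed simp
qed

section \<open>The quotient norm\<close>

lemma coset_imaginary_scalars:
  "imaginary_scalars +>\<^bsub>skew_hermitian_algebra\<^esub> B = (\<lambda>z. z + B) ` imaginary_scalars"
  by (auto simp: a_r_coset_def' skew_hermitian_simps)

lemma quotient_norm_coset_le: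
  "z \<in> imaginary_scalars \<Longrightarrow>
    quotient_norm (imaginary_scalars +>\<^bsub>skew_hermitian_algebra\<^esub> B) \<le> norm (z + B)"
  unfolding quotient_norm_def coset_imaginary_scalars
  by (rule cInf_lower) (auto intro!: bdd_belowI[of _ 0])

lemma quotient_norm_coset_ge:
  fixes B :: "'h::complex_hilbert_space \<Rightarrow>\<^sub>L 'h"
  assumes "\<And>z. z \<in> imaginary_scalars \<Longrightarrow> m \<le> norm (z + B)"
  shows "m \<le> quotient_norm (imaginary_scalars +>\<^bsub>skew_hermitian_algebra\<^esub> B)"
  unfolding quotient_norm_def coset_imaginary_scalars
  using assms by (intro cInf_greatest) (auto simp: imaginary_scalars_eq)

text \<open>Only definiteness needs more than manipulating infima: quotient norm 0 puts
  \<open>B\<close> into the closure of the imaginary scalars, and a line is closed.\<close>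

lemma vector_norm_quotient_norm:
  "vector_norm (projective_skew_hermitian_algebra :: (real, ('h::complex_hilbert_space \<Rightarrow>\<^sub>L 'h) set) module)
     quotient_norm"
proof -
  let ?U = "skew_hermitian_algebra :: (real, 'h \<Rightarrow>\<^sub>L 'h) module"
  let ?I = "imaginary_scalars :: ('h \<Rightarrow>\<^sub>L 'h) set"
  let ?q = "\<lambda>B. quotient_norm (?I +>\<^bsub>?U\<^esub> B)"
  have zI: "0 \<in> ?I" and addI: "\<And>x y. x \<in> ?I \<Longrightarrow> y \<in> ?I \<Longrightarrow> x + y \<in> ?I"
    and smI: "\<And>x r. x \<in> ?I \<Longrightarrow> r *\<^sub>R x \<in> ?I"
    using pu.I_zero pu.I_add pu.I_smult by (auto simp: skew_hermitian_simps)
  have nonneg: "0 \<le> ?q B" for B by (rule quotient_norm_coset_ge) simp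
  have zero: "?q B = 0 \<longleftrightarrow> B \<in> ?I" for B
  proof
    assume "B \<in> ?I"
    then have "- B \<in> ?I" using smI[of B "-1"] by simp
    from quotient_norm_coset_le[OF this, of B] nonneg[of B] show "?q B = 0" by simp
  next
    assume q0: "?q B = 0"
    have "B \<in> closure ?I"
      unfolding closure_approachable
    proof (intro allI impI)
      fix e :: real assume "0 < e"
      then have "\<not> e \<le> ?q B" using q0 by simp
      then obtain z where "z \<in> ?I" "norm (z + B) < e"
        using quotient_norm_coset_ge[of e B] by fastforce
      then show "\<exists>y\<in>?I. dist y B < e"
        using smI[of z "-1"] by (intro bexI[of _ "- z"]) (auto simp: dist_norm norm_minus_commute algebra_simps)
    qed
    then show "B \<in> ?I" unfolding imaginary_scalars_eq closure_closed[OF closed_line] .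
  qed
  \<comment> \<open>One inequality suffices, since the reverse one is this inequality for
    \<open>inverse r\<close> and \<open>r *\<^sub>R B\<close>.\<close>
  have smult_le: "?q (r *\<^sub>R B) \<le> \<bar>r\<bar> * ?q B" for r B
  proof (cases "r = 0")
    case True then show ?thesis using zero[of 0] zI by simp
  next
    case False
    have "?q (r *\<^sub>R B) / \<bar>r\<bar> \<le> ?q B"
    proof (rule quotient_norm_coset_ge)
      fix z assume "z \<in> ?I"
      from quotient_norm_coset_le[OF smI[OF this, of r], of "r *\<^sub>R B"]
      have "?q (r *\<^sub>R B) \<le> \<bar>r\<bar> * norm (z + B)" by (simp flip: scaleR_add_right)
      then show "?q (r *\<^sub>R B) / \<bar>r\<bar> \<le> norm (z + B)"
        using False by (simp add: divide_le_eq mult.commute)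
    qed
    then show ?thesis using False by (simp add: divide_le_eq mult.commute)
  qed
  have smult: "?q (r *\<^sub>R B) = \<bar>r\<bar> * ?q B" for r B
  proof (cases "r = 0")
    case True then show ?thesis using smult_le[of 0 B] nonneg[of 0] by simp
  next
    case False
    have "\<bar>r\<bar> * ?q B \<le> \<bar>r\<bar> * (\<bar>inverse r\<bar> * ?q (r *\<^sub>R B))"
      using smult_le[of "inverse r" "r *\<^sub>R B"] False by (intro mult_left_mono) auto
    also have "\<dots> = ?q (r *\<^sub>R B)" using False by (simp add: abs_inverse)
    finally show ?thesis using smult_le[of r B] by simp
  qed
  have tri: "?q (B + D) \<le> ?q B + ?q D" for B D
  proof -
    \<comment> \<open>The two infima are taken in turn, first over the representatives of
      \<open>B\<close> with \<open>w\<close> fixed, then over \<open>w\<close>.\<close>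
    have "?q (B + D) - norm (w + D) \<le> ?q B" if w: "w \<in> ?I" for w
    proof (rule quotient_norm_coset_ge)
      fix z assume "z \<in> ?I"
      from quotient_norm_coset_le[OF addI[OF this w], of "B + D"]
      have "?q (B + D) \<le> norm ((z + B) + (w + D))" by (simp add: algebra_simps)
      also have "\<dots> \<le> norm (z + B) + norm (w + D)" by (rule norm_triangle_ineq)
      finally show "?q (B + D) - norm (w + D) \<le> norm (z + B)" by simp
    qed
    then have "?q (B + D) - ?q B \<le> norm (w + D)" if "w \<in> ?I" for w using that by fastforce
    from quotient_norm_coset_ge[OF this] show ?thesis by fastforce
  qed
  show ?thesis
    unfolding vector_norm_def projective_skew_hermitian_algebra_def
  proof (intro conjI ballI allI)
    let ?Q = "lie_quotient ?U ?I"
    fix C D r assume "C \<in> carrier ?Q" "D \<in> carrier ?Q"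
    then obtain v w where vw: "v \<in> carrier ?U" "C = ?I +>\<^bsub>?U\<^esub> v" "w \<in> carrier ?U" "D = ?I +>\<^bsub>?U\<^esub> w"
      by (metis pu.quotient_carrierE)
    show "0 \<le> quotient_norm C" using vw nonneg by simp
    show "quotient_norm C = 0 \<longleftrightarrow> C = \<zero>\<^bsub>?Q\<^esub>"
      using vw zero pu.coset_eq_self_iff[OF vw(1)] by (simp add: lie_quotient_def)
    show "quotient_norm (r \<odot>\<^bsub>?Q\<^esub> C) = \<bar>r\<bar> * quotient_norm C"
      using vw smult by (simp add: pu.quotient_smult skew_hermitian_simps)
    show "quotient_norm (C \<oplus>\<^bsub>?Q\<^esub> D) \<le> quotient_norm C + quotient_norm D"
      using vw tri by (simp add: pu.quotient_add skew_hermitian_simps)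
  qed
qed

text \<open>Imaginary scalars commute with the complex-linear operator \<open>a\<close>. Hence
  shifting the representative of \<open>C\<close> by \<open>z\<close> shifts that of C + h [A, C] by
  the same \<open>z\<close>; the operator estimate holds for all representatives of \<open>C\<close>
  with one constant and passes to the infimum.\<close>

lemma quotient_norm_bracket_le:
  fixes A :: "('h::complex_hilbert_space \<Rightarrow>\<^sub>L 'h) set"
  assumes "A \<in> carrier projective_skew_hermitian_algebra"
  obtains M where "0 \<le> M" "\<And>h C. C \<in> carrier projective_skew_hermitian_algebra \<Longrightarrow>
    quotient_norm (C \<oplus>\<^bsub>projective_skew_hermitian_algebra\<^esub>
      h \<odot>\<^bsub>projective_skew_hermitian_algebra\<^esub> (A \<otimes>\<^bsub>projective_skew_hermitian_algebra\<^esub> C))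
    \<le> (1 + M * h\<^sup>2) * quotient_norm C"
proof -
  let ?U = "skew_hermitian_algebra :: (real, 'h \<Rightarrow>\<^sub>L 'h) module"
  let ?I = "imaginary_scalars :: ('h \<Rightarrow>\<^sub>L 'h) set"
  let ?Q = "lie_quotient ?U ?I"
  obtain a where a: "a \<in> carrier ?U" "A = ?I +>\<^bsub>?U\<^esub> a"
    using assms by (auto simp: projective_skew_hermitian_algebra_def elim: pu.quotient_carrierE)
  show thesis
    unfolding projective_skew_hermitian_algebra_def
  proof (rule that[of "2 * (norm a)\<^sup>2"], simp)
    fix h C assume "C \<in> carrier (projective_skew_hermitian_algebra :: (real, ('h \<Rightarrow>\<^sub>L 'h) set) module)"
    then obtain b where b: "b \<in> carrier ?U" "C = ?I +>\<^bsub>?U\<^esub> b"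
      by (auto simp: projective_skew_hermitian_algebra_def elim: pu.quotient_carrierE)
    let ?d = "b + h *\<^sub>R ((a o\<^sub>L b) - (b o\<^sub>L a))"
    let ?s = "1 + 2 * (norm a)\<^sup>2 * h\<^sup>2"
    have "C \<oplus>\<^bsub>?Q\<^esub> h \<odot>\<^bsub>?Q\<^esub> (A \<otimes>\<^bsub>?Q\<^esub> C) = ?I +>\<^bsub>?U\<^esub> (b \<oplus>\<^bsub>?U\<^esub> h \<odot>\<^bsub>?U\<^esub> (a \<otimes>\<^bsub>?U\<^esub> b))"
      using a b by (simp add: pu.quotient_add pu.quotient_smult pu.quotient_mult pu.bracket_closed)
    then have eq: "C \<oplus>\<^bsub>?Q\<^esub> h \<odot>\<^bsub>?Q\<^esub> (A \<otimes>\<^bsub>?Q\<^esub> C) = ?I +>\<^bsub>?U\<^esub> ?d" by (simp add: skew_hermitian_simps)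
    have s: "0 < ?s" by (simp add: add_pos_nonneg)
    have "quotient_norm (?I +>\<^bsub>?U\<^esub> ?d) / ?s \<le> quotient_norm C"
      unfolding b(2)
    proof (rule quotient_norm_coset_ge)
      fix z assume z: "z \<in> ?I"
      then have "a o\<^sub>L z = z o\<^sub>L a"
        using a by (auto intro!: blinfun_eqI simp: imaginary_scalars_eq skew_hermitian_carrier_iff blinfun_simps)
      then have "z + ?d = (z + b) + h *\<^sub>R ((a o\<^sub>L (z + b)) - ((z + b) o\<^sub>L a))"
        by (simp add: bounded_bilinear.add_left[OF bounded_bilinear_blinfun_compose]
          bounded_bilinear.add_right[OF bounded_bilinear_blinfun_compose])
      with quotient_norm_coset_le[OF z, of ?d]
      have "quotient_norm (?I +>\<^bsub>?U\<^esub> ?d) \<le> ?s * norm (z + b)"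
        using norm_skew_hermitian_bracket_le[OF a(1), of "z + b" h] by simp
      then show "quotient_norm (?I +>\<^bsub>?U\<^esub> ?d) / ?s \<le> norm (z + b)"
        using s by (simp add: divide_le_eq mult.commute)
    qed
    then show "quotient_norm (C \<oplus>\<^bsub>projective_skew_hermitian_algebra\<^esub>
      h \<odot>\<^bsub>projective_skew_hermitian_algebra\<^esub> (A \<otimes>\<^bsub>projective_skew_hermitian_algebra\<^esub> C)) \<le> ?s * quotient_norm C"
      using s by (simp add: divide_le_eq mult.commute eq projective_skew_hermitian_algebra_def)
  qed
qed

text \<open>Separates the algebra from the bundle. \<Lambda> will be v \<mapsto> \<pi>(f v) for a
  fixed compactly supported f, which is linear but in general not a homomorphism. It is enough that
  ad y is carried to the bracket with some A, since \<open>quotient_norm_bracket_le\<close> then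
  supplies the infinitesimal invariance.\<close>

lemma (in lie_algebra) equivariant_map_vanishes:
  fixes \<Lambda> :: "'a \<Rightarrow> ('h::complex_hilbert_space \<Rightarrow>\<^sub>L 'h) set"
  defines "P \<equiv> projective_skew_hermitian_algebra :: (real, ('h \<Rightarrow>\<^sub>L 'h) set) module"
  assumes fin: "finite_dimensional L" and n: "minimal_cocompact_ideal \<nn> L"
    and cl: "\<And>x. x \<in> carrier L \<Longrightarrow> \<Lambda> x \<in> carrier P"
    and add: "\<And>x y. x \<in> carrier L \<Longrightarrow> y \<in> carrier L \<Longrightarrow> \<Lambda> (x \<oplus> y) = \<Lambda> x \<oplus>\<^bsub>P\<^esub> \<Lambda> y"
    and sm: "\<And>r x. x \<in> carrier L \<Longrightarrow> \<Lambda> (r \<odot> x) = r \<odot>\<^bsub>P\<^esub> \<Lambda> x"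
    and br: "\<And>y. y \<in> carrier L \<Longrightarrow> \<exists>A\<in>carrier P. \<forall>x\<in>carrier L. \<Lambda> (y \<otimes> x) = A \<otimes>\<^bsub>P\<^esub> \<Lambda> x"
    and v: "v \<in> \<nn>"
  shows "\<Lambda> v = \<zero>\<^bsub>P\<^esub>"
proof -
  have vn: "vector_norm P quotient_norm" unfolding P_def by (rule vector_norm_quotient_norm)
  have "quotient_norm (\<Lambda> v) = 0"
  proof (rule minimal_cocompact_ideal_seminorm[OF fin n _ _ v])
    show "seminorm (\<lambda>x. quotient_norm (\<Lambda> x))"
      using vn cl add sm unfolding seminorm_def vector_norm_def by simp
    fix y assume y: "y \<in> carrier L"
    obtain A where A: "A \<in> carrier P" "\<And>x. x \<in> carrier L \<Longrightarrow> \<Lambda> (y \<otimes> x) = A \<otimes>\<^bsub>P\<^esub> \<Lambda> x"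
      using br[OF y] by blast
    obtain M where "0 \<le> M" and M: "\<And>h C. C \<in> carrier P \<Longrightarrow>
        quotient_norm (C \<oplus>\<^bsub>P\<^esub> h \<odot>\<^bsub>P\<^esub> (A \<otimes>\<^bsub>P\<^esub> C)) \<le> (1 + M * h\<^sup>2) * quotient_norm C"
      using quotient_norm_bracket_le A(1) unfolding P_def by blast
    have "quotient_norm (\<Lambda> (x \<oplus> h \<odot> (y \<otimes> x))) \<le> (1 + M * h\<^sup>2) * quotient_norm (\<Lambda> x)"
      if x: "x \<in> carrier L" for h x
      using M[OF cl[OF x], of h] x y by (simp add: add sm A(2) bracket_closed)
    with \<open>0 \<le> M\<close> show "\<exists>C\<ge>0. \<forall>h. \<forall>v\<in>carrier L.
        quotient_norm (\<Lambda> (v \<oplus> h \<odot> (y \<otimes> v))) \<le> (1 + C * h\<^sup>2) * quotient_norm (\<Lambda> v)" by blast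
  qed
  moreover have "v \<in> carrier L"
    using n v submodule_subset[OF lie_ideal_submodule] by (auto simp: minimal_cocompact_ideal_def)
  ultimately show ?thesis using vn cl[of v] by (simp add: vector_norm_def)
qed

section \<open>Smooth functions up to the boundary\<close>

lemma eventually_at_within_openin:
  assumes "openin (top_of_set V) T" "x \<in> T"
  shows "\<forall>\<^sub>F y in at x within V. y \<in> T"
proof -
  obtain G where "open G" "T = V \<inter> G" using assms by (auto simp: openin_open)
  then show ?thesis using assms by (auto simp: eventually_at_topological)
qed

lemma has_derivative_cong_openin:
  assumes T: "openin (top_of_set V) T" "x \<in> T" and eq: "\<And>y. y \<in> T \<Longrightarrow> f y = g y"
  shows "(f has_derivative D) (at x within V) \<longleftrightarrow> (g has_derivative D) (at x within V)"
proof -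
  have x: "x \<in> V" using T openin_imp_subset by blast
  have ev: "\<forall>\<^sub>F y in at x within V. f y = g y"
    by (rule eventually_mono[OF eventually_at_within_openin[OF T] eq])
  then have ev': "\<forall>\<^sub>F y in at x within V. g y = f y" by (simp add: eq_commute)
  show ?thesis
    using has_derivative_transform_eventually[OF _ ev] has_derivative_transform_eventually[OF _ ev']
      eq[OF T(2)] x by auto
qed

lemma iterated_deriv_cong:
  assumes T: "openin (top_of_set V) T" and eq: "\<And>y. y \<in> T \<Longrightarrow> f y = g y" and "x \<in> T"
  shows "iterated_deriv V vs f x = iterated_deriv V vs g x"
  using assms(3)
proof (induction vs arbitrary: x)
  case (Cons v vs)
  then show ?case
    unfolding iterated_deriv.simps frechet_derivative_def
    by (subst has_derivative_cong_openin[OF T]) auto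
qed (use eq in simp)

lemma iterated_deriv_append: "iterated_deriv V (vs @ ws) f = iterated_deriv V vs (iterated_deriv V ws f)"
  by (induction vs) simp_all

text \<open>Restriction to the line x + t v, which stays in \<open>V\<close>, reduces this to
  uniqueness of the derivative in one real variable.\<close>

lemma has_derivative_subspace_unique:
  fixes f :: "'e::euclidean_space \<Rightarrow> 'f::real_normed_vector"
  assumes V: "subspace V" and x: "x \<in> V" and v: "v \<in> V"
    and D: "(f has_derivative D) (at x within V)" "(f has_derivative D') (at x within V)"
  shows "D v = D' v"
proof -
  let ?g = "\<lambda>t::real. x + t *\<^sub>R v"
  have sub: "range ?g \<subseteq> V" using V x v by (auto simp: subspace_add subspace_scale)
  have g: "(?g has_derivative (\<lambda>t. t *\<^sub>R v)) (at 0)" by (auto intro!: derivative_eq_intros)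
  have "((\<lambda>t. f (?g t)) has_derivative (\<lambda>t. E (t *\<^sub>R v))) (at 0)"
    if "(f has_derivative E) (at x within V)" for E
    using has_derivative_in_compose[OF g, of f E] has_derivative_subset[OF that sub] by simp
  from has_derivative_unique[OF this[OF D(1)] this[OF D(2)]]
  have "D (1 *\<^sub>R v) = D' (1 *\<^sub>R v)" by metis
  then show ?thesis by simp
qed

section \<open>Smoothness by coinduction\<close>

abbreviation interior_in :: "'e::topological_space set \<Rightarrow> 'e set \<Rightarrow> 'e set" where
  "interior_in V S \<equiv> top_of_set V interior_of S"

text \<open>Agreement with \<open>g\<close> is asked on the interior only: being continuous on
  \<open>S\<close>, the function \<open>g\<close> then serves as the extension of the directional
  derivative to the boundary.\<close>

definition derivation_closed ::
  "'e::euclidean_space set \<Rightarrow> 'e set \<Rightarrow> ('e \<Rightarrow> 'f::real_normed_vector) set \<Rightarrow> bool" where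
  "derivation_closed V S F \<longleftrightarrow> (\<forall>f\<in>F. continuous_on S f \<and>
     (\<exists>D. (\<forall>x\<in>interior_in V S. (f has_derivative D x) (at x within V)) \<and>
        (\<forall>v\<in>V. \<exists>g\<in>F. \<forall>x\<in>interior_in V S. g x = D x v)))"

text \<open>
  Smoothness is the largest \<^const>\<open>derivation_closed\<close> class, which makes coinduction available;
  closure properties of smooth functions follow without formulas for higher derivatives.
\<close>

lemma smooth_upto_boundary_coinduct:
  assumes V: "subspace V" and F: "derivation_closed V S F" and f: "f \<in> F"
  shows "smooth_upto_boundary V S f"
proof -
  have IV: "x \<in> V" if "x \<in> interior_in V S" for x
    using that interior_of_subset_topspace[of "top_of_set V" S] by auto
  have step: "\<exists>g\<in>F. \<forall>x\<in>interior_in V S. iterated_deriv V vs f x = g x" if "vs \<in> lists V" for vs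
    using that
  proof (induction vs)
    case (Cons v vs)
    then obtain g where g: "g \<in> F" "\<And>x. x \<in> interior_in V S \<Longrightarrow> iterated_deriv V vs f x = g x"
      by auto
    obtain D g' where D: "\<And>x. x \<in> interior_in V S \<Longrightarrow> (g has_derivative D x) (at x within V)"
      and g': "g' \<in> F" "\<And>x. x \<in> interior_in V S \<Longrightarrow> g' x = D x v"
      using F g(1) Cons.hyps unfolding derivation_closed_def by blast
    have "iterated_deriv V (v # vs) f x = g' x" if x: "x \<in> interior_in V S" for x
    proof -
      have d: "(iterated_deriv V vs f has_derivative D x) (at x within V)"
        using has_derivative_cong_openin[OF openin_interior_of x, of "iterated_deriv V vs f" g "D x"]
          g(2) D[OF x] by blast
      then have "(iterated_deriv V vs f has_derivative
          frechet_derivative (iterated_deriv V vs f) (at x within V)) (at x within V)"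
        unfolding frechet_derivative_works[symmetric] by (rule differentiableI)
      from has_derivative_subspace_unique[OF V IV[OF x] Cons.hyps(1) this d]
      show ?thesis using g'(2)[OF x] by simp
    qed
    then show ?case using g'(1) by blast
  qed (use f in auto)
  show ?thesis
    unfolding smooth_upto_boundary_def
  proof (intro conjI ballI)
    show "continuous_on S f" using F f by (auto simp: derivation_closed_def)
    fix vs assume vs: "vs \<in> lists V"
    obtain g where g: "g \<in> F" "\<And>x. x \<in> interior_in V S \<Longrightarrow> iterated_deriv V vs f x = g x"
      using step[OF vs] by auto
    then show "\<exists>g. continuous_on S g \<and> (\<forall>x\<in>interior_in V S. g x = iterated_deriv V vs f x)"
      using F by (intro exI[of _ g]) (auto simp: derivation_closed_def)
    fix x assume x: "x \<in> interior_in V S"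
    obtain D where "\<And>x. x \<in> interior_in V S \<Longrightarrow> (g has_derivative D x) (at x within V)"
      using F g(1) unfolding derivation_closed_def by blast
    then have "(iterated_deriv V vs f has_derivative D x) (at x within V)"
      using has_derivative_cong_openin[OF openin_interior_of x, of "iterated_deriv V vs f" g "D x"]
        g(2) x by blast
    then show "iterated_deriv V vs f differentiable (at x within V)" by (rule differentiableI)
  qed
qed

text \<open>The continuous extension \<open>g\<close> of a directional derivative of
  \<open>f\<close> is itself smooth: on the interior its derivatives along \<open>vs\<close> are
  those of \<open>f\<close> along \<open>vs @ [v]\<close>, where the last entry of the list is
  applied first.\<close>

lemma derivation_closed_smooth: "derivation_closed V S {f. smooth_upto_boundary V S f}"
  unfolding derivation_closed_def mem_Collect_eq
proof (intro ballI allI impI conjI)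
  fix f :: "'a \<Rightarrow> 'b" assume "f \<in> {f. smooth_upto_boundary V S f}"
  then have f: "smooth_upto_boundary V S f" by simp
  then show "continuous_on S f" by (simp add: smooth_upto_boundary_def)
  let ?D = "\<lambda>x. frechet_derivative f (at x within V)"
  have "(f has_derivative ?D x) (at x within V)" if "x \<in> interior_in V S" for x
    using f that frechet_derivative_works
    unfolding smooth_upto_boundary_def by (metis iterated_deriv.simps(1) lists.Nil)
  moreover have "\<exists>g\<in>{f. smooth_upto_boundary V S f}. \<forall>x\<in>interior_in V S. g x = ?D x v" if v: "v \<in> V" for v
  proof -
    obtain g where g: "continuous_on S g"
      "\<And>x. x \<in> interior_in V S \<Longrightarrow> g x = iterated_deriv V [v] f x"
      using f v unfolding smooth_upto_boundary_def by (metis lists.Cons lists.Nil)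
    have eq: "iterated_deriv V vs g x = iterated_deriv V (vs @ [v]) f x" if "x \<in> interior_in V S" for vs x
      unfolding iterated_deriv_append by (rule iterated_deriv_cong[OF openin_interior_of g(2) that])
    have "smooth_upto_boundary V S g"
      unfolding smooth_upto_boundary_def
    proof (intro conjI ballI g(1))
      fix vs assume "vs \<in> lists V"
      then have vs: "vs @ [v] \<in> lists V" using v by auto
      show "\<exists>h. continuous_on S h \<and> (\<forall>x\<in>interior_in V S. h x = iterated_deriv V vs g x)"
        using f vs eq unfolding smooth_upto_boundary_def by metis
      fix x assume x: "x \<in> interior_in V S"
      have "iterated_deriv V (vs @ [v]) f differentiable (at x within V)"
        using f vs x unfolding smooth_upto_boundary_def by blast
      then show "iterated_deriv V vs g differentiable (at x within V)"
        unfolding differentiable_def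
        using has_derivative_cong_openin[OF openin_interior_of x,
            of "iterated_deriv V vs g" "iterated_deriv V (vs @ [v]) f"] eq[of _ vs] by blast
    qed
    then show ?thesis using g(2) by (intro bexI[of _ g]) auto
  qed
  ultimately show "\<exists>D. (\<forall>x\<in>interior_in V S. (f has_derivative D x) (at x within V)) \<and>
      (\<forall>v\<in>V. \<exists>g\<in>{f. smooth_upto_boundary V S f}. \<forall>x\<in>interior_in V S. g x = D x v)"
    by (intro exI[of _ ?D]) blast
qed

lemma smooth_upto_boundary_subset:
  assumes "smooth_upto_boundary V S f" "T \<subseteq> S"
  shows "smooth_upto_boundary V T f"
  using assms interior_of_mono[OF assms(2), of "top_of_set V"] unfolding smooth_upto_boundary_def
  by (meson continuous_on_subset subsetD)

lemma smooth_upto_boundary_cong: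
  assumes "\<And>x. x \<in> S \<Longrightarrow> f x = g x" "smooth_upto_boundary V S f"
  shows "smooth_upto_boundary V S g"
proof -
  have IS: "x \<in> S" if "x \<in> interior_in V S" for x
    using that interior_of_subset[of "top_of_set V" S] by blast
  have eq: "iterated_deriv V vs f x = iterated_deriv V vs g x" if "x \<in> interior_in V S" for x vs
    using that assms(1) IS by (intro iterated_deriv_cong[OF openin_interior_of]) auto
  show ?thesis
    unfolding smooth_upto_boundary_def
  proof (intro conjI ballI)
    show "continuous_on S g"
      using assms continuous_on_cong[of S S f g] by (simp add: smooth_upto_boundary_def)
    fix vs assume vs: "vs \<in> lists V"
    show "\<exists>h. continuous_on S h \<and> (\<forall>x\<in>interior_in V S. h x = iterated_deriv V vs g x)"
      using assms(2) vs eq unfolding smooth_upto_boundary_def by metis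
    fix x assume x: "x \<in> interior_in V S"
    have "iterated_deriv V vs f differentiable (at x within V)"
      using assms(2) vs x unfolding smooth_upto_boundary_def by blast
    then show "iterated_deriv V vs g differentiable (at x within V)"
      unfolding differentiable_def
      using has_derivative_cong_openin[OF openin_interior_of x,
          of "iterated_deriv V vs f" "iterated_deriv V vs g"] eq[of _ vs] by blast
  qed
qed

text \<open>Turns vector-valued chart transitions into real coordinate functions, to which sums and
  products apply.\<close>

lemma smooth_upto_boundary_inner:
  fixes G :: "'e::euclidean_space \<Rightarrow> 'f::euclidean_space"
  assumes V: "subspace V" and G: "smooth_upto_boundary V S G"
  shows "smooth_upto_boundary V S (\<lambda>x. G x \<bullet> b)"
proof (rule smooth_upto_boundary_coinduct[OF V])
  let ?F = "{\<lambda>x. G x \<bullet> b | G :: 'e \<Rightarrow> 'f. smooth_upto_boundary V S G}"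
  show "(\<lambda>x. G x \<bullet> b) \<in> ?F" using G by blast
  show "derivation_closed V S ?F"
    unfolding derivation_closed_def
  proof (intro ballI, elim CollectE exE conjE)
    fix f and G :: "'e \<Rightarrow> 'f" assume f: "f = (\<lambda>x. G x \<bullet> b)" and "smooth_upto_boundary V S G"
    then have "G \<in> {f. smooth_upto_boundary V S f}" by simp
    from derivation_closed_smooth[unfolded derivation_closed_def, rule_format, OF this]
    obtain D where G: "continuous_on S G"
      and D: "\<And>x. x \<in> interior_in V S \<Longrightarrow> (G has_derivative D x) (at x within V)"
      and d: "\<And>v. v \<in> V \<Longrightarrow> \<exists>g. smooth_upto_boundary V S g \<and> (\<forall>x\<in>interior_in V S. g x = D x v)"
      by auto
    show "continuous_on S f \<and>
      (\<exists>D. (\<forall>x\<in>interior_in V S. (f has_derivative D x) (at x within V)) \<and>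
        (\<forall>v\<in>V. \<exists>g\<in>?F. \<forall>x\<in>interior_in V S. g x = D x v))"
    proof (intro conjI exI[of _ "\<lambda>x h. D x h \<bullet> b"] ballI)
      show "continuous_on S f" unfolding f by (intro continuous_intros G)
      show "(f has_derivative (\<lambda>h. D x h \<bullet> b)) (at x within V)" if "x \<in> interior_in V S" for x
        unfolding f using D[OF that] by (rule has_derivative_inner_left)
      fix v assume "v \<in> V"
      then obtain g where "smooth_upto_boundary V S g" "\<forall>x\<in>interior_in V S. g x = D x v" using d by blast
      then show "\<exists>g\<in>?F. \<forall>x\<in>interior_in V S. g x = D x v \<bullet> b"
        by (intro bexI[of _ "\<lambda>x. g x \<bullet> b"]) auto
    qed
  qed
qed

text \<open>
  This family contains \<open>exp (- 1 / t)\<close>, extended by zero to \<open>t \<le> 0\<close>, and is closed under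
  derivatives.
\<close>

definition flat :: "real poly \<Rightarrow> real \<Rightarrow> real" where
  "flat p t = (if 0 < t then poly p (1 / t) * exp (- 1 / t) else 0)"

text \<open>After the substitution y = 1 / t this is the decay of a polynomial divided by exp
  y.\<close>

lemma flat_tendsto_zero: "(flat p \<longlongrightarrow> 0) (at_right 0)"
proof -
  have "((\<lambda>y. \<Sum>i\<le>degree p. coeff p i * (y ^ i / exp y)) \<longlongrightarrow> (\<Sum>i\<le>degree p. coeff p i * 0)) at_top"
    by (intro tendsto_intros tendsto_power_div_exp_0)
  then have "((\<lambda>y. poly p y * exp (- y)) \<longlongrightarrow> 0) at_top"
    by (simp add: poly_altdef sum_distrib_right exp_minus sum_divide_distrib field_simps)
  from filterlim_compose[OF this filterlim_inverse_at_top_right]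
  have lim: "((\<lambda>t. poly p (inverse t) * exp (- inverse t)) \<longlongrightarrow> 0) (at_right 0)" .
  have ev: "\<forall>\<^sub>F t in at_right 0. flat p t = poly p (inverse t) * exp (- inverse t)"
    by (rule eventually_at_rightI[of 0 1]) (auto simp: flat_def inverse_eq_divide)
  show ?thesis using lim by (subst tendsto_cong[OF ev])
qed

text \<open>Differentiating p(1 / t) exp (- 1 / t) produces the factor 1 / t^2 and the polynomial p
  - p', so the family reproduces itself.\<close>

lemma flat_has_derivative:
  "(flat p has_real_derivative flat ([:0, 0, 1:] * (p - pderiv p)) t) (at t)"
proof -
  consider "t > 0" | "t < 0" | "t = 0" by linarith
  then show ?thesis
  proof cases
    case 1
    have "((\<lambda>t. poly p (1 / t) * exp (- 1 / t)) has_real_derivative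
        flat ([:0, 0, 1:] * (p - pderiv p)) t) (at t)"
      using 1 by (auto intro!: derivative_eq_intros DERIV_chain'[OF _ poly_DERIV]
          simp: flat_def field_simps power2_eq_square)
    then show ?thesis
      by (rule has_field_derivative_transform_within_open[where S = "{0<..}"])
        (use 1 in \<open>auto simp: flat_def\<close>)
  next
    case 2
    have "((\<lambda>t. 0) has_real_derivative flat ([:0, 0, 1:] * (p - pderiv p)) t) (at t)"
      using 2 by (simp add: flat_def)
    then show ?thesis
      by (rule has_field_derivative_transform_within_open[where S = "{..<0}"])
        (use 2 in \<open>auto simp: flat_def\<close>)
  next
    case 3
    have "((\<lambda>h. (flat p (0 + h) - flat p 0) / h) \<longlongrightarrow> 0) (at 0)"
    \<comment> \<open>From the left the difference quotient is 0. From the right, division by h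
      multiplies the polynomial in 1 / h by its variable, so the quotient is again a member of the
      family and tends to 0.\<close>
    proof (rule filterlim_split_at)
      have "\<forall>\<^sub>F h in at_left 0. (flat p (0 + h) - flat p 0) / h = (0::real)"
        by (rule eventually_at_leftI[of "-1"]) (auto simp: flat_def)
      then show "((\<lambda>h. (flat p (0 + h) - flat p 0) / h) \<longlongrightarrow> 0) (at_left 0)"
        by (rule tendsto_eventually)
      have "\<forall>\<^sub>F h in at_right 0. (flat p (0 + h) - flat p 0) / h = flat ([:0, 1:] * p) h"
        by (rule eventually_at_rightI[of 0 1]) (auto simp: flat_def)
      then show "((\<lambda>h. (flat p (0 + h) - flat p 0) / h) \<longlongrightarrow> 0) (at_right 0)"
        using flat_tendsto_zero[of "[:0, 1:] * p"] by (subst tendsto_cong)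
    qed
    then show ?thesis using 3 by (simp add: DERIV_def flat_def)
  qed
qed

text \<open>Derivatives of products, reciprocals and compositions mix the given functions with their
  derivatives. Coinduction therefore needs one class that is closed under all these operations at
  once; the polynomial in the last rule is arbitrary because differentiation changes it.\<close>

inductive_set smooth_closure :: "'e::euclidean_space set \<Rightarrow> 'e set \<Rightarrow> ('e \<Rightarrow> real) set"
  for V S :: "'e set" where
  base: "smooth_upto_boundary V S f \<Longrightarrow> f \<in> smooth_closure V S"
| const: "(\<lambda>x. c) \<in> smooth_closure V S"
| add: "f \<in> smooth_closure V S \<Longrightarrow> g \<in> smooth_closure V S \<Longrightarrow> (\<lambda>x. f x + g x) \<in> smooth_closure V S"
| mult: "f \<in> smooth_closure V S \<Longrightarrow> g \<in> smooth_closure V S \<Longrightarrow> (\<lambda>x. f x * g x) \<in> smooth_closure V S"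
| inverse: "f \<in> smooth_closure V S \<Longrightarrow> (\<And>x. x \<in> S \<Longrightarrow> f x \<noteq> 0) \<Longrightarrow>
    (\<lambda>x. inverse (f x)) \<in> smooth_closure V S"
| flat: "f \<in> smooth_closure V S \<Longrightarrow> (\<lambda>x. flat p (f x)) \<in> smooth_closure V S"

lemma derivation_closed_smooth_closure: "derivation_closed V S (smooth_closure V S)"
proof -
  let ?A = "smooth_closure V S" and ?I = "interior_in V S"
  have "continuous_on S f \<and> (\<exists>D. (\<forall>x\<in>?I. (f has_derivative D x) (at x within V)) \<and>
      (\<forall>v\<in>V. \<exists>g\<in>?A. \<forall>x\<in>?I. g x = D x v))" if "f \<in> ?A" for f
    using that
  proof induction
    case (base f)
    then have "f \<in> {f. smooth_upto_boundary V S f}" by simp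
    from derivation_closed_smooth[unfolded derivation_closed_def, rule_format, OF this]
    show ?case using smooth_closure.base by blast
  next
    case (const c)
    show ?case
      by (intro conjI exI[of _ "\<lambda>x h. 0"] ballI bexI[OF _ smooth_closure.const[of 0]]) auto
  next
    case (add f g)
    obtain D where D: "\<forall>x\<in>?I. (f has_derivative D x) (at x within V)"
        "\<forall>v\<in>V. \<exists>g\<in>?A. \<forall>x\<in>?I. g x = D x v"
      using add.IH(1) by blast
    obtain E where E: "\<forall>x\<in>?I. (g has_derivative E x) (at x within V)"
        "\<forall>v\<in>V. \<exists>g\<in>?A. \<forall>x\<in>?I. g x = E x v"
      using add.IH(2) by blast
    show ?case
    proof (intro conjI exI[of _ "\<lambda>x h. D x h + E x h"] ballI)
      show "continuous_on S (\<lambda>x. f x + g x)" using add by (intro continuous_intros) auto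
      show "((\<lambda>x. f x + g x) has_derivative (\<lambda>h. D x h + E x h)) (at x within V)" if "x \<in> ?I" for x
        using D(1) E(1) that by (intro has_derivative_add) auto
      fix v assume "v \<in> V"
      then obtain d e where "d \<in> ?A" "\<forall>x\<in>?I. d x = D x v" "e \<in> ?A" "\<forall>x\<in>?I. e x = E x v"
        using D(2) E(2) by blast
      then show "\<exists>g\<in>?A. \<forall>x\<in>?I. g x = D x v + E x v"
        by (intro bexI[OF _ smooth_closure.add[of d _ _ e]]) auto
    qed
  next
    case (mult f g)
    obtain D where D: "\<forall>x\<in>?I. (f has_derivative D x) (at x within V)"
        "\<forall>v\<in>V. \<exists>g\<in>?A. \<forall>x\<in>?I. g x = D x v"
      using mult.IH(1) by blast
    obtain E where E: "\<forall>x\<in>?I. (g has_derivative E x) (at x within V)"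
        "\<forall>v\<in>V. \<exists>g\<in>?A. \<forall>x\<in>?I. g x = E x v"
      using mult.IH(2) by blast
    show ?case
    proof (intro conjI exI[of _ "\<lambda>x h. f x * E x h + D x h * g x"] ballI)
      show "continuous_on S (\<lambda>x. f x * g x)" using mult by (intro continuous_intros) auto
      show "((\<lambda>x. f x * g x) has_derivative (\<lambda>h. f x * E x h + D x h * g x)) (at x within V)"
        if "x \<in> ?I" for x
        using D(1) E(1) that by (intro has_derivative_mult) auto
      fix v assume "v \<in> V"
      then obtain d e where "d \<in> ?A" "\<forall>x\<in>?I. d x = D x v" "e \<in> ?A" "\<forall>x\<in>?I. e x = E x v"
        using D(2) E(2) by blast
      then show "\<exists>g'\<in>?A. \<forall>x\<in>?I. g' x = f x * E x v + D x v * g x"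
        using mult.hyps
        by (intro bexI[OF _ smooth_closure.add[OF smooth_closure.mult[of f _ _ e] smooth_closure.mult[of d _ _ g]]]) auto
    qed
  next
    case (inverse f)
    obtain D where D: "\<forall>x\<in>?I. (f has_derivative D x) (at x within V)"
        "\<forall>v\<in>V. \<exists>g\<in>?A. \<forall>x\<in>?I. g x = D x v"
      using inverse.IH by blast
    have nz: "f x \<noteq> 0" if "x \<in> ?I" for x
      using that inverse.hyps interior_of_subset[of "top_of_set V" S] by blast
    show ?case
    proof (intro conjI exI[of _ "\<lambda>x h. - (inverse (f x) * D x h * inverse (f x))"] ballI)
      show "continuous_on S (\<lambda>x. inverse (f x))" using inverse by (intro continuous_intros) auto
      show "((\<lambda>x. inverse (f x)) has_derivative (\<lambda>h. - (inverse (f x) * D x h * inverse (f x)))) (at x within V)"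
        if "x \<in> ?I" for x
        using D(1) nz that by (intro Deriv.has_derivative_inverse) auto
      fix v assume "v \<in> V"
      then obtain d where d: "d \<in> ?A" "\<forall>x\<in>?I. d x = D x v" using D(2) by blast
      have i: "(\<lambda>x. inverse (f x)) \<in> ?A" using inverse.hyps by (intro smooth_closure.inverse) auto
      show "\<exists>g\<in>?A. \<forall>x\<in>?I. g x = - (inverse (f x) * D x v * inverse (f x))"
        using d by (intro bexI[OF _ smooth_closure.mult[OF smooth_closure.const[of "-1"]
          smooth_closure.mult[OF smooth_closure.mult[OF i d(1)] i]]]) auto
    qed
  next
    case (flat f p)
    obtain D where D: "\<forall>x\<in>?I. (f has_derivative D x) (at x within V)"
        "\<forall>v\<in>V. \<exists>g\<in>?A. \<forall>x\<in>?I. g x = D x v"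
      using flat.IH by blast
    let ?p = "[:0, 0, 1:] * (p - pderiv p)"
    show ?case
    proof (intro conjI exI[of _ "\<lambda>x h. D x h * flat ?p (f x)"] ballI)
      have "continuous_on UNIV (flat p)"
        using flat_has_derivative DERIV_isCont continuous_at_imp_continuous_on by blast
      then show "continuous_on S (\<lambda>x. flat p (f x))"
        using flat by (intro continuous_on_compose2[of UNIV "flat p" S f]) auto
      show "((\<lambda>x. flat p (f x)) has_derivative (\<lambda>h. D x h * flat ?p (f x))) (at x within V)"
        if "x \<in> ?I" for x
        using D(1) that by (intro DERIV_compose_FDERIV[OF flat_has_derivative]) auto
      fix v assume "v \<in> V"
      then obtain d where d: "d \<in> ?A" "\<forall>x\<in>?I. d x = D x v" using D(2) by blast
      then show "\<exists>g\<in>?A. \<forall>x\<in>?I. g x = D x v * flat ?p (f x)"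
        using flat.hyps
        by (intro bexI[OF _ smooth_closure.mult[OF d(1) smooth_closure.flat[of f _ _ ?p]]]) auto
    qed
  qed
  then show ?thesis unfolding derivation_closed_def by blast
qed

text \<open>By coinduction the closure adds nothing, which yields all closure properties of real
  smooth functions in one stroke.\<close>

lemma smooth_closure_iff:
  assumes "subspace V"
  shows "f \<in> smooth_closure V S \<longleftrightarrow> smooth_upto_boundary V S f"
  using smooth_upto_boundary_coinduct[OF assms derivation_closed_smooth_closure] smooth_closure.base
  by blast

section \<open>Manifolds with boundary\<close>

text \<open>From a boundary point one moves inward along the conormal: y + t n lies in the interior
  for small t > 0 and tends to \<open>y\<close>. For n = 0 the half-space is all of \<open>V\<close>
  and \<open>T\<close> is its own interior.\<close>

lemma half_space_interior_agree:
  fixes g g' :: "'e::euclidean_space \<Rightarrow> 'f::t2_space"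
  assumes V: "subspace V" "n \<in> V" and T: "openin (top_of_set {v \<in> V. 0 \<le> n \<bullet> v}) T" and y: "y \<in> T"
    and g: "continuous_on T g" "continuous_on T g'" and eq: "\<And>x. x \<in> interior_in V T \<Longrightarrow> g x = g' x"
  shows "g y = g' y"
proof -
  obtain G where G: "open G" "T = {v \<in> V. 0 \<le> n \<bullet> v} \<inter> G" using T by (auto simp: openin_open)
  show ?thesis
  proof (cases "n = 0")
    case True
    then have "openin (top_of_set V) T" using G by (auto simp: openin_open)
    then have "interior_in V T = T" by (simp add: interior_of_openin)
    then show ?thesis using eq y by simp
  next
    case False
    have "openin (top_of_set V) {v \<in> V. v \<in> G \<and> 0 < n \<bullet> v}"
      unfolding openin_open using G(1)
      by (intro exI[of _ "G \<inter> {v. 0 < n \<bullet> v}"] conjI open_Int open_halfspace_gt) auto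
    moreover have "{v \<in> V. v \<in> G \<and> 0 < n \<bullet> v} \<subseteq> T" using G by auto
    ultimately have int: "{v \<in> V. v \<in> G \<and> 0 < n \<bullet> v} \<subseteq> interior_in V T"
      by (rule interior_of_maximal[rotated])
    have yG: "y \<in> G" "y \<in> V" "0 \<le> n \<bullet> y" using y G by auto
    have lim: "((\<lambda>t. y + t *\<^sub>R n) \<longlongrightarrow> y + 0 *\<^sub>R n) (at_right 0)" by (intro tendsto_intros)
    then have "\<forall>\<^sub>F t in at_right 0. y + t *\<^sub>R n \<in> G"
      using topological_tendstoD[OF lim G(1)] yG by simp
    then have ev: "\<forall>\<^sub>F t in at_right 0. y + t *\<^sub>R n \<in> interior_in V T"
      using eventually_at_right_less[of 0]
    proof eventually_elim
      case (elim t)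
      have "0 < n \<bullet> (y + t *\<^sub>R n)"
        using elim yG False by (simp add: inner_add_right add_nonneg_pos)
      then show ?case
        using elim yG V int by (auto simp: subspace_add subspace_scale)
    qed
    have IT: "interior_in V T \<subseteq> T" by (rule interior_of_subset)
    have evT: "\<forall>\<^sub>F t in at_right 0. y + t *\<^sub>R n \<in> T"
      by (rule eventually_mono[OF ev]) (use IT in auto)
    have "((\<lambda>t. g (y + t *\<^sub>R n)) \<longlongrightarrow> g y) (at_right 0)" "((\<lambda>t. g' (y + t *\<^sub>R n)) \<longlongrightarrow> g' y) (at_right 0)"
      using lim y evT by (auto intro!: continuous_on_tendsto_compose[OF g(1)] continuous_on_tendsto_compose[OF g(2)])
    moreover have "\<forall>\<^sub>F t in at_right 0. g (y + t *\<^sub>R n) = g' (y + t *\<^sub>R n)"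
      by (rule eventually_mono[OF ev eq])
    ultimately have "((\<lambda>t. g' (y + t *\<^sub>R n)) \<longlongrightarrow> g y) (at_right 0)" by (simp add: tendsto_cong)
    then show ?thesis
      using \<open>((\<lambda>t. g' (y + t *\<^sub>R n)) \<longlongrightarrow> g' y) (at_right 0)\<close> by (rule tendsto_unique[rotated]) simp
  qed
qed

lemma continuous_on_locally:
  assumes "\<And>x. x \<in> S \<Longrightarrow> \<exists>T. x \<in> T \<and> openin (top_of_set S) T \<and> continuous_on T f"
  shows "continuous_on S f"
  unfolding continuous_on_def
proof
  fix x assume x: "x \<in> S"
  then obtain T where T: "x \<in> T" "openin (top_of_set S) T" "continuous_on T f" using assms by blast
  then obtain G where G: "open G" "T = S \<inter> G" by (auto simp: openin_open)
  have "at x within T = at x within S"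
    using G T(1) by (intro at_within_nhd[of x G]) auto
  then show "(f \<longlongrightarrow> f x) (at x within S)" using T by (auto simp: continuous_on_def)
qed

text \<open>
  The interior of a half-space is dense in it, hence local extensions of a derivative to the
  boundary agree on overlaps.
\<close>

lemma smooth_upto_boundary_locally:
  fixes f :: "'e::euclidean_space \<Rightarrow> 'f::real_normed_vector"
  assumes V: "subspace V" "n \<in> V" and S: "openin (top_of_set {v \<in> V. 0 \<le> n \<bullet> v}) S"
    and loc: "\<And>x. x \<in> S \<Longrightarrow> \<exists>T. x \<in> T \<and> openin (top_of_set S) T \<and> smooth_upto_boundary V T f"
  shows "smooth_upto_boundary V S f"
proof -
  obtain T where T: "\<And>x. x \<in> S \<Longrightarrow> x \<in> T x" "\<And>x. x \<in> S \<Longrightarrow> openin (top_of_set S) (T x)"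
    "\<And>x. x \<in> S \<Longrightarrow> smooth_upto_boundary V (T x) f"
    using loc by metis
  have int: "x \<in> interior_in V (T z)" if x: "x \<in> interior_in V S" "z \<in> S" "x \<in> T z" for x z
  proof -
    obtain G where G: "open G" "T z = S \<inter> G" using T(2)[OF x(2)] by (auto simp: openin_open)
    have "openin (top_of_set V) (interior_in V S \<inter> G)"
      using G(1) openin_interior_of[of "top_of_set V" S]
      by (metis (no_types, lifting) Int_assoc open_Int openin_open)
    moreover have "interior_in V S \<inter> G \<subseteq> T z" using interior_of_subset[of "top_of_set V" S] G by blast
    ultimately have "interior_in V S \<inter> G \<subseteq> interior_in V (T z)" by (rule interior_of_maximal[rotated])
    then show ?thesis using x G by auto
  qed
  have intS: "x \<in> S" if "x \<in> interior_in V S" for x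
    using that interior_of_subset[of "top_of_set V" S] by blast
  show ?thesis
    unfolding smooth_upto_boundary_def
  proof (intro conjI ballI)
    show "continuous_on S f"
      by (rule continuous_on_locally) (use T in \<open>auto simp: smooth_upto_boundary_def\<close>)
    fix vs assume vs: "vs \<in> lists V"
    show "iterated_deriv V vs f differentiable (at x within V)" if x: "x \<in> interior_in V S" for x
      using T(3)[OF intS[OF x]] int[OF x intS[OF x] T(1)[OF intS[OF x]]] vs
      by (simp add: smooth_upto_boundary_def)
    have "\<exists>g. continuous_on (T z) g \<and> (\<forall>x\<in>interior_in V (T z). g x = iterated_deriv V vs f x)"
      if "z \<in> S" for z
      using T(3)[OF that] vs by (simp add: smooth_upto_boundary_def)
    then obtain h where h: "\<And>z. z \<in> S \<Longrightarrow> continuous_on (T z) (h z)"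
      "\<And>z x. z \<in> S \<Longrightarrow> x \<in> interior_in V (T z) \<Longrightarrow> h z x = iterated_deriv V vs f x"
      by metis
    have agree: "h x x = h z x" if x: "x \<in> S" "z \<in> S" "x \<in> T z" for x z
    proof (rule half_space_interior_agree[OF V, where g = "h x" and g' = "h z" and T = "T x \<inter> T z"])
      let ?T = "T x \<inter> T z"
      show "openin (top_of_set {v \<in> V. 0 \<le> n \<bullet> v}) ?T"
        using T(2)[OF x(1)] T(2)[OF x(2)] S by (meson openin_Int openin_trans)
      show "x \<in> ?T" using T(1) x by auto
      show "continuous_on ?T (h x)" "continuous_on ?T (h z)"
        using continuous_on_subset[OF h(1)[OF x(1)]] continuous_on_subset[OF h(1)[OF x(2)]] by blast+
      fix w assume "w \<in> interior_in V ?T"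
      moreover have "interior_in V ?T \<subseteq> interior_in V (T x)" "interior_in V ?T \<subseteq> interior_in V (T z)"
        by (rule interior_of_mono, blast)+
      ultimately have "w \<in> interior_in V (T x)" "w \<in> interior_in V (T z)" by blast+
      then show "h x w = h z w" using h(2) x by simp
    qed
    show "\<exists>g. continuous_on S g \<and> (\<forall>x\<in>interior_in V S. g x = iterated_deriv V vs f x)"
    \<comment> \<open>Each point takes its value from the extension chosen for its own
      neighbourhood. By \<open>agree\<close>, this coincides with the single function
      \<open>h z\<close> on all of \<open>T z\<close>, hence is continuous there.\<close>
    proof (intro exI[of _ "\<lambda>x. h x x"] conjI ballI)
      show "continuous_on S (\<lambda>x. h x x)"
      proof (rule continuous_on_locally)
        fix z assume z: "z \<in> S"
        have "T z \<subseteq> S" using T(2)[OF z] openin_imp_subset by blast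
        then have "continuous_on (T z) (\<lambda>x. h x x) \<longleftrightarrow> continuous_on (T z) (h z)"
          using agree z by (intro continuous_on_cong) auto
        then show "\<exists>U. z \<in> U \<and> openin (top_of_set S) U \<and> continuous_on U (\<lambda>x. h x x)"
          using T z h(1) by blast
      qed
      fix x assume x: "x \<in> interior_in V S"
      show "h x x = iterated_deriv V vs f x"
        using int[OF x intS[OF x] T(1)[OF intS[OF x]]] h(2) intS[OF x] by simp
    qed
  qed
qed

text \<open>The usual cutoff built from exp (- 1 / t), which is \<open>flat 1\<close>. For a < b the
  two terms of the denominator never vanish together, and the value drops from 1 at a to 0 at
  b.\<close>

definition smooth_step :: "real \<Rightarrow> real \<Rightarrow> real \<Rightarrow> real" where
  "smooth_step a b t = flat 1 (b - t) * inverse (flat 1 (b - t) + flat 1 (t - a))"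

lemma flat_1: "0 \<le> flat 1 t" "0 < flat 1 t \<longleftrightarrow> 0 < t" "t \<le> 0 \<Longrightarrow> flat 1 t = 0"
  by (auto simp: flat_def)

lemma smooth_step_eq_1: "a < b \<Longrightarrow> t \<le> a \<Longrightarrow> smooth_step a b t = 1"
proof -
  assume "a < b" "t \<le> a"
  then have "0 < flat 1 (b - t)" "flat 1 (t - a) = 0" by (simp_all add: flat_1)
  then show ?thesis by (simp add: smooth_step_def)
qed

lemma smooth_step_eq_0: "b \<le> t \<Longrightarrow> smooth_step a b t = 0"
  by (simp add: smooth_step_def flat_1)

section \<open>Charts, smooth functions and bump functions\<close>

locale manifold_with_boundary =
  fixes X :: "('m, 'e::euclidean_space) manifold"
  assumes smooth_manifold: "smooth_manifold X"
begin

lemma Hausdorff: "Hausdorff_space (points X)"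
  and subspace_model: "subspace (model X)"
  and conormal_model: "conormal X \<in> model X"
  and atlas_cover: "(\<Union>(U, \<phi>)\<in>atlas X. U) = topspace (points X)"
  using smooth_manifold by (auto simp: smooth_manifold_def)

lemma chart:
  assumes "(U, \<phi>) \<in> atlas X"
  shows chart_openin: "openin (points X) U"
    and chart_image_openin: "openin (top_of_set (model_half_space X)) (\<phi> ` U)"
    and chart_homeomorphic: "homeomorphic_map (subtopology (points X) U) (top_of_set (\<phi> ` U)) \<phi>"
  using smooth_manifold assms by (auto simp: smooth_manifold_def)

lemma chart_transition:
  "(U, \<phi>) \<in> atlas X \<Longrightarrow> (U', \<phi>') \<in> atlas X \<Longrightarrow>
    smooth_upto_boundary (model X) (\<phi> ` (U \<inter> U')) (\<phi>' \<circ> inv_into U \<phi>)"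
  using smooth_manifold by (fastforce simp: smooth_manifold_def)

lemma chart_subset: "(U, \<phi>) \<in> atlas X \<Longrightarrow> U \<subseteq> topspace (points X)"
  using chart_openin openin_subset by blast

lemma chart_inj: assumes "(U, \<phi>) \<in> atlas X" shows "inj_on \<phi> U"
  using homeomorphic_imp_injective_map[OF chart_homeomorphic[OF assms]] chart_subset[OF assms]
  by (simp add: Int_absorb1)

lemma chart_inv: "(U, \<phi>) \<in> atlas X \<Longrightarrow> x \<in> U \<Longrightarrow> inv_into U \<phi> (\<phi> x) = x"
  using chart_inj by simp

lemma chart_image_open:
  assumes c: "(U, \<phi>) \<in> atlas X" and W: "openin (points X) W"
  shows "openin (top_of_set (model_half_space X)) (\<phi> ` (U \<inter> W))"
proof -
  have "openin (subtopology (points X) U) (U \<inter> W)" using W by (simp add: openin_subtopology_Int2)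
  then have "openin (top_of_set (\<phi> ` U)) (\<phi> ` (U \<inter> W))"
    using homeomorphic_imp_open_map[OF chart_homeomorphic[OF c]] by (simp add: open_map_def)
  then show ?thesis using chart_image_openin[OF c] openin_trans by blast
qed

lemma smooth_functionI:
  "(\<And>U \<phi>. (U, \<phi>) \<in> atlas X \<Longrightarrow> smooth_upto_boundary (model X) (\<phi> ` (U \<inter> W)) (f \<circ> inv_into U \<phi>)) \<Longrightarrow>
    smooth_function X W f"
  by (auto simp: smooth_function_def)

lemma smooth_functionD:
  "smooth_function X W f \<Longrightarrow> (U, \<phi>) \<in> atlas X \<Longrightarrow>
    smooth_upto_boundary (model X) (\<phi> ` (U \<inter> W)) (f \<circ> inv_into U \<phi>)"
  by (auto simp: smooth_function_def)

lemma smooth_functionI_closure: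
  assumes "\<And>U \<phi>. (U, \<phi>) \<in> atlas X \<Longrightarrow>
    (\<lambda>x. f (inv_into U \<phi> x)) \<in> smooth_closure (model X) (\<phi> ` (U \<inter> W))"
  shows "smooth_function X W f"
  using assms unfolding smooth_closure_iff[OF subspace_model] by (intro smooth_functionI) (simp add: comp_def)

lemma smooth_functionD_closure:
  assumes "smooth_function X W f" "(U, \<phi>) \<in> atlas X"
  shows "(\<lambda>x. f (inv_into U \<phi> x)) \<in> smooth_closure (model X) (\<phi> ` (U \<inter> W))"
  using smooth_functionD[OF assms] unfolding smooth_closure_iff[OF subspace_model] by (simp add: comp_def)

lemma smooth_function_subset:
  assumes "smooth_function X W f" "W' \<subseteq> W"
  shows "smooth_function X W' f"
proof (rule smooth_functionI)
  fix U \<phi> assume "(U, \<phi>) \<in> atlas X"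
  from smooth_functionD[OF assms(1) this]
  show "smooth_upto_boundary (model X) (\<phi> ` (U \<inter> W')) (f \<circ> inv_into U \<phi>)"
    by (rule smooth_upto_boundary_subset) (use assms(2) in blast)
qed

lemma smooth_function_cong:
  assumes "smooth_function X W f" "\<And>x. x \<in> W \<Longrightarrow> f x = g x"
  shows "smooth_function X W g"
proof (rule smooth_functionI)
  fix U \<phi> assume c: "(U, \<phi>) \<in> atlas X"
  show "smooth_upto_boundary (model X) (\<phi> ` (U \<inter> W)) (g \<circ> inv_into U \<phi>)"
    by (rule smooth_upto_boundary_cong[OF _ smooth_functionD[OF assms(1) c]])
      (use assms(2) chart_inv[OF c] in auto)
qed

lemma smooth_function_const: "smooth_function X W (\<lambda>x. c)"
  by (intro smooth_functionI_closure smooth_closure.const)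

lemma smooth_function_add:
  assumes "smooth_function X W f" "smooth_function X W g"
  shows "smooth_function X W (\<lambda>x. f x + g x)"
  by (intro smooth_functionI_closure smooth_closure.add assms[THEN smooth_functionD_closure])

lemma smooth_function_mult:
  assumes "smooth_function X W f" "smooth_function X W g"
  shows "smooth_function X W (\<lambda>x. f x * g x)"
  by (intro smooth_functionI_closure smooth_closure.mult assms[THEN smooth_functionD_closure])

lemma smooth_function_sum:
  "(\<And>i. i \<in> I \<Longrightarrow> smooth_function X W (f i)) \<Longrightarrow> smooth_function X W (\<lambda>x. \<Sum>i\<in>I. f i x)"
  by (induction I rule: infinite_finite_induct) (simp_all add: smooth_function_const smooth_function_add)

lemma smooth_function_inverse:
  assumes "smooth_function X W f" "\<And>x. x \<in> W \<Longrightarrow> f x \<noteq> 0"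
  shows "smooth_function X W (\<lambda>x. inverse (f x))"
  using assms(2) by (intro smooth_functionI_closure smooth_closure.inverse
    smooth_functionD_closure[OF assms(1)]) (auto simp: chart_inv)

lemma smooth_function_flat:
  assumes "smooth_function X W f"
  shows "smooth_function X W (\<lambda>x. flat p (f x))"
  by (intro smooth_functionI_closure smooth_closure.flat assms[THEN smooth_functionD_closure])

lemma smooth_function_locally:
  assumes W: "openin (points X) W"
    and loc: "\<And>x. x \<in> W \<Longrightarrow> \<exists>W'. x \<in> W' \<and> openin (points X) W' \<and> smooth_function X W' f"
  shows "smooth_function X W f"
proof (rule smooth_functionI)
  fix U \<phi> assume c: "(U, \<phi>) \<in> atlas X"
  show "smooth_upto_boundary (model X) (\<phi> ` (U \<inter> W)) (f \<circ> inv_into U \<phi>)"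
  proof (rule smooth_upto_boundary_locally[OF subspace_model conormal_model])
    show "openin (top_of_set {v \<in> model X. 0 \<le> conormal X \<bullet> v}) (\<phi> ` (U \<inter> W))"
      using chart_image_open[OF c W] by (simp add: model_half_space_def)
    fix y assume "y \<in> \<phi> ` (U \<inter> W)"
    then obtain x where x: "x \<in> U" "x \<in> W" "y = \<phi> x" by auto
    then obtain W' where W': "x \<in> W'" "openin (points X) W'" "smooth_function X W' f" using loc by blast
    let ?T = "\<phi> ` (U \<inter> (W \<inter> W'))"
    have "openin (top_of_set (model_half_space X)) ?T"
      using W W'(2) by (intro chart_image_open[OF c] openin_Int)
    moreover have "\<phi> ` (U \<inter> W) \<subseteq> model_half_space X"
      using openin_imp_subset[OF chart_image_openin[OF c]] by auto
    ultimately have "openin (top_of_set (\<phi> ` (U \<inter> W))) ?T"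
      by (meson Int_lower1 Int_mono image_mono openin_subset_trans subset_refl)
    moreover have "smooth_upto_boundary (model X) ?T (f \<circ> inv_into U \<phi>)"
      by (rule smooth_upto_boundary_subset[OF smooth_functionD[OF W'(3) c]]) auto
    ultimately show "\<exists>T. y \<in> T \<and> openin (top_of_set (\<phi> ` (U \<inter> W))) T \<and>
        smooth_upto_boundary (model X) T (f \<circ> inv_into U \<phi>)"
      using x W'(1) by (intro exI[of _ ?T]) auto
  qed
qed

text \<open>Extension by zero. A compact set in a Hausdorff space is closed, so
  \<open>U \<inter> W\<close> and \<open>W - C\<close> form an open cover of \<open>W\<close>; on
  the second set \<open>f\<close> is 0.\<close>

lemma smooth_function_extend:
  assumes U: "openin (points X) U" and W: "openin (points X) W" and C: "compactin (points X) C" "C \<subseteq> U"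
    and f: "smooth_function X (U \<inter> W) f" and zero: "\<And>x. x \<in> W \<Longrightarrow> x \<notin> C \<Longrightarrow> f x = 0"
  shows "smooth_function X W f"
proof (rule smooth_function_locally[OF W])
  fix x assume x: "x \<in> W"
  have "closedin (points X) C" using C(1) Hausdorff by (intro compactin_imp_closedin)
  then have oC: "openin (points X) (W - C)" using W by (rule openin_diff[rotated])
  show "\<exists>W'. x \<in> W' \<and> openin (points X) W' \<and> smooth_function X W' f"
  proof (cases "x \<in> C")
    case True
    then show ?thesis using x C U W f by (intro exI[of _ "U \<inter> W"]) auto
  next
    case False
    have "smooth_function X (W - C) f"
      by (rule smooth_function_cong[OF smooth_function_const[of _ 0]]) (use zero in auto)
    then show ?thesis using x False oC by (intro exI[of _ "W - C"]) auto
  qed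
qed

text \<open>Around a boundary point the chart image contains no full ball. The closed ball cut with
  the half-space is still compact, since the half-space is closed, and for small \<open>r\<close> it
  lies in the image of \<open>U \<inter> O'\<close>.\<close>

lemma chart_ball:
  assumes c: "(U, \<phi>) \<in> atlas X" and x: "x \<in> U" and O: "openin (points X) O'" "x \<in> O'"
  obtains r where "0 < r" "compactin (points X) {y \<in> U. dist (\<phi> y) (\<phi> x) \<le> r}"
    "{y \<in> U. dist (\<phi> y) (\<phi> x) \<le> r} \<subseteq> O'"
proof -
  let ?H = "model_half_space X"
  have op: "openin (top_of_set ?H) (\<phi> ` (U \<inter> O'))" by (rule chart_image_open[OF c O(1)])
  then obtain G where G: "open G" "\<phi> ` (U \<inter> O') = ?H \<inter> G" by (auto simp: openin_open)
  have "\<phi> x \<in> G" using G x O by auto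
  then obtain r where r: "0 < r" "cball (\<phi> x) r \<subseteq> G" using open_contains_cball G(1) by blast
  let ?K = "cball (\<phi> x) r \<inter> ?H" and ?C = "{y \<in> U. dist (\<phi> y) (\<phi> x) \<le> r}"
  have H: "closed ?H"
  proof -
    have "?H = model X \<inter> {v. conormal X \<bullet> v \<ge> 0}" by (auto simp: model_half_space_def)
    then show ?thesis
      using closed_subspace[OF subspace_model] by (simp add: closed_Int closed_halfspace_ge)
  qed
  have UH: "\<phi> ` U \<subseteq> ?H" using openin_imp_subset[OF chart_image_openin[OF c]] .
  have K: "?K \<subseteq> \<phi> ` (U \<inter> O')" unfolding G(2) using r by auto
  have CO: "?C \<subseteq> O'"
  proof
    fix y assume y: "y \<in> ?C"
    then have "\<phi> y \<in> ?K" using UH by (auto simp: dist_commute)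
    then obtain z where "z \<in> U \<inter> O'" "\<phi> y = \<phi> z" using K by auto
    then show "y \<in> O'" using chart_inj[OF c] y by (auto dest: inj_onD)
  qed
  have "\<phi> ` ?C = ?K" using K UH by (auto simp: dist_commute)
  moreover have "compact ?K" using H by (intro compact_Int_closed compact_cball)
  ultimately have "compactin (top_of_set (\<phi> ` U)) (\<phi> ` ?C)" using K by (auto simp: compactin_subtopology)
  then have "compactin (subtopology (points X) U) ?C"
    using homeomorphic_map_compactness_eq[OF chart_homeomorphic[OF c], of ?C] chart_subset[OF c] by auto
  then have "compactin (points X) ?C" by (simp add: compactin_subtopology)
  then show ?thesis using that r(1) CO by blast
qed

lemma smooth_function_smooth_step:
  assumes f: "smooth_function X W f" and ab: "a < b"
  shows "smooth_function X W (\<lambda>x. smooth_step a b (f x))"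
proof -
  have lin: "smooth_function X W (\<lambda>x. c + d * f x)" for c d
    by (intro smooth_function_add smooth_function_mult smooth_function_const f)
  have "smooth_function X W (\<lambda>x. flat 1 (b + (-1) * f x) *
      inverse (flat 1 (b + (-1) * f x) + flat 1 (- a + 1 * f x)))"
  proof (rule smooth_function_mult[OF smooth_function_flat[OF lin]
      smooth_function_inverse[OF smooth_function_add[OF smooth_function_flat[OF lin] smooth_function_flat[OF lin]]]])
    fix x
    have "0 < b + (-1) * f x \<or> 0 < - a + 1 * f x" using ab by linarith
    then have "0 < flat 1 (b + (-1) * f x) \<or> 0 < flat 1 (- a + 1 * f x)" by (simp only: flat_1)
    then show "flat 1 (b + (-1) * f x) + flat 1 (- a + 1 * f x) \<noteq> 0"
      using flat_1(1)[of "b + (-1) * f x"] flat_1(1)[of "- a + 1 * f x"] by linarith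
  qed
  then show ?thesis by (simp add: smooth_step_def)
qed

lemma bump_functions:
  assumes O: "openin (points X) O'" "x \<in> O'"
  obtains \<rho> \<eta> :: "'m \<Rightarrow> real" and P C where
    "smooth_function X (topspace (points X)) \<rho>" "smooth_function X (topspace (points X)) \<eta>"
    "openin (points X) P" "x \<in> P" "\<And>y. y \<in> P \<Longrightarrow> \<rho> y = 1" "compactin (points X) C" "C \<subseteq> O'"
    "\<And>y. y \<notin> C \<Longrightarrow> \<rho> y = 0" "\<And>y. y \<notin> C \<Longrightarrow> \<eta> y = 0" "\<And>y. \<eta> y * \<rho> y = \<rho> y"
proof -
  let ?M = "topspace (points X)"
  have "x \<in> ?M" using O openin_subset by blast
  then obtain U \<phi> where c: "(U, \<phi>) \<in> atlas X" and x: "x \<in> U" using atlas_cover by fastforce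
  obtain r where r: "0 < r" and C: "compactin (points X) {y \<in> U. dist (\<phi> y) (\<phi> x) \<le> r}"
    "{y \<in> U. dist (\<phi> y) (\<phi> x) \<le> r} \<subseteq> O'"
    using chart_ball[OF c x O] .
  let ?C = "{y \<in> U. dist (\<phi> y) (\<phi> x) \<le> r}"
  \<comment> \<open>The squared chart distance, spelled out in coordinates so that the rules for
    sums and products give its smoothness; the distance itself is in general not smooth at
    \<open>x\<close>.\<close>
  define d where "d y = (\<Sum>b\<in>Basis. (\<phi> y \<bullet> b + - (\<phi> x \<bullet> b)) * (\<phi> y \<bullet> b + - (\<phi> x \<bullet> b)))" for y
  have d_eq: "d y = (dist (\<phi> y) (\<phi> x))\<^sup>2" for y
    unfolding dist_norm d_def power2_norm_eq_inner
    by (subst euclidean_inner) (simp add: inner_diff_left)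
  have "smooth_function X U (\<lambda>y. \<phi> y \<bullet> b)" for b
    using smooth_upto_boundary_inner[OF subspace_model chart_transition[OF _ c], of _ _ b]
    by (intro smooth_functionI) (simp add: comp_def)
  then have sd: "smooth_function X U d"
    unfolding d_def
    by (intro smooth_function_sum smooth_function_mult smooth_function_add smooth_function_const)
  \<comment> \<open>The value 0 outside the chart domain fits smoothly: for b \<le> r^2 the cutoff
    already vanishes outside the compact set \<open>?C\<close>.\<close>
  define bump where "bump a b y = (if y \<in> U then smooth_step a b (d y) else 0)" for a b y
  have bump0: "bump a b y = 0" if "b \<le> r\<^sup>2" "y \<notin> ?C" for a b y
  proof (cases "y \<in> U")
    case True
    then have "r \<le> dist (\<phi> y) (\<phi> x)" using that by auto
    then have "r\<^sup>2 \<le> d y" unfolding d_eq using r by (intro power_mono) auto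
    then show ?thesis using that(1) by (simp add: bump_def smooth_step_eq_0)
  qed (simp add: bump_def)
  have sb: "smooth_function X ?M (bump a b)" if "a < b" "b \<le> r\<^sup>2" for a b
  proof (rule smooth_function_extend[OF chart_openin[OF c] openin_topspace C(1)])
    show "?C \<subseteq> U" by auto
    have "smooth_function X U (bump a b)"
      by (rule smooth_function_cong[OF smooth_function_smooth_step[OF sd that(1)]]) (simp add: bump_def)
    then show "smooth_function X (U \<inter> ?M) (bump a b)" by (rule smooth_function_subset) auto
  qed (use bump0[OF that(2)] in auto)
  let ?P = "{y \<in> U. \<phi> y \<in> ball (\<phi> x) (r / 2)}"
  have "openin (subtopology (points X) U) {y \<in> topspace (subtopology (points X) U). \<phi> y \<in> ball (\<phi> x) (r / 2) \<inter> \<phi> ` U}"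
    using homeomorphic_imp_continuous_map[OF chart_homeomorphic[OF c]]
    by (rule openin_continuous_map_preimage) (auto simp: openin_open)
  also have "{y \<in> topspace (subtopology (points X) U). \<phi> y \<in> ball (\<phi> x) (r / 2) \<inter> \<phi> ` U} = ?P"
    using chart_subset[OF c] by auto
  finally have P: "openin (points X) ?P" using chart_openin[OF c] by (simp add: openin_open_subtopology)
  \<comment> \<open>In terms of the squared distance, \<rho> drops from 1 to 0 between r^2 / 4 and
    r^2 / 2, and \<eta> between r^2 / 2 and r^2. Thus \<eta> is 1 wherever \<rho> is nonzero, and
    \<rho> is 1 on the ball of radius r / 2.\<close>
  have r4: "r\<^sup>2 / 4 < r\<^sup>2 / 2" "r\<^sup>2 / 2 < r\<^sup>2" using r by auto
  show thesis
  proof (rule that[of "bump (r\<^sup>2 / 4) (r\<^sup>2 / 2)" "bump (r\<^sup>2 / 2) (r\<^sup>2)" ?P ?C])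
    show "bump (r\<^sup>2 / 4) (r\<^sup>2 / 2) y = 1" if "y \<in> ?P" for y
    proof -
      have "d y \<le> (r / 2)\<^sup>2" unfolding d_eq using that by (intro power_mono) (auto simp: dist_commute)
      then show ?thesis using that r4 by (simp add: bump_def smooth_step_eq_1 power_divide)
    qed
    show "bump (r\<^sup>2 / 2) (r\<^sup>2) y * bump (r\<^sup>2 / 4) (r\<^sup>2 / 2) y = bump (r\<^sup>2 / 4) (r\<^sup>2 / 2) y" for y
      using smooth_step_eq_1[OF r4(2), of "d y"] smooth_step_eq_0[of "r\<^sup>2 / 2" "d y"]
      by (cases "d y \<le> r\<^sup>2 / 2") (auto simp: bump_def)
    show "x \<in> ?P" using x r by simp
    show "smooth_function X ?M (bump (r\<^sup>2 / 4) (r\<^sup>2 / 2))" "smooth_function X ?M (bump (r\<^sup>2 / 2) (r\<^sup>2))"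
      using r4 by (intro sb; linarith)+
    show "bump (r\<^sup>2 / 4) (r\<^sup>2 / 2) y = 0" "bump (r\<^sup>2 / 2) (r\<^sup>2) y = 0" if "y \<notin> ?C" for y
      using r4 by (intro bump0[OF _ that]; linarith)+
  qed (fact P C)+
qed

end

section \<open>Sections of Lie algebra bundles\<close>

locale lie_isomorphism = F: lie_algebra F + L: lie_algebra L
  for F :: "(real, 'b) module" and L :: "(real, 'a) module" and h +
  assumes iso: "h \<in> lie_iso F L"
begin

abbreviation g where "g \<equiv> inv_into (carrier F) h"

lemma closed [simp]: "v \<in> carrier F \<Longrightarrow> h v \<in> carrier L"
  and add: "v \<in> carrier F \<Longrightarrow> w \<in> carrier F \<Longrightarrow> h (v \<oplus>\<^bsub>F\<^esub> w) = h v \<oplus>\<^bsub>L\<^esub> h w"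
  and mult: "v \<in> carrier F \<Longrightarrow> w \<in> carrier F \<Longrightarrow> h (v \<otimes>\<^bsub>F\<^esub> w) = h v \<otimes>\<^bsub>L\<^esub> h w"
  and smult: "v \<in> carrier F \<Longrightarrow> h (r \<odot>\<^bsub>F\<^esub> v) = r \<odot>\<^bsub>L\<^esub> h v"
  and bij: "bij_betw h (carrier F) (carrier L)"
  using iso by (auto simp: lie_iso_def lie_hom_def)

lemma zero: "h \<zero>\<^bsub>F\<^esub> = \<zero>\<^bsub>L\<^esub>"
  using smult[of "\<zero>\<^bsub>F\<^esub>" 0] by simp

lemma inv_closed [simp]: "v \<in> carrier L \<Longrightarrow> g v \<in> carrier F"
  using bij by (metis bij_betw_imp_surj_on inv_into_into)

lemma right_inv [simp]: "v \<in> carrier L \<Longrightarrow> h (g v) = v"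
  using bij by (metis bij_betw_inv_into_right)

lemma left_inv [simp]: "v \<in> carrier F \<Longrightarrow> g (h v) = v"
  using bij by (metis bij_betw_inv_into_left)

lemma inv_eqI: "w \<in> carrier F \<Longrightarrow> h w = v \<Longrightarrow> g v = w"
  using left_inv by blast

lemma inv_add: "v \<in> carrier L \<Longrightarrow> w \<in> carrier L \<Longrightarrow> g (v \<oplus>\<^bsub>L\<^esub> w) = g v \<oplus>\<^bsub>F\<^esub> g w"
  by (intro inv_eqI) (simp_all add: add)

lemma inv_mult: "v \<in> carrier L \<Longrightarrow> w \<in> carrier L \<Longrightarrow> g (v \<otimes>\<^bsub>L\<^esub> w) = g v \<otimes>\<^bsub>F\<^esub> g w"
  by (intro inv_eqI) (simp_all add: mult F.bracket_closed)

lemma inv_smult: "v \<in> carrier L \<Longrightarrow> g (r \<odot>\<^bsub>L\<^esub> v) = r \<odot>\<^bsub>F\<^esub> g v"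
  by (intro inv_eqI) (simp_all add: smult)

lemma inv_zero: "g \<zero>\<^bsub>L\<^esub> = \<zero>\<^bsub>F\<^esub>"
  by (intro inv_eqI) (simp_all add: zero)

end

section \<open>Compactly supported sections of the bundle\<close>

locale lie_algebra_bundle_over = manifold_with_boundary X + L: lie_algebra L
  for X :: "('m, 'e::euclidean_space) manifold" and L :: "(real, 'g) module" +
  fixes K :: "('m, 'b, 'g) fiber_bundle"
  assumes fin: "finite_dimensional L" and is_bundle: "lie_algebra_bundle X L K"
begin

abbreviation "M \<equiv> topspace (points X)"
abbreviation "\<Gamma> \<equiv> compact_sections X L K"

lemma bundle_conditions:
  shows fiber_lie_algebra: "x \<in> M \<Longrightarrow> lie_algebra (fiber K x)"
    and trivialization_openin: "(U, \<psi>) \<in> trivializations K \<Longrightarrow> openin (points X) U"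
    and trivialization_lie_iso:
      "(U, \<psi>) \<in> trivializations K \<Longrightarrow> x \<in> U \<Longrightarrow> \<psi> x \<in> lie_iso (fiber K x) L"
    and trivialization_cover: "x \<in> M \<Longrightarrow> \<exists>U \<psi>. (U, \<psi>) \<in> trivializations K \<and> x \<in> U"
    and transition_smooth:
      "(U, \<psi>) \<in> trivializations K \<Longrightarrow> (U', \<psi>') \<in> trivializations K \<Longrightarrow> v \<in> carrier L \<Longrightarrow>
        l \<in> linear_functionals L \<Longrightarrow>
        smooth_function X (U \<inter> U') (\<lambda>x. l (\<psi>' x (inv_into (carrier (fiber K x)) (\<psi> x) v)))"
proof -
  note b = is_bundle[unfolded lie_algebra_bundle_def]
  note b1 = b[THEN conjunct1] and b2 = b[THEN conjunct2, THEN conjunct1]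
    and b3 = b[THEN conjunct2, THEN conjunct2, THEN conjunct1]
    and b4 = b[THEN conjunct2, THEN conjunct2, THEN conjunct2]
  show "x \<in> M \<Longrightarrow> lie_algebra (fiber K x)" by (rule bspec[OF b1])
  {
    assume t: "(U, \<psi>) \<in> trivializations K"
    note b2' = bspec[OF b2 t, unfolded prod.case]
    show "openin (points X) U" using b2' ..
    show "x \<in> U \<Longrightarrow> \<psi> x \<in> lie_iso (fiber K x) L" by (rule bspec[OF b2'[THEN conjunct2]])
    assume t': "(U', \<psi>') \<in> trivializations K" and v: "v \<in> carrier L" and l: "l \<in> linear_functionals L"
    show "smooth_function X (U \<inter> U') (\<lambda>x. l (\<psi>' x (inv_into (carrier (fiber K x)) (\<psi> x) v)))"
      by (rule bspec[OF bspec[OF bspec[OF bspec[OF b4 t, unfolded prod.case] t', unfolded prod.case] v] l])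
  }
  show "\<exists>U \<psi>. (U, \<psi>) \<in> trivializations K \<and> x \<in> U" if "x \<in> M"
    using that unfolding b3[symmetric] by blast
qed

lemma trivialization_subset: "(U, \<psi>) \<in> trivializations K \<Longrightarrow> U \<subseteq> M"
  by (rule openin_subset[OF trivialization_openin])

lemma trivialization_iso:
  assumes t: "(U, \<psi>) \<in> trivializations K" and x: "x \<in> U"
  shows "lie_isomorphism (fiber K x) L (\<psi> x)"
  using trivialization_subset[OF t] x
  by (intro lie_isomorphism.intro lie_isomorphism_axioms.intro fiber_lie_algebra
    trivialization_lie_iso[OF t x] L.lie_algebra_axioms) blast

lemma compact_sections_iff:
  "s \<in> carrier \<Gamma> \<longleftrightarrow> (\<forall>x\<in>M. s x \<in> carrier (fiber K x)) \<and> s \<in> extensional M \<and>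
     (\<forall>(U, \<psi>)\<in>trivializations K. \<forall>l\<in>linear_functionals L. smooth_function X U (\<lambda>x. l (\<psi> x (s x)))) \<and>
     compactin (points X) (section_support X K s)"
  by (simp add: compact_sections_def smooth_sections_def PiE_iff conj_assoc)

text \<open>Instead of computing the support it suffices to name a compact set outside which the
  section vanishes: such a set is closed and so contains the support.\<close>

lemma compact_sectionsI:
  assumes "\<And>x. x \<in> M \<Longrightarrow> s x \<in> carrier (fiber K x)" "s \<in> extensional M"
    and "\<And>U \<psi> l. (U, \<psi>) \<in> trivializations K \<Longrightarrow> l \<in> linear_functionals L \<Longrightarrow>
      smooth_function X U (\<lambda>x. l (\<psi> x (s x)))"
    and "compactin (points X) C" "\<And>x. x \<in> M \<Longrightarrow> x \<notin> C \<Longrightarrow> s x = \<zero>\<^bsub>fiber K x\<^esub>"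
  shows "s \<in> carrier \<Gamma>"
proof -
  have C: "closedin (points X) C" using assms(4) Hausdorff by (intro compactin_imp_closedin)
  then have "section_support X K s \<subseteq> C"
    unfolding section_support_def using assms(5) by (intro closure_of_minimal) auto
  then have "compactin (points X) (section_support X K s)"
    by (rule closed_compactin[OF assms(4)]) (simp add: section_support_def)
  then show ?thesis
    using assms(1-3) unfolding compact_sections_iff by blast
qed

lemma compact_sectionsD:
  assumes "s \<in> carrier \<Gamma>"
  shows section_in_fiber: "x \<in> M \<Longrightarrow> s x \<in> carrier (fiber K x)"
    and section_extensional: "s \<in> extensional M"
    and section_smooth: "(U, \<psi>) \<in> trivializations K \<Longrightarrow> l \<in> linear_functionals L \<Longrightarrow>
      smooth_function X U (\<lambda>x. l (\<psi> x (s x)))"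
    and section_support_compact: "compactin (points X) (section_support X K s)"
  using assms unfolding compact_sections_iff by blast+

lemma section_zero_off_support:
  "x \<in> M \<Longrightarrow> x \<notin> section_support X K s \<Longrightarrow> s x = \<zero>\<^bsub>fiber K x\<^esub>"
  unfolding section_support_def using closure_of_subset[of "{x \<in> M. s x \<noteq> \<zero>\<^bsub>fiber K x\<^esub>}" "points X"] by auto

lemma sections_add_apply: "x \<in> M \<Longrightarrow> (s \<oplus>\<^bsub>\<Gamma>\<^esub> t) x = s x \<oplus>\<^bsub>fiber K x\<^esub> t x"
  and sections_mult_apply: "x \<in> M \<Longrightarrow> (s \<otimes>\<^bsub>\<Gamma>\<^esub> t) x = s x \<otimes>\<^bsub>fiber K x\<^esub> t x"
  and sections_smult_apply: "x \<in> M \<Longrightarrow> (r \<odot>\<^bsub>\<Gamma>\<^esub> t) x = r \<odot>\<^bsub>fiber K x\<^esub> t x"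
  and sections_ops_extensional: "s \<oplus>\<^bsub>\<Gamma>\<^esub> t \<in> extensional M" "s \<otimes>\<^bsub>\<Gamma>\<^esub> t \<in> extensional M"
    "r \<odot>\<^bsub>\<Gamma>\<^esub> t \<in> extensional M"
  by (simp_all add: compact_sections_def)

text \<open>The section with coordinates \<open>u\<close> in one trivialization, extended by zero.
  For u x = f x v it is the section called f v. Nothing is required of \<open>u\<close>, so the
  algebraic rules hold before smoothness is settled.\<close>

definition local_section :: "'m set \<Rightarrow> ('m \<Rightarrow> 'b \<Rightarrow> 'g) \<Rightarrow> ('m \<Rightarrow> 'g) \<Rightarrow> 'm \<Rightarrow> 'b" where
  "local_section U \<psi> u = (\<lambda>x\<in>M. if x \<in> U then inv_into (carrier (fiber K x)) (\<psi> x) (u x) else \<zero>\<^bsub>fiber K x\<^esub>)"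

lemma local_section_extensional: "local_section U \<psi> u \<in> extensional M"
  by (simp add: local_section_def)

lemma local_section_apply:
  assumes "(U, \<psi>) \<in> trivializations K" "x \<in> U"
  shows "local_section U \<psi> u x = inv_into (carrier (fiber K x)) (\<psi> x) (u x)"
  using assms trivialization_subset by (auto simp: local_section_def)

lemma local_section_off: "x \<in> M \<Longrightarrow> x \<notin> U \<Longrightarrow> local_section U \<psi> u x = \<zero>\<^bsub>fiber K x\<^esub>"
  by (simp add: local_section_def)

lemma local_section_add:
  assumes t: "(U, \<psi>) \<in> trivializations K" and "\<And>x. x \<in> U \<Longrightarrow> u x \<in> carrier L" "\<And>x. x \<in> U \<Longrightarrow> w x \<in> carrier L"
  shows "local_section U \<psi> (\<lambda>x. u x \<oplus>\<^bsub>L\<^esub> w x) = local_section U \<psi> u \<oplus>\<^bsub>\<Gamma>\<^esub> local_section U \<psi> w"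
proof (rule extensionalityI[OF local_section_extensional sections_ops_extensional(1)])
  fix x assume x: "x \<in> M"
  interpret F: lie_algebra "fiber K x" using x by (rule fiber_lie_algebra)
  show "local_section U \<psi> (\<lambda>x. u x \<oplus>\<^bsub>L\<^esub> w x) x = (local_section U \<psi> u \<oplus>\<^bsub>\<Gamma>\<^esub> local_section U \<psi> w) x"
  proof (cases "x \<in> U")
    case True
    then interpret lie_isomorphism "fiber K x" L "\<psi> x" by (rule trivialization_iso[OF t])
    show ?thesis using x True t assms by (simp add: sections_add_apply local_section_apply inv_add)
  qed (simp add: x sections_add_apply local_section_off)
qed

lemma local_section_smult:
  assumes t: "(U, \<psi>) \<in> trivializations K" and "\<And>x. x \<in> U \<Longrightarrow> u x \<in> carrier L"
  shows "local_section U \<psi> (\<lambda>x. r \<odot>\<^bsub>L\<^esub> u x) = r \<odot>\<^bsub>\<Gamma>\<^esub> local_section U \<psi> u"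
proof (rule extensionalityI[OF local_section_extensional sections_ops_extensional(3)])
  fix x assume x: "x \<in> M"
  interpret F: lie_algebra "fiber K x" using x by (rule fiber_lie_algebra)
  show "local_section U \<psi> (\<lambda>x. r \<odot>\<^bsub>L\<^esub> u x) x = (r \<odot>\<^bsub>\<Gamma>\<^esub> local_section U \<psi> u) x"
  proof (cases "x \<in> U")
    case True
    then interpret lie_isomorphism "fiber K x" L "\<psi> x" by (rule trivialization_iso[OF t])
    show ?thesis using x True t assms by (simp add: sections_smult_apply local_section_apply inv_smult)
  qed (simp add: x sections_smult_apply local_section_off)
qed

lemma local_section_mult:
  assumes t: "(U, \<psi>) \<in> trivializations K" and "\<And>x. x \<in> U \<Longrightarrow> u x \<in> carrier L" "\<And>x. x \<in> U \<Longrightarrow> w x \<in> carrier L"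
  shows "local_section U \<psi> (\<lambda>x. u x \<otimes>\<^bsub>L\<^esub> w x) = local_section U \<psi> u \<otimes>\<^bsub>\<Gamma>\<^esub> local_section U \<psi> w"
proof (rule extensionalityI[OF local_section_extensional sections_ops_extensional(2)])
  fix x assume x: "x \<in> M"
  interpret F: lie_algebra "fiber K x" using x by (rule fiber_lie_algebra)
  show "local_section U \<psi> (\<lambda>x. u x \<otimes>\<^bsub>L\<^esub> w x) x = (local_section U \<psi> u \<otimes>\<^bsub>\<Gamma>\<^esub> local_section U \<psi> w) x"
  proof (cases "x \<in> U")
    case True
    then interpret lie_isomorphism "fiber K x" L "\<psi> x" by (rule trivialization_iso[OF t])
    show ?thesis using x True t assms by (simp add: sections_mult_apply local_section_apply inv_mult)
  qed (simp add: x sections_mult_apply local_section_off F.bracket_alternating)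
qed

text \<open>Smoothness has to be tested in all other trivializations. There the section has the
  coordinates \<open>f\<close> times a matrix coefficient of the transition map, and outside the
  compact set \<open>C\<close> it is zero.\<close>

lemma local_section_in_sections:
  assumes t: "(U, \<psi>) \<in> trivializations K" and v: "v \<in> carrier L" and f: "smooth_function X M f"
    and C: "compactin (points X) C" "C \<subseteq> U" "\<And>x. x \<notin> C \<Longrightarrow> f x = 0"
  shows "local_section U \<psi> (\<lambda>x. f x \<odot>\<^bsub>L\<^esub> v) \<in> carrier \<Gamma>"
proof (rule compact_sectionsI[OF _ local_section_extensional _ C(1)])
  let ?s = "local_section U \<psi> (\<lambda>x. f x \<odot>\<^bsub>L\<^esub> v)"
  show "?s x \<in> carrier (fiber K x)" if x: "x \<in> M" for x
  proof (cases "x \<in> U")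
    case True
    then interpret lie_isomorphism "fiber K x" L "\<psi> x" by (rule trivialization_iso[OF t])
    show ?thesis using True t v by (simp add: local_section_apply)
  next
    case False
    interpret F: lie_algebra "fiber K x" using x by (rule fiber_lie_algebra)
    show ?thesis using False x by (simp add: local_section_off)
  qed
  show zero: "?s x = \<zero>\<^bsub>fiber K x\<^esub>" if x: "x \<in> M" "x \<notin> C" for x
  proof (cases "x \<in> U")
    case True
    then interpret lie_isomorphism "fiber K x" L "\<psi> x" by (rule trivialization_iso[OF t])
    show ?thesis using True t v C(3)[OF x(2)] by (simp add: local_section_apply inv_zero)
  qed (simp add: x local_section_off)
  fix U' \<psi>' l assume t': "(U', \<psi>') \<in> trivializations K" and l: "l \<in> linear_functionals L"
  show "smooth_function X U' (\<lambda>x. l (\<psi>' x (?s x)))"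
  proof (rule smooth_function_extend[OF trivialization_openin[OF t] trivialization_openin[OF t'] C(1,2)])
    have "smooth_function X (U \<inter> U') (\<lambda>x. f x * l (\<psi>' x (inv_into (carrier (fiber K x)) (\<psi> x) v)))"
      using trivialization_subset[OF t]
      by (intro smooth_function_mult transition_smooth[OF t t' v l] smooth_function_subset[OF f]) auto
    then show "smooth_function X (U \<inter> U') (\<lambda>x. l (\<psi>' x (?s x)))"
    proof (rule smooth_function_cong)
      fix x assume x: "x \<in> U \<inter> U'"
      interpret h: lie_isomorphism "fiber K x" L "\<psi> x" using x by (intro trivialization_iso[OF t]) auto
      interpret h': lie_isomorphism "fiber K x" L "\<psi>' x" using x by (intro trivialization_iso[OF t']) auto
      show "f x * l (\<psi>' x (inv_into (carrier (fiber K x)) (\<psi> x) v)) = l (\<psi>' x (?s x))"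
        using x t v l by (simp add: local_section_apply h.inv_smult h'.smult L.linear_functionals_smult)
    qed
    fix x assume x: "x \<in> U'" "x \<notin> C"
    interpret h': lie_isomorphism "fiber K x" L "\<psi>' x" using x(1) by (rule trivialization_iso[OF t'])
    have "x \<in> M" using trivialization_subset[OF t'] x by blast
    then show "l (\<psi>' x (?s x)) = 0" using zero x l by (simp add: h'.zero L.linear_functionals_zero)
  qed
qed

lemma sections_add_closed:
  assumes s: "s \<in> carrier \<Gamma>" and t: "t \<in> carrier \<Gamma>"
  shows "s \<oplus>\<^bsub>\<Gamma>\<^esub> t \<in> carrier \<Gamma>"
proof (rule compact_sectionsI[OF _ sections_ops_extensional(1)])
  show "compactin (points X) (section_support X K s \<union> section_support X K t)"
    using s t by (intro compactin_Un section_support_compact)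
  fix x assume x: "x \<in> M"
  interpret F: lie_algebra "fiber K x" using x by (rule fiber_lie_algebra)
  show "(s \<oplus>\<^bsub>\<Gamma>\<^esub> t) x \<in> carrier (fiber K x)"
    using x s t by (simp add: sections_add_apply section_in_fiber)
  show "(s \<oplus>\<^bsub>\<Gamma>\<^esub> t) x = \<zero>\<^bsub>fiber K x\<^esub>" if "x \<notin> section_support X K s \<union> section_support X K t"
    using x that by (simp add: sections_add_apply section_zero_off_support)
next
  fix U \<psi> l assume t': "(U, \<psi>) \<in> trivializations K" and l: "l \<in> linear_functionals L"
  show "smooth_function X U (\<lambda>x. l (\<psi> x ((s \<oplus>\<^bsub>\<Gamma>\<^esub> t) x)))"
  proof (rule smooth_function_cong[OF smooth_function_add[OF section_smooth[OF s t' l] section_smooth[OF t t' l]]])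
    fix x assume x: "x \<in> U"
    interpret h: lie_isomorphism "fiber K x" L "\<psi> x" using x by (rule trivialization_iso[OF t'])
    have "x \<in> M" using trivialization_subset[OF t'] x by blast
    then show "l (\<psi> x (s x)) + l (\<psi> x (t x)) = l (\<psi> x ((s \<oplus>\<^bsub>\<Gamma>\<^esub> t) x))"
      using s t l by (simp add: sections_add_apply h.add section_in_fiber L.linear_functionals_add)
  qed
qed

end

section \<open>Sections of the subbundle\<close>

locale lie_subbundle = lie_algebra_bundle_over +
  fixes \<nn> assumes ideal: "lie_ideal \<nn> L"
begin

abbreviation "N \<equiv> L\<lparr>carrier := \<nn>\<rparr>"
abbreviation "\<Gamma>N \<equiv> compact_sections X N (subbundle K \<nn>)"

lemmas \<nn>_subset = L.submodule_subset[OF lie_ideal_submodule[OF ideal]]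
lemmas \<nn>_smult = L.submodule_smult[OF lie_ideal_submodule[OF ideal]]

lemma \<nn>_carrier: "v \<in> \<nn> \<Longrightarrow> v \<in> carrier L"
  using \<nn>_subset by blast

lemma subbundle_section_support: "section_support X (subbundle K \<nn>) s = section_support X K s"
  by (simp add: section_support_def subbundle_def)

lemma subbundle_sections_iff:
  "s \<in> carrier \<Gamma>N \<longleftrightarrow> (\<forall>x\<in>M. s x \<in> carrier (fiber K x)) \<and>
     (\<forall>(U, \<psi>)\<in>trivializations K. \<forall>x\<in>U. \<psi> x (s x) \<in> \<nn>) \<and> s \<in> extensional M \<and>
     (\<forall>(U, \<psi>)\<in>trivializations K. \<forall>l\<in>linear_functionals N. smooth_function X U (\<lambda>x. l (\<psi> x (s x)))) \<and>
     compactin (points X) (section_support X K s)"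
proof -
  let ?K = "subbundle K \<nn>"
  have tr: "trivializations ?K = trivializations K" by (simp add: subbundle_def)
  have fib: "v \<in> carrier (fiber ?K x) \<longleftrightarrow> v \<in> carrier (fiber K x) \<and>
      (\<forall>(U, \<psi>)\<in>trivializations K. x \<in> U \<longrightarrow> \<psi> x v \<in> \<nn>)" for v x
    by (simp add: subbundle_def)
  have "s \<in> carrier \<Gamma>N \<longleftrightarrow> ((\<forall>x\<in>M. s x \<in> carrier (fiber ?K x)) \<and> s \<in> extensional M) \<and>
     (\<forall>(U, \<psi>)\<in>trivializations K. \<forall>l\<in>linear_functionals N. smooth_function X U (\<lambda>x. l (\<psi> x (s x)))) \<and>
     compactin (points X) (section_support X K s)"
    by (simp add: compact_sections_def smooth_sections_def subbundle_section_support tr PiE_iff)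
  moreover have "(\<forall>x\<in>M. s x \<in> carrier (fiber ?K x)) \<longleftrightarrow> (\<forall>x\<in>M. s x \<in> carrier (fiber K x)) \<and>
     (\<forall>(U, \<psi>)\<in>trivializations K. \<forall>x\<in>U. \<psi> x (s x) \<in> \<nn>)"
    unfolding fib using trivialization_subset by blast
  ultimately show ?thesis by argo
qed

lemma linear_functionals_subset: "linear_functionals L \<subseteq> linear_functionals N"
  using \<nn>_subset by (auto simp: linear_functionals_def subset_eq)

text \<open>The two sides test smoothness with different functionals; those of \<open>L\<close>
  restrict to functionals on \<nn>.\<close>

lemma subbundle_sections_subset: "carrier \<Gamma>N \<subseteq> carrier \<Gamma>"
proof
  fix s assume s: "s \<in> carrier \<Gamma>N"
  show "s \<in> carrier \<Gamma>"
  proof (rule compact_sectionsI[where C = "section_support X K s"])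
    fix U \<psi> l assume "(U, \<psi>) \<in> trivializations K" "l \<in> linear_functionals L"
    then show "smooth_function X U (\<lambda>x. l (\<psi> x (s x)))"
      using s linear_functionals_subset unfolding subbundle_sections_iff by blast
  qed (use s section_zero_off_support in \<open>auto simp: subbundle_sections_iff\<close>)
qed

definition scaled :: "('a \<Rightarrow> real) \<Rightarrow> ('a \<Rightarrow> 'd) \<Rightarrow> 'a \<Rightarrow> 'd" where
  "scaled f s = (\<lambda>x\<in>M. f x \<odot>\<^bsub>fiber K x\<^esub> s x)"

lemma scaled_in_subbundle_sections:
  assumes f: "smooth_function X M f" and s: "s \<in> carrier \<Gamma>N"
  shows "scaled f s \<in> carrier \<Gamma>N"
  unfolding subbundle_sections_iff
proof (intro conjI ballI, goal_cases)
  have sx: "s x \<in> carrier (fiber K x)" if "x \<in> M" for x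
    using s that by (simp add: subbundle_sections_iff)
  have sn: "\<psi> x (s x) \<in> \<nn>" if "(U, \<psi>) \<in> trivializations K" "x \<in> U" for U \<psi> x
    using s that unfolding subbundle_sections_iff by blast
  have eq: "\<psi> x (scaled f s x) = f x \<odot>\<^bsub>L\<^esub> \<psi> x (s x)" if t: "(U, \<psi>) \<in> trivializations K" "x \<in> U" for U \<psi> x
  proof -
    interpret h: lie_isomorphism "fiber K x" L "\<psi> x" by (rule trivialization_iso[OF t])
    have "x \<in> M" using trivialization_subset t by blast
    then show ?thesis by (simp add: scaled_def h.smult sx)
  qed
  {
    case (1 x)
    interpret F: lie_algebra "fiber K x" using 1 by (rule fiber_lie_algebra)
    show ?case using 1 sx by (simp add: scaled_def)
  next
    case (2 t)
    have "\<psi> x (scaled f s x) \<in> \<nn>" if "(U, \<psi>) \<in> trivializations K" "x \<in> U" for U \<psi> x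
      using eq[OF that] \<nn>_smult[OF sn[OF that]] by simp
    then show ?case using 2 by auto
  next
    case 3
    show ?case by (simp add: scaled_def)
  next
    case (4 t)
    obtain U \<psi> where t: "t = (U, \<psi>)" by (cases t)
    have "smooth_function X U (\<lambda>x. l (\<psi> x (scaled f s x)))" if l: "l \<in> linear_functionals N" for l
    proof -
      have "smooth_function X U (\<lambda>x. l (\<psi> x (s x)))"
        using s 4 l unfolding t subbundle_sections_iff by blast
      then have "smooth_function X U (\<lambda>x. f x * l (\<psi> x (s x)))"
        using trivialization_subset 4 by (intro smooth_function_mult smooth_function_subset[OF f]) (auto simp: t)
      then show ?thesis
      proof (rule smooth_function_cong)
        fix x assume "x \<in> U"
        then have tx: "(U, \<psi>) \<in> trivializations K" "x \<in> U" using 4 by (auto simp: t)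
        show "f x * l (\<psi> x (s x)) = l (\<psi> x (scaled f s x))"
          using l sn[OF tx] unfolding eq[OF tx] by (simp add: linear_functionals_def)
      qed
    qed
    then show ?case by (simp add: t)
  next
    case 5
    have "{x \<in> M. scaled f s x \<noteq> \<zero>\<^bsub>fiber K x\<^esub>} \<subseteq> {x \<in> M. s x \<noteq> \<zero>\<^bsub>fiber K x\<^esub>}"
    proof safe
      fix x assume x: "x \<in> M" "scaled f s x \<noteq> \<zero>\<^bsub>fiber K x\<^esub>" "s x = \<zero>\<^bsub>fiber K x\<^esub>"
      interpret F: lie_algebra "fiber K x" using x(1) by (rule fiber_lie_algebra)
      show False using x by (simp add: scaled_def)
    qed
    then have sub: "section_support X K (scaled f s) \<subseteq> section_support X K s"
      unfolding section_support_def by (rule closure_of_mono)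
    have comp: "compactin (points X) (section_support X K s)"
      using s unfolding subbundle_sections_iff by blast
    have "closedin (points X) (section_support X K (scaled f s))"
      unfolding section_support_def by (rule closedin_closure_of)
    from closed_compactin[OF comp sub this] show ?case .
  }
qed

end

section \<open>Vanishing of the representation on sections of the subbundle\<close>

locale projective_rep = lie_subbundle +
  fixes \<pi> :: "_ \<Rightarrow> ('h::complex_hilbert_space \<Rightarrow>\<^sub>L 'h) set"
  assumes minimal: "minimal_cocompact_ideal \<nn> L"
    and hom: "\<pi> \<in> lie_hom \<Gamma> projective_skew_hermitian_algebra"
begin

abbreviation "P \<equiv> projective_skew_hermitian_algebra :: (real, ('h \<Rightarrow>\<^sub>L 'h) set) module"

sublocale P: lie_algebra P
  unfolding projective_skew_hermitian_algebra_def by (rule pu.quotient_lie_algebra)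

lemma \<pi>_closed: "s \<in> carrier \<Gamma> \<Longrightarrow> \<pi> s \<in> carrier P"
  and \<pi>_add: "s \<in> carrier \<Gamma> \<Longrightarrow> t \<in> carrier \<Gamma> \<Longrightarrow> \<pi> (s \<oplus>\<^bsub>\<Gamma>\<^esub> t) = \<pi> s \<oplus>\<^bsub>P\<^esub> \<pi> t"
  and \<pi>_mult: "s \<in> carrier \<Gamma> \<Longrightarrow> t \<in> carrier \<Gamma> \<Longrightarrow> \<pi> (s \<otimes>\<^bsub>\<Gamma>\<^esub> t) = \<pi> s \<otimes>\<^bsub>P\<^esub> \<pi> t"
  and \<pi>_smult: "s \<in> carrier \<Gamma> \<Longrightarrow> \<pi> (r \<odot>\<^bsub>\<Gamma>\<^esub> s) = r \<odot>\<^bsub>P\<^esub> \<pi> s"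
  using hom by (auto simp: lie_hom_def)

lemma \<pi>_zero_section:
  assumes s: "s \<in> carrier \<Gamma>" "\<And>x. x \<in> M \<Longrightarrow> s x = \<zero>\<^bsub>fiber K x\<^esub>"
  shows "\<pi> s = \<zero>\<^bsub>P\<^esub>"
proof -
  have "0 \<odot>\<^bsub>\<Gamma>\<^esub> s = s"
  proof (rule extensionalityI[OF sections_ops_extensional(3) section_extensional[OF s(1)]])
    fix x assume x: "x \<in> M"
    interpret F: lie_algebra "fiber K x" using x by (rule fiber_lie_algebra)
    show "(0 \<odot>\<^bsub>\<Gamma>\<^esub> s) x = s x" using x s by (simp add: sections_smult_apply)
  qed
  then show ?thesis using \<pi>_smult[OF s(1), of 0] \<pi>_closed[OF s(1)] by simp
qed

text \<open>
  As \<open>\<eta> f = f\<close>, the map \<open>v \<mapsto> \<pi> (f \<otimes> v)\<close> intertwines \<open>ad y\<close> with \<open>ad (\<pi> (\<eta> \<otimes> y))\<close>.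
\<close>

lemma \<pi>_local_section_vanishes:
  assumes t: "(U, \<psi>) \<in> trivializations K" and v: "v \<in> \<nn>"
    and f: "smooth_function X M f" and \<eta>: "smooth_function X M \<eta>"
    and C: "compactin (points X) C" "C \<subseteq> U" "\<And>x. x \<notin> C \<Longrightarrow> f x = 0" "\<And>x. x \<notin> C \<Longrightarrow> \<eta> x = 0"
    and \<eta>f: "\<And>x. \<eta> x * f x = f x"
  shows "\<pi> (local_section U \<psi> (\<lambda>x. f x \<odot>\<^bsub>L\<^esub> v)) = \<zero>\<^bsub>P\<^esub>"
proof (rule L.equivariant_map_vanishes[OF fin minimal _ _ _ _ v])
  let ?s = "\<lambda>f v. local_section U \<psi> (\<lambda>x. f x \<odot>\<^bsub>L\<^esub> v)"
  have s: "?s f x \<in> carrier \<Gamma>" if "x \<in> carrier L" for x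
    using that by (intro local_section_in_sections[OF t _ f C(1,2,3)])
  fix x y assume xy: "x \<in> carrier L" "y \<in> carrier L"
  show "\<pi> (?s f x) \<in> carrier P" using s xy \<pi>_closed by blast
  have "?s f (x \<oplus>\<^bsub>L\<^esub> y) = ?s f x \<oplus>\<^bsub>\<Gamma>\<^esub> ?s f y"
    using xy by (subst local_section_add[OF t, symmetric]) (auto simp: L.smult_add_right)
  then show "\<pi> (?s f (x \<oplus>\<^bsub>L\<^esub> y)) = \<pi> (?s f x) \<oplus>\<^bsub>P\<^esub> \<pi> (?s f y)" using s xy \<pi>_add by simp
next
  let ?s = "\<lambda>f v. local_section U \<psi> (\<lambda>x. f x \<odot>\<^bsub>L\<^esub> v)"
  fix r x assume x: "x \<in> carrier L"
  have "?s f (r \<odot>\<^bsub>L\<^esub> x) = r \<odot>\<^bsub>\<Gamma>\<^esub> ?s f x"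
    using x by (subst local_section_smult[OF t, symmetric]) (auto simp: L.smult_smult mult.commute)
  then show "\<pi> (?s f (r \<odot>\<^bsub>L\<^esub> x)) = r \<odot>\<^bsub>P\<^esub> \<pi> (?s f x)"
    using local_section_in_sections[OF t x f C(1,2,3)] \<pi>_smult by simp
next
  let ?s = "\<lambda>f v. local_section U \<psi> (\<lambda>x. f x \<odot>\<^bsub>L\<^esub> v)"
  fix y assume y: "y \<in> carrier L"
  have sy: "?s \<eta> y \<in> carrier \<Gamma>" by (rule local_section_in_sections[OF t y \<eta> C(1,2,4)])
  have "\<pi> (?s f (y \<otimes>\<^bsub>L\<^esub> x)) = \<pi> (?s \<eta> y) \<otimes>\<^bsub>P\<^esub> \<pi> (?s f x)" if x: "x \<in> carrier L" for x
  proof -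
    have "(\<eta> z \<odot>\<^bsub>L\<^esub> y) \<otimes>\<^bsub>L\<^esub> (f z \<odot>\<^bsub>L\<^esub> x) = f z \<odot>\<^bsub>L\<^esub> (y \<otimes>\<^bsub>L\<^esub> x)" for z
    proof -
      have "(\<eta> z \<odot>\<^bsub>L\<^esub> y) \<otimes>\<^bsub>L\<^esub> (f z \<odot>\<^bsub>L\<^esub> x) = (\<eta> z * f z) \<odot>\<^bsub>L\<^esub> (y \<otimes>\<^bsub>L\<^esub> x)"
        using x y by (simp add: L.bracket_smult_left L.bracket_smult_right L.smult_smult L.bracket_closed mult.commute)
      then show ?thesis by (simp only: \<eta>f)
    qed
    then have "?s f (y \<otimes>\<^bsub>L\<^esub> x) = ?s \<eta> y \<otimes>\<^bsub>\<Gamma>\<^esub> ?s f x"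
      using x y by (subst local_section_mult[OF t, symmetric]) auto
    then show ?thesis
      using sy local_section_in_sections[OF t x f C(1,2,3)] \<pi>_mult by simp
  qed
  then show "\<exists>A\<in>carrier P. \<forall>x\<in>carrier L. \<pi> (?s f (y \<otimes>\<^bsub>L\<^esub> x)) = A \<otimes>\<^bsub>P\<^esub> \<pi> (?s f x)"
    using \<pi>_closed[OF sy] by blast
qed

text \<open>In the trivialization \<rho> s is the sum over b of f_b b, with f_b the product of
  \<rho> and the b-coordinate of s. The coordinates come from a frame of \<nn> rather than of
  \<open>L\<close>, so that every b is in \<nn>. One \<eta> serves all summands, as \<eta> \<rho> =
  \<rho> implies \<eta> f_b = f_b.\<close>

lemma \<pi>_scaled_vanishes:
  assumes t: "(U, \<psi>) \<in> trivializations K" and s: "s \<in> carrier \<Gamma>N"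
    and \<rho>: "smooth_function X M \<rho>" and \<eta>: "smooth_function X M \<eta>"
    and C: "compactin (points X) C" "C \<subseteq> U" "\<And>x. x \<notin> C \<Longrightarrow> \<rho> x = 0" "\<And>x. x \<notin> C \<Longrightarrow> \<eta> x = 0"
    and \<eta>\<rho>: "\<And>x. \<eta> x * \<rho> x = \<rho> x"
  shows "\<pi> (scaled \<rho> s) = \<zero>\<^bsub>P\<^esub>"
proof -
  interpret N: real_module N
    by (rule L.submodule_is_real_module[OF lie_ideal_submodule[OF ideal]])
  obtain B c where Bc: "N.frame B c"
    using L.submodule_frame[OF fin lie_ideal_submodule[OF ideal]] .
  then have B: "finite B" "B \<subseteq> \<nn>" and c: "\<And>b. b \<in> B \<Longrightarrow> c b \<in> linear_functionals N"
    and rep: "\<And>w. w \<in> \<nn> \<Longrightarrow> w = (\<Oplus>\<^bsub>N\<^esub>b\<in>B. c b w \<odot>\<^bsub>N\<^esub> b)"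
    by (auto simp: N.frame_def)
  have sn: "\<psi> x (s x) \<in> \<nn>" if "x \<in> U" for x
    using s t that unfolding subbundle_sections_iff by blast
  define f where "f b x = (if x \<in> U then \<rho> x * c b (\<psi> x (s x)) else 0)" for b x
  have f0: "f b x = 0" if "x \<notin> C" for b x using C(3)[OF that] by (simp add: f_def)
  have f: "smooth_function X M (f b)" if "b \<in> B" for b
  proof (rule smooth_function_extend[OF trivialization_openin[OF t] openin_topspace C(1,2)])
    have "smooth_function X U (\<lambda>x. c b (\<psi> x (s x)))"
      using s t c[OF that] unfolding subbundle_sections_iff by blast
    then have "smooth_function X U (\<lambda>x. \<rho> x * c b (\<psi> x (s x)))"
      using trivialization_subset[OF t] by (intro smooth_function_mult smooth_function_subset[OF \<rho>])
    then have "smooth_function X U (f b)" by (rule smooth_function_cong) (simp add: f_def)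
    then show "smooth_function X (U \<inter> M) (f b)" by (rule smooth_function_subset) auto
  qed (use f0 in auto)
  define S where "S A = local_section U \<psi> (\<lambda>x. \<Oplus>\<^bsub>N\<^esub>b\<in>A. f b x \<odot>\<^bsub>N\<^esub> b)" for A
  \<comment> \<open>Additivity of \<pi> is available on \<Gamma> only, so membership of the partial
    sums is carried through the induction.\<close>
  have "S A \<in> carrier \<Gamma> \<and> \<pi> (S A) = \<zero>\<^bsub>P\<^esub>" if "finite A" "A \<subseteq> B" for A
    using that
  proof (induction A rule: finite_induct)
    case empty
    have z: "S {} x = \<zero>\<^bsub>fiber K x\<^esub>" if "x \<in> M" for x
    proof (cases "x \<in> U")
      case True
      then interpret h: lie_isomorphism "fiber K x" L "\<psi> x" by (rule trivialization_iso[OF t])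
      show ?thesis using h.inv_zero by (simp add: S_def local_section_apply[OF t True])
    qed (simp add: that S_def local_section_off)
    have "S {} \<in> carrier \<Gamma>"
    proof (rule compact_sectionsI[OF _ _ _ compactin_empty z])
      show "S {} \<in> extensional M" unfolding S_def by (rule local_section_extensional)
      show "S {} x \<in> carrier (fiber K x)" if "x \<in> M" for x
      proof -
        interpret F: lie_algebra "fiber K x" using that by (rule fiber_lie_algebra)
        show ?thesis using z[OF that] by simp
      qed
      fix U' \<psi>' l assume t': "(U', \<psi>') \<in> trivializations K" and l: "l \<in> linear_functionals L"
      show "smooth_function X U' (\<lambda>x. l (\<psi>' x (S {} x)))"
      proof (rule smooth_function_cong[OF smooth_function_const[of _ 0]])
        fix x assume x: "x \<in> U'"
        interpret h': lie_isomorphism "fiber K x" L "\<psi>' x" by (rule trivialization_iso[OF t' x])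
        show "0 = l (\<psi>' x (S {} x))"
          using z trivialization_subset[OF t'] x l by (auto simp: h'.zero L.linear_functionals_zero)
      qed
    qed
    then show ?case using \<pi>_zero_section z by blast
  next
    case (insert b A)
    then have A: "A \<subseteq> \<nn>" "b \<in> \<nn>" "b \<in> B" using B by auto
    have mem: "(\<Oplus>\<^bsub>N\<^esub>b\<in>A. f b x \<odot>\<^bsub>N\<^esub> b) \<in> \<nn>" for x
      using N.finsum_closed[of "\<lambda>b. f b x \<odot>\<^bsub>N\<^esub> b" A] A \<nn>_smult by auto
    have "S (insert b A) = local_section U \<psi> (\<lambda>x. f b x \<odot>\<^bsub>L\<^esub> b \<oplus>\<^bsub>L\<^esub> (\<Oplus>\<^bsub>N\<^esub>b\<in>A. f b x \<odot>\<^bsub>N\<^esub> b))"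
      unfolding S_def
    proof (rule arg_cong[where f = "local_section U \<psi>"], rule ext)
      fix x
      show "(\<Oplus>\<^bsub>N\<^esub>b\<in>insert b A. f b x \<odot>\<^bsub>N\<^esub> b) = f b x \<odot>\<^bsub>L\<^esub> b \<oplus>\<^bsub>L\<^esub> (\<Oplus>\<^bsub>N\<^esub>b\<in>A. f b x \<odot>\<^bsub>N\<^esub> b)"
        using N.finsum_insert[of A b "\<lambda>b. f b x \<odot>\<^bsub>N\<^esub> b"] insert.hyps A \<nn>_smult by (auto simp: subset_eq)
    qed
    also have "\<dots> = local_section U \<psi> (\<lambda>x. f b x \<odot>\<^bsub>L\<^esub> b) \<oplus>\<^bsub>\<Gamma>\<^esub> S A"
      unfolding S_def using A \<nn>_carrier mem by (intro local_section_add[OF t]) auto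
    finally have eq: "S (insert b A) = local_section U \<psi> (\<lambda>x. f b x \<odot>\<^bsub>L\<^esub> b) \<oplus>\<^bsub>\<Gamma>\<^esub> S A" .
    have 1: "local_section U \<psi> (\<lambda>x. f b x \<odot>\<^bsub>L\<^esub> b) \<in> carrier \<Gamma>"
      using A \<nn>_carrier f0 by (intro local_section_in_sections[OF t _ f C(1,2)]) auto
    have 2: "\<pi> (local_section U \<psi> (\<lambda>x. f b x \<odot>\<^bsub>L\<^esub> b)) = \<zero>\<^bsub>P\<^esub>"
    proof (rule \<pi>_local_section_vanishes[OF t A(2) f[OF A(3)] \<eta> C(1,2) _ C(4)])
      show "\<eta> x * f b x = f b x" for x using \<eta>\<rho>[of x] by (auto simp: f_def)
    qed (use f0 in auto)
    have IH: "S A \<in> carrier \<Gamma>" "\<pi> (S A) = \<zero>\<^bsub>P\<^esub>" using insert by auto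
    show ?case unfolding eq using sections_add_closed[OF 1 IH(1)] \<pi>_add[OF 1 IH(1)] 2 IH(2) by simp
  qed
  from this[OF B(1)] have "\<pi> (S B) = \<zero>\<^bsub>P\<^esub>" by simp
  moreover have "S B = scaled \<rho> s"
  proof (rule extensionalityI[of _ M])
    show "S B \<in> extensional M" unfolding S_def by (rule local_section_extensional)
    show "scaled \<rho> s \<in> extensional M" by (simp add: scaled_def)
    fix x assume x: "x \<in> M"
    interpret F: lie_algebra "fiber K x" using x by (rule fiber_lie_algebra)
    have sx: "s x \<in> carrier (fiber K x)" using s x by (simp add: subbundle_sections_iff)
    show "S B x = scaled \<rho> s x"
    proof (cases "x \<in> U")
      case True
      then interpret h: lie_isomorphism "fiber K x" L "\<psi> x" by (rule trivialization_iso[OF t])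
      let ?w = "\<psi> x (s x)"
      have "(\<Oplus>\<^bsub>N\<^esub>b\<in>B. f b x \<odot>\<^bsub>N\<^esub> b) = (\<Oplus>\<^bsub>N\<^esub>b\<in>B. \<rho> x \<odot>\<^bsub>N\<^esub> (c b ?w \<odot>\<^bsub>N\<^esub> b))"
        using B \<nn>_smult \<nn>_carrier True
        by (intro N.finsum_cong') (auto simp: f_def L.smult_smult subset_eq)
      also have "\<dots> = \<rho> x \<odot>\<^bsub>N\<^esub> (\<Oplus>\<^bsub>N\<^esub>b\<in>B. c b ?w \<odot>\<^bsub>N\<^esub> b)"
        using B \<nn>_smult by (intro N.finsum_smult_ldistr[symmetric]) auto
      also have "\<dots> = \<rho> x \<odot>\<^bsub>L\<^esub> ?w" using rep[OF sn[OF True]] by simp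
      finally show ?thesis
        using True x sx by (simp add: S_def local_section_apply[OF t True] scaled_def h.inv_smult)
    next
      case False
      then have "\<rho> x = 0" using C(2,3) by blast
      then show ?thesis using False x sx by (simp add: S_def local_section_off scaled_def)
    qed
  qed
  ultimately show ?thesis by simp
qed

text \<open>Hides the trivialization, the set and \<eta> behind an existential, so that finite
  families of bumps can be chosen as plain functions.\<close>

definition trivializing_bump :: "('a \<Rightarrow> real) \<Rightarrow> bool" where
  "trivializing_bump \<rho> \<longleftrightarrow> (\<exists>U \<psi> \<eta> C. (U, \<psi>) \<in> trivializations K \<and> smooth_function X M \<rho> \<and>
     smooth_function X M \<eta> \<and> compactin (points X) C \<and> C \<subseteq> U \<and> (\<forall>x. x \<notin> C \<longrightarrow> \<rho> x = 0) \<and>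
     (\<forall>x. x \<notin> C \<longrightarrow> \<eta> x = 0) \<and> (\<forall>x. \<eta> x * \<rho> x = \<rho> x))"

text \<open>One bump is split off at a time: s = \<rho> s + (1 - \<rho>) s. The remainder is zero
  wherever \<rho> = 1, so at each point where it is nonzero one of the remaining functions equals 1.
  The claim is therefore made for all \<open>s\<close> at once; the functions need not add up to
  1.\<close>

lemma \<pi>_vanishes_if_covered:
  assumes "finite F"
    and "\<And>z. z \<in> F \<Longrightarrow> trivializing_bump (\<rho> z)"
    and "s \<in> carrier \<Gamma>N" "\<And>x. x \<in> M \<Longrightarrow> s x \<noteq> \<zero>\<^bsub>fiber K x\<^esub> \<Longrightarrow> \<exists>z\<in>F. \<rho> z x = 1"
  shows "\<pi> s = \<zero>\<^bsub>P\<^esub>"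
  using assms
proof (induction F arbitrary: s rule: finite_induct)
  case empty
  then show ?case using subbundle_sections_subset by (intro \<pi>_zero_section) auto
next
  case (insert z F)
  obtain U \<psi> \<eta> C where t: "(U, \<psi>) \<in> trivializations K" and \<rho>: "smooth_function X M (\<rho> z)"
    and \<eta>: "smooth_function X M \<eta>" "compactin (points X) C" "C \<subseteq> U" "\<forall>x. x \<notin> C \<longrightarrow> \<rho> z x = 0"
      "\<forall>x. x \<notin> C \<longrightarrow> \<eta> x = 0" "\<forall>x. \<eta> x * \<rho> z x = \<rho> z x"
    using insert.prems(1)[of z] unfolding trivializing_bump_def by blast
  let ?\<sigma> = "\<lambda>x. 1 + (-1) * \<rho> z x"
  have \<sigma>: "smooth_function X M ?\<sigma>"
    by (intro smooth_function_add smooth_function_mult smooth_function_const \<rho>)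
  have s1: "scaled (\<rho> z) s \<in> carrier \<Gamma>N" and s2: "scaled ?\<sigma> s \<in> carrier \<Gamma>N"
    using scaled_in_subbundle_sections insert.prems(2) \<rho> \<sigma> by auto
  have sx: "s x \<in> carrier (fiber K x)" if "x \<in> M" for x
    using insert.prems(2) that by (simp add: subbundle_sections_iff)
  have "\<pi> (scaled ?\<sigma> s) = \<zero>\<^bsub>P\<^esub>"
  proof (rule insert.IH[OF _ s2])
    fix x assume x: "x \<in> M" "scaled ?\<sigma> s x \<noteq> \<zero>\<^bsub>fiber K x\<^esub>"
    interpret F: lie_algebra "fiber K x" using x(1) by (rule fiber_lie_algebra)
    have "s x \<noteq> \<zero>\<^bsub>fiber K x\<^esub>" "\<rho> z x \<noteq> 1" using x sx by (auto simp: scaled_def)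
    then show "\<exists>z\<in>F. \<rho> z x = 1" using insert.prems(3) x(1) by blast
  qed (use insert.prems(1) in blast)
  moreover have "\<pi> (scaled (\<rho> z) s) = \<zero>\<^bsub>P\<^esub>"
    using \<eta> by (intro \<pi>_scaled_vanishes[OF t insert.prems(2) \<rho> \<eta>(1,2,3)]) auto
  moreover have "s = scaled (\<rho> z) s \<oplus>\<^bsub>\<Gamma>\<^esub> scaled ?\<sigma> s"
  proof (rule extensionalityI[OF _ sections_ops_extensional(1)])
    show "s \<in> extensional M" using insert.prems(2) by (simp add: subbundle_sections_iff)
    fix x assume x: "x \<in> M"
    interpret F: lie_algebra "fiber K x" using x by (rule fiber_lie_algebra)
    have "scaled (\<rho> z) s x \<oplus>\<^bsub>fiber K x\<^esub> scaled ?\<sigma> s x = (\<rho> z x + ?\<sigma> x) \<odot>\<^bsub>fiber K x\<^esub> s x"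
      using x sx by (simp only: scaled_def restrict_apply' F.smult_add_left)
    then show "s x = (scaled (\<rho> z) s \<oplus>\<^bsub>\<Gamma>\<^esub> scaled ?\<sigma> s) x"
      using x sx by (simp add: sections_add_apply)
  qed
  ultimately show ?case
    using \<pi>_add[of "scaled (\<rho> z) s" "scaled ?\<sigma> s"] s1 s2 subbundle_sections_subset by force
qed

text \<open>The bumps equal 1 on whole neighbourhoods, so compactness of the support selects
  finitely many of them that satisfy the covering condition of the previous lemma.\<close>

lemma \<pi>_subbundle_sections_vanishes:
  assumes s: "s \<in> carrier \<Gamma>N"
  shows "\<pi> s = \<zero>\<^bsub>P\<^esub>"
proof -
  let ?S = "section_support X K s"
  have comp: "compactin (points X) ?S" using s by (simp add: subbundle_sections_iff)
  have "\<exists>\<rho> Q. openin (points X) Q \<and> z \<in> Q \<and> (\<forall>y\<in>Q. \<rho> y = 1) \<and> trivializing_bump \<rho>"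
    if z: "z \<in> ?S" for z
  proof -
    have "z \<in> M" using z comp compactin_subset_topspace by blast
    then obtain U \<psi> where t: "(U, \<psi>) \<in> trivializations K" "z \<in> U" using trivialization_cover by blast
    obtain \<rho> \<eta> :: "'a \<Rightarrow> real" and Q C where
      bump: "smooth_function X M \<rho>" "smooth_function X M \<eta>"
        "openin (points X) Q" "z \<in> Q" "\<And>y. y \<in> Q \<Longrightarrow> \<rho> y = 1" "compactin (points X) C" "C \<subseteq> U"
        "\<And>y. y \<notin> C \<Longrightarrow> \<rho> y = 0" "\<And>y. y \<notin> C \<Longrightarrow> \<eta> y = 0" "\<And>y. \<eta> y * \<rho> y = \<rho> y"
      using bump_functions[OF trivialization_openin[OF t(1)] t(2)] by blast
    then have "trivializing_bump \<rho>" using t(1) unfolding trivializing_bump_def by blast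
    then show ?thesis using bump(3,4,5) by blast
  qed
  then obtain \<rho> Q where Q: "\<And>z. z \<in> ?S \<Longrightarrow> openin (points X) (Q z)" "\<And>z. z \<in> ?S \<Longrightarrow> z \<in> Q z"
      "\<And>z y. z \<in> ?S \<Longrightarrow> y \<in> Q z \<Longrightarrow> \<rho> z y = 1" and \<rho>: "\<And>z. z \<in> ?S \<Longrightarrow> trivializing_bump (\<rho> z)"
    by metis
  have "\<exists>\<F>. finite \<F> \<and> \<F> \<subseteq> Q ` ?S \<and> ?S \<subseteq> \<Union>\<F>"
  proof (rule compactinD[OF comp])
    show "openin (points X) T" if "T \<in> Q ` ?S" for T using that Q(1) by blast
    show "?S \<subseteq> \<Union>(Q ` ?S)" using Q(2) by blast
  qed
  then obtain F where F: "finite F" "F \<subseteq> ?S" "?S \<subseteq> (\<Union>z\<in>F. Q z)"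
    by (metis finite_subset_image)
  show ?thesis
  proof (rule \<pi>_vanishes_if_covered[OF F(1) _ s])
    fix x assume "x \<in> M" "s x \<noteq> \<zero>\<^bsub>fiber K x\<^esub>"
    then have "x \<in> ?S" using section_zero_off_support by blast
    then show "\<exists>z\<in>F. \<rho> z x = 1" using F Q(3) by blast
  qed (use \<rho> F(2) in blast)
qed

end

theorem corollary5p3:
  fixes X :: "('m, 'e::euclidean_space) manifold"
    and \<kk> :: "(real, 'g) module"
    and K :: "('m, 'b, 'g) fiber_bundle"
    and \<nn> :: "'g set"
    and \<pi> :: "('m \<Rightarrow> 'b) \<Rightarrow> ('h::complex_hilbert_space \<Rightarrow>\<^sub>L 'h) set"
  assumes "smooth_manifold X"
    and "sigma_compact_space (points X)"
    and "compactin (points X) (manifold_boundary X)"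
    and "lie_algebra \<kk>" and "finite_dimensional \<kk>"
    and "lie_algebra_bundle X \<kk> K"
    and "minimal_cocompact_ideal \<nn> \<kk>"
    and "bounded_projective_unitary_rep X \<kk> K \<pi>"
  shows "carrier (compact_sections X (\<kk>\<lparr>carrier := \<nn>\<rparr>) (subbundle K \<nn>))
    \<subseteq> a_kernel (compact_sections X \<kk> K) projective_skew_hermitian_algebra \<pi>"
proof -
  have "lie_ideal \<nn> \<kk>" using assms(7) by (simp add: minimal_cocompact_ideal_def)
  moreover have "\<pi> \<in> lie_hom (compact_sections X \<kk> K) projective_skew_hermitian_algebra"
    using assms(8) by (simp add: bounded_projective_unitary_rep_def)
  ultimately interpret projective_rep X \<kk> K \<nn> \<pi>
    using assms(1,4-7)
    by (intro projective_rep.intro lie_subbundle.intro lie_algebra_bundle_over.intro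
      manifold_with_boundary.intro lie_algebra_bundle_over_axioms.intro lie_subbundle_axioms.intro
      projective_rep_axioms.intro)
  show ?thesis
    unfolding a_kernel_def' using subbundle_sections_subset \<pi>_subbundle_sections_vanishes by blast
qed

end
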